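(* There is an absolute constant $K>0$ such that the following holds. Let $U_{AB}$ be a unitary acting on $n$ qubits in total (split between Alice's input system $A$ and Bob's input system $B$) which admits a Clifford$+T$ decomposition of $T$-depth $d$. Then \[ E(U_{AB}) \le O\big((Kn)^d\big), \] where $E(U_{AB})$ denotes the number of EPR pairs needed to implement $U_{AB}$ as a non-local quantum computation.
   Context: A non-local quantum computation (NLQC) with inputs $A$ (held by Alice) and $B$ (held by Bob) and outputs $A$ (Alice) and $B$ (Bob) is a channel of the form $\mathcal{N}_{AB\to AB}(\cdot)=(\mathcal{W}_{K_aM_a\to A}\otimes\mathcal{W}'_{K_bM_b\to B})\circ(\mathcal{V}_{AL\to K_aM_b}\otimes\mathcal{V}'_{RB\to M_aK_b})(\cdot\otimes\Psi_{LR})$, where $\Psi_{LR}$ is a shared resource state with $L$ held by Alice and $R$ by Bob and $\mathcal{V},\mathcal{V}',\mathcal{W},\mathcal{W}'$ are quantum channels: each party acts locally, they exchange one simultaneous round of quantum communication ($M_b$ sent Alice$\to$Bob, $M_a$ sent Bob$\to$Alice), and act locally again. $E(U)$ is the minimal number of EPR pairs (maximally entangled qubit pairs) forming the resource state of an NLQC whose channel equals $\rho\mapsto U\rho U^\dagger$. A Clifford$+T$ decomposition of $T$-depth $d$ is a factorization $U=C_{d+1}\bar T_d C_d\bar T_{d-1}\cdots \bar T_1 C_1$ where each $C_i$ is a Clifford unitary on all $n$ qubits and each $\bar T_i$ is a layer consisting of single-qubit $T=\mathrm{diag}(1,e^{i\pi/4})$ gates on some subset of the qubits.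
   Formalization: The T-depth d is assumed to be at least 1; for d = 0 the stated bound would be O(1) EPR pairs for every Clifford, which fails (k CNOTs across the split need at least k/2 EPR pairs). *)

theory Defs
  imports Complex_Main "Jordan_Normal_Form.Matrix"
begin

definition adj :: "complex mat \<Rightarrow> complex mat" where
  "adj A = mat (dim_col A) (dim_row A) (\<lambda>(i,j). cnj (A $$ (j,i)))"

definition is_unitary :: "nat \<Rightarrow> complex mat \<Rightarrow> bool" where
  "is_unitary N U \<longleftrightarrow> U \<in> carrier_mat N N \<and> adj U * U = 1\<^sub>m N"

text \<open>Kronecker (tensor) product; the first factor is the most significant index.\<close>
definition kron :: "complex mat \<Rightarrow> complex mat \<Rightarrow> complex mat" where
  "kron A B = mat (dim_row A * dim_row B) (dim_col A * dim_col B)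
     (\<lambda>(i,j). A $$ (i div dim_row B, j div dim_col B) * B $$ (i mod dim_row B, j mod dim_col B))"

fun kron_list :: "complex mat list \<Rightarrow> complex mat" where
  "kron_list [] = 1\<^sub>m 1"
| "kron_list (A # As) = kron A (kron_list As)"

text \<open>Swap of two tensor factors of dimensions d1, d2: |i>|j> goes to |j>|i>.\<close>
definition swap_mat :: "nat \<Rightarrow> nat \<Rightarrow> complex mat" where
  "swap_mat d1 d2 = mat (d1 * d2) (d1 * d2)
     (\<lambda>(r,c). if r = (c mod d2) * d1 + c div d2 then 1 else 0)"

definition is_channel :: "nat \<Rightarrow> nat \<Rightarrow> complex mat list \<Rightarrow> bool" where
  "is_channel din dout Ks \<longleftrightarrow>
     (\<forall>K \<in> set Ks. K \<in> carrier_mat dout din) \<and>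
     foldr (\<lambda>K acc. adj K * K + acc) Ks (0\<^sub>m din din) = 1\<^sub>m din"

definition apply_channel :: "nat \<Rightarrow> complex mat list \<Rightarrow> complex mat \<Rightarrow> complex mat" where
  "apply_channel dout Ks \<rho> = foldr (\<lambda>K acc. K * \<rho> * adj K + acc) Ks (0\<^sub>m dout dout)"

definition tensor_channel :: "complex mat list \<Rightarrow> complex mat list \<Rightarrow> complex mat list" where
  "tensor_channel Ks Ls = concat (map (\<lambda>K. map (\<lambda>L. kron K L) Ls) Ks)"

text \<open>Density matrix of m EPR pairs, with L = Alice's m halves and R = Bob's m halves;
  as a state on L (x) R this is the maximally entangled state 2^(-m/2) sum_x |x>_L |x>_R.\<close>
definition epr_state :: "nat \<Rightarrow> complex mat" where
  "epr_state m = mat (2^m * 2^m) (2^m * 2^m)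
     (\<lambda>(r,c). if r div 2^m = r mod 2^m \<and> c div 2^m = c mod 2^m
              then 1 / of_nat (2^m) else 0)"

text \<open>Alice's input A is a qubits, Bob's input B is b qubits; the global ordering is A (x) B.
  V : A L -> K_a M_b (Alice), V' : R B -> M_a K_b (Bob), W : K_a M_a -> A, W' : K_b M_b -> B.\<close>
definition nlqc_channel ::
  "nat \<Rightarrow> nat \<Rightarrow> nat \<Rightarrow> nat \<Rightarrow> nat \<Rightarrow> nat \<Rightarrow> nat \<Rightarrow>
   complex mat list \<Rightarrow> complex mat list \<Rightarrow> complex mat list \<Rightarrow> complex mat list \<Rightarrow>
   complex mat \<Rightarrow> complex mat" where
  "nlqc_channel a b m dKa dMa dKb dMb V V' W W' \<rho> =
     (let dA = 2^a; dB = 2^b; dL = 2^m;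
          \<sigma>0 = kron \<rho> (epr_state m);
          P1 = kron (1\<^sub>m dA) (swap_mat dB (dL * dL));
          \<sigma>1 = P1 * \<sigma>0 * adj P1;
          \<sigma>2 = apply_channel (dKa * dMb * (dMa * dKb)) (tensor_channel V V') \<sigma>1;
          P2 = kron (1\<^sub>m dKa) (swap_mat dMb (dMa * dKb));
          \<sigma>3 = P2 * \<sigma>2 * adj P2
      in apply_channel (dA * dB) (tensor_channel W W') \<sigma>3)"

definition nlqc_implements :: "nat \<Rightarrow> nat \<Rightarrow> nat \<Rightarrow> complex mat \<Rightarrow> bool" where
  "nlqc_implements a b m U \<longleftrightarrow>
     (\<exists>dKa dMa dKb dMb V V' W W'.
        is_channel (2^a * 2^m) (dKa * dMb) V \<and>
        is_channel (2^m * 2^b) (dMa * dKb) V' \<and>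
        is_channel (dKa * dMa) (2^a) W \<and>
        is_channel (dKb * dMb) (2^b) W' \<and>
        (\<forall>\<rho> \<in> carrier_mat (2^a * 2^b) (2^a * 2^b).
           nlqc_channel a b m dKa dMa dKb dMb V V' W W' \<rho> = U * \<rho> * adj U))"

definition E_nlqc :: "nat \<Rightarrow> nat \<Rightarrow> complex mat \<Rightarrow> nat" where
  "E_nlqc a b U = (LEAST m. nlqc_implements a b m U)"

definition pauli_I :: "complex mat" where "pauli_I = mat_of_rows_list 2 [[1,0],[0,1]]"
definition pauli_X :: "complex mat" where "pauli_X = mat_of_rows_list 2 [[0,1],[1,0]]"
definition pauli_Y :: "complex mat" where "pauli_Y = mat_of_rows_list 2 [[0,-\<i>],[\<i>,0]]"
definition pauli_Z :: "complex mat" where "pauli_Z = mat_of_rows_list 2 [[1,0],[0,-1]]"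
definition T_gate :: "complex mat" where "T_gate = mat_of_rows_list 2 [[1,0],[0,cis (pi/4)]]"

definition pauli_string :: "nat \<Rightarrow> complex mat \<Rightarrow> bool" where
  "pauli_string n P \<longleftrightarrow> (\<exists>ps. length ps = n \<and> set ps \<subseteq> {pauli_I, pauli_X, pauli_Y, pauli_Z}
                                 \<and> P = kron_list ps)"

definition clifford :: "nat \<Rightarrow> complex mat \<Rightarrow> bool" where
  "clifford n C \<longleftrightarrow> is_unitary (2^n) C \<and>
     (\<forall>P. pauli_string n P \<longrightarrow>
        (\<exists>Q c. pauli_string n Q \<and> c \<in> {1, -1, \<i>, -\<i>} \<and> C * P * adj C = c \<cdot>\<^sub>m Q))"

definition T_layer :: "nat \<Rightarrow> nat set \<Rightarrow> complex mat" where
  "T_layer n S = kron_list (map (\<lambda>j. if j \<in> S then T_gate else pauli_I) [0..<n])"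

text \<open>ct_circuit n Cs Ss k = C_(k+1) Tbar_k C_k ... Tbar_1 C_1, with C_(i+1) = Cs i, Tbar_(i+1) from Ss i.\<close>
fun ct_circuit :: "nat \<Rightarrow> (nat \<Rightarrow> complex mat) \<Rightarrow> (nat \<Rightarrow> nat set) \<Rightarrow> nat \<Rightarrow> complex mat" where
  "ct_circuit n Cs Ss 0 = Cs 0"
| "ct_circuit n Cs Ss (Suc k) = Cs (Suc k) * T_layer n (Ss k) * ct_circuit n Cs Ss k"

definition has_CT_decomposition :: "nat \<Rightarrow> nat \<Rightarrow> complex mat \<Rightarrow> bool" where
  "has_CT_decomposition n d U \<longleftrightarrow>
     (\<exists>Cs Ss. (\<forall>i\<le>d. clifford n (Cs i)) \<and> (\<forall>i<d. Ss i \<subseteq> {..<n}) \<and>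
              U = ct_circuit n Cs Ss d)"

end

theory Submission
  imports Defs "HOL-Combinatorics.Permutations"
begin

text \<open>Bob teleports his input to Alice, who runs the circuit on her own. Her data is then encrypted
  by a Pauli key whose bits depend on the measurement outcomes of both parties. Clifford gates act on
  the key additively; a T gate on a wire with X-key bit \<open>f\<close> leaves a phase gate \<open>S\<^sup>f\<close> that must be undone
  although neither party knows \<open>f\<close>. For this the wire is routed through rails that are teleported back and
  forth: a network of rail permutations, each controlled by the outcomes of one party, takes rail 0 to
  rail \<open>f\<close>; the inverse phase gate is applied on rail 1, and the inverse network returns the wire to rail 0.
  The teleportations cause new Pauli errors on the wire, which depend on the rails that it visited.
  Splitting each rail into eight, the same network can track these errors, so (computing, copying,
  uncomputing) the new key bits are again computed by networks. One layer of T gates multiplies the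
  length of the networks by \<open>O(n)\<close> and the number of rails by 8, whence \<open>O((K n)\<^sup>d)\<close> EPR pairs. At the end the
  outcomes are exchanged together with Bob's part of the data, and both parties remove the key.\<close>

section \<open>Channels given by Kraus operators\<close>

text \<open>With a single exchange, every measurement precedes any knowledge of the other party's
  outcomes, so corrections must be arranged blindly. The phase gate arises because T X equals S X T
  up to a phase. The bit f mixes outcomes of both parties, but each party can choose permutations by
  its own outcomes, and an alternating product of such permutations can compute f. An error bit is
  read off at a rail whose position already depends on both histories; so key bits cease to be sums
  of a bit of Alice and a bit of Bob, and the networks have to alternate more and more often. Growth
  stays multiplicative per layer: a T gate changes the key only on its own wire, so all gates of a
  layer use networks for the key at the beginning of that layer. Networks are kept for every linear
  functional of the key, which makes Clifford layers free. If L bounds their length, each T gate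
  adds at most 8 L + 3 steps, so L becomes at most (11 n + 1) L. The number of rails is fixed in
  advance as 2 * 8^d.\<close>

lemma sum_lessThan_mult:
  fixes f :: "nat \<Rightarrow> 'a::comm_monoid_add"
  shows "(\<Sum>r<d1 * d2. f r) = (\<Sum>i<d1. \<Sum>j<d2. f (i * d2 + j))"
proof (induction d1)
  case (Suc d1)
  have "(\<Sum>r<Suc d1 * d2. f r) = (\<Sum>r<d1 * d2. f r) + (\<Sum>r=d1*d2..<d1*d2+d2. f r)"
    by (metis add.commute atLeast0LessThan le_add2 le0 mult_Suc sum.atLeastLessThan_concat)
  also have "(\<Sum>r=d1*d2..<d1*d2+d2. f r) = (\<Sum>j<d2. f (d1 * d2 + j))"
    using sum.shift_bounds_nat_ivl[of f 0 "d1*d2" d2] by (simp add: atLeast0LessThan add.commute)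
  finally show ?case using Suc by simp
qed simp

lemma sum_if_const:
  "(\<Sum>x\<in>A. if P then f x else 0) = (if P then sum f A else (0 :: 'a :: comm_monoid_add))"
  by simp

lemma pair_index_less:
  fixes i j d1 d2 :: nat
  assumes "i < d1" "j < d2"
  shows "i * d2 + j < d1 * d2"
proof -
  have "i * d2 + j < Suc i * d2" using assms by simp
  also have "\<dots> \<le> d1 * d2" using assms by (intro mult_le_mono1) simp
  finally show ?thesis .
qed

lemma pair_index_cases:
  fixes r d1 d2 :: nat
  assumes "r < d1 * d2"
  obtains i j where "i < d1" "j < d2" "r = i * d2 + j"
proof
  have "d2 > 0" using assms by (cases d2) auto
  then show "r mod d2 < d2" by simp
  show "r div d2 < d1" using assms by (simp add: less_mult_imp_div_less)
  show "r = r div d2 * d2 + r mod d2" by simp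
qed

lemma pair_index_eq_iff:
  fixes i j d2 :: nat
  assumes "j < d2" "j' < d2"
  shows "i * d2 + j = i' * d2 + j' \<longleftrightarrow> i = i' \<and> j = j'"
  by (metis assms div_mult_self3 div_less add.commute add_0 mod_less mod_mult_self3
      less_nat_zero_code)

section \<open>Adjoints and Kronecker products, entry by entry\<close>

lemma adj_dim [simp]: "dim_row (adj A) = dim_col A" "dim_col (adj A) = dim_row A"
  by (simp_all add: adj_def)

lemma adj_carrier [simp]: "A \<in> carrier_mat n m \<Longrightarrow> adj A \<in> carrier_mat m n"
  by (auto simp: adj_def)

lemma adj_index [simp]:
  "i < dim_col A \<Longrightarrow> j < dim_row A \<Longrightarrow> adj A $$ (i, j) = cnj (A $$ (j, i))"
  by (simp add: adj_def)

lemma gram_carrier: "K \<in> carrier_mat m n \<Longrightarrow> adj K * K \<in> carrier_mat n n"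
  by (meson adj_carrier mult_carrier_mat)

lemma conjugate_carrier:
  "K \<in> carrier_mat m n \<Longrightarrow> \<rho> \<in> carrier_mat n n \<Longrightarrow> K * \<rho> * adj K \<in> carrier_mat m m"
  by (meson adj_carrier mult_carrier_mat)

lemma mult_mat_index:
  assumes "A \<in> carrier_mat n k" "B \<in> carrier_mat k m" "i < n" "j < m"
  shows "(A * B) $$ (i, j) = (\<Sum>l<k. A $$ (i, l) * B $$ (l, j))"
  using assms by (simp add: scalar_prod_def atLeast0LessThan)

lemma adj_mult:
  assumes "A \<in> carrier_mat n k" "B \<in> carrier_mat k m"
  shows "adj (A * B) = adj B * adj A"
proof (rule eq_matI)
  fix i j assume "i < dim_row (adj B * adj A)" "j < dim_col (adj B * adj A)"
  then have ij: "i < m" "j < n" using assms by auto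
  have "adj (A * B) $$ (i, j) = cnj ((A * B) $$ (j, i))" using ij assms by simp
  also have "\<dots> = (\<Sum>l<k. cnj (A $$ (j, l)) * cnj (B $$ (l, i)))"
    using mult_mat_index[OF assms ij(2,1)] by (simp add: cnj_sum)
  also have "\<dots> = (adj B * adj A) $$ (i, j)"
    using assms ij by (subst mult_mat_index[of _ m k _ n]) (auto simp: mult.commute intro!: sum.cong)
  finally show "adj (A * B) $$ (i, j) = (adj B * adj A) $$ (i, j)" .
qed (use assms in auto)

lemma kron_dim [simp]:
  "dim_row (kron A B) = dim_row A * dim_row B" "dim_col (kron A B) = dim_col A * dim_col B"
  by (simp_all add: kron_def)

lemma kron_carrier:
  "A \<in> carrier_mat n m \<Longrightarrow> B \<in> carrier_mat n' m' \<Longrightarrow> kron A B \<in> carrier_mat (n * n') (m * m')"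
  by (auto simp: kron_def)

lemma kron_index:
  assumes "A \<in> carrier_mat n m" "B \<in> carrier_mat n' m'" "i < n" "i' < n'" "j < m" "j' < m'"
  shows "kron A B $$ (i * n' + i', j * m' + j') = A $$ (i, j) * B $$ (i', j')"
proof -
  have "i * n' + i' < n * n'" "j * m' + j' < m * m'"
    using assms by (auto intro: pair_index_less)
  moreover have "(i * n' + i') div n' = i" "(j * m' + j') div m' = j"
    using assms by auto
  ultimately show ?thesis using assms by (simp add: kron_def)
qed

lemma kron_mult:
  assumes "A \<in> carrier_mat n k" "B \<in> carrier_mat n' k'"
    and "C \<in> carrier_mat k m" "D \<in> carrier_mat k' m'"
  shows "kron A B * kron C D = kron (A * C) (B * D)"
proof (rule eq_matI)
  fix r c assume "r < dim_row (kron (A * C) (B * D))" "c < dim_col (kron (A * C) (B * D))"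
  then have rc: "r < n * n'" "c < m * m'" using assms by auto
  obtain i i' where i: "i < n" "i' < n'" "r = i * n' + i'" using rc(1) by (rule pair_index_cases)
  obtain j j' where j: "j < m" "j' < m'" "c = j * m' + j'" using rc(2) by (rule pair_index_cases)
  have "(kron A B * kron C D) $$ (r, c) = (\<Sum>l<k * k'. kron A B $$ (r, l) * kron C D $$ (l, c))"
    using assms rc by (intro mult_mat_index kron_carrier) auto
  also have "\<dots> = (\<Sum>l<k. \<Sum>l'<k'. (A $$ (i, l) * C $$ (l, j)) * (B $$ (i', l') * D $$ (l', j')))"
    unfolding sum_lessThan_mult i j
    by (intro sum.cong refl)
       (simp add: kron_index[OF assms(1,2) i(1,2)] kron_index[OF assms(3,4) _ _ j(1,2)])
  also have "\<dots> = (A * C) $$ (i, j) * (B * D) $$ (i', j')"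
    by (simp add: mult_mat_index[OF assms(1,3) i(1) j(1)] mult_mat_index[OF assms(2,4) i(2) j(2)]
        sum_product)
  also have "\<dots> = kron (A * C) (B * D) $$ (r, c)"
    unfolding i j using assms i j by (subst kron_index[of _ n m _ n' m']) auto
  finally show "(kron A B * kron C D) $$ (r, c) = kron (A * C) (B * D) $$ (r, c)" .
qed (use assms in auto)

lemma adj_kron: "adj (kron A B) = kron (adj A) (adj B)"
proof (rule eq_matI)
  fix r c assume rc: "r < dim_row (kron (adj A) (adj B))" "c < dim_col (kron (adj A) (adj B))"
  then have "r div dim_col B < dim_col A" "c div dim_row B < dim_row A"
    by (simp_all add: less_mult_imp_div_less)
  moreover have "r mod dim_col B < dim_col B" "c mod dim_row B < dim_row B"
    using rc by (metis adj_dim kron_dim less_nat_zero_code mod_less_divisor mult_0_right not_gr0)+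
  ultimately show "adj (kron A B) $$ (r, c) = kron (adj A) (adj B) $$ (r, c)"
    using rc by (simp add: kron_def)
qed auto

lemma kron_one: "kron (1\<^sub>m n) (1\<^sub>m m) = 1\<^sub>m (n * m)"
proof (rule eq_matI)
  fix r c assume "r < dim_row (1\<^sub>m (n * m))" "c < dim_col (1\<^sub>m (n * m))"
  then have rc: "r < n * m" "c < n * m" by auto
  obtain i i' where i: "i < n" "i' < m" "r = i * m + i'" using rc(1) by (rule pair_index_cases)
  obtain j j' where j: "j < n" "j' < m" "c = j * m + j'" using rc(2) by (rule pair_index_cases)
  show "kron (1\<^sub>m n) (1\<^sub>m m) $$ (r, c) = 1\<^sub>m (n * m) $$ (r, c)"
    unfolding i j using i j
    by (subst kron_index[of _ n n _ m m]) (auto simp: pair_index_less pair_index_eq_iff)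
qed auto

section \<open>Completeness, composition and tensor products of Kraus families\<close>

lemma foldr_add_mat_carrier:
  assumes "\<And>x. x \<in> set xs \<Longrightarrow> f x \<in> carrier_mat n m"
  shows "foldr (\<lambda>x acc. f x + acc) xs (0\<^sub>m n m) \<in> carrier_mat n m"
  using assms by (induction xs) auto

lemma foldr_add_mat_index:
  assumes "\<And>x. x \<in> set xs \<Longrightarrow> f x \<in> carrier_mat n m" "i < n" "j < m"
  shows "foldr (\<lambda>x acc. f x + acc) xs (0\<^sub>m n m) $$ (i, j) = (\<Sum>x\<leftarrow>xs. f x $$ (i, j))"
  using assms
proof (induction xs)
  case (Cons x xs)
  have "foldr (\<lambda>x acc. f x + acc) xs (0\<^sub>m n m) \<in> carrier_mat n m"
    using Cons.prems by (intro foldr_add_mat_carrier) auto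
  then show ?case using Cons by auto
qed simp

lemma is_channel_iff:
  "is_channel din dout Ks \<longleftrightarrow> (\<forall>K\<in>set Ks. K \<in> carrier_mat dout din) \<and>
     (\<forall>i<din. \<forall>j<din. (\<Sum>K\<leftarrow>Ks. (adj K * K) $$ (i, j)) = (if i = j then 1 else 0))"
proof (cases "\<forall>K\<in>set Ks. K \<in> carrier_mat dout din")
  case True
  then have c: "\<And>K. K \<in> set Ks \<Longrightarrow> adj K * K \<in> carrier_mat din din"
    by (blast intro: gram_carrier)
  let ?F = "foldr (\<lambda>K acc. adj K * K + acc) Ks (0\<^sub>m din din)"
  have F: "?F \<in> carrier_mat din din" using c by (rule foldr_add_mat_carrier)
  have "?F = 1\<^sub>m din \<longleftrightarrow> (\<forall>i<din. \<forall>j<din. ?F $$ (i, j) = 1\<^sub>m din $$ (i, j))"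
    using F by (auto intro!: eq_matI)
  also have "\<dots> \<longleftrightarrow> (\<forall>i<din. \<forall>j<din. (\<Sum>K\<leftarrow>Ks. (adj K * K) $$ (i, j)) = (if i = j then 1 else 0))"
  proof -
    have "?F $$ (i, j) = (\<Sum>K\<leftarrow>Ks. (adj K * K) $$ (i, j))" if "i < din" "j < din" for i j
      using that by (intro foldr_add_mat_index c)
    then show ?thesis by (simp del: index_mult_mat(1))
  qed
  finally show ?thesis using True by (simp add: is_channel_def)
qed (auto simp: is_channel_def)

lemma is_channel_single:
  assumes "P \<in> carrier_mat m n" "adj P * P = 1\<^sub>m n"
  shows "is_channel n m [P]"
  using assms by (simp add: is_channel_iff)

lemma gram_index:
  assumes "K \<in> carrier_mat n m" "i < m" "j < m"
  shows "(adj K * K) $$ (i, j) = (\<Sum>r<n. cnj (K $$ (r, i)) * K $$ (r, j))"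
  using assms by (subst mult_mat_index[of _ m n _ m]) auto

lemma apply_channel_carrier:
  assumes "\<And>K. K \<in> set Ks \<Longrightarrow> K \<in> carrier_mat m n" "\<rho> \<in> carrier_mat n n"
  shows "apply_channel m Ks \<rho> \<in> carrier_mat m m"
  unfolding apply_channel_def using assms by (intro foldr_add_mat_carrier conjugate_carrier)

lemma apply_channel_single:
  assumes "P \<in> carrier_mat m n" "\<rho> \<in> carrier_mat n n"
  shows "apply_channel m [P] \<rho> = P * \<rho> * adj P"
  using assms by (auto simp: apply_channel_def)

lemma apply_channel_append:
  assumes "\<And>K. K \<in> set (Ks @ Ls) \<Longrightarrow> K \<in> carrier_mat m n" "\<rho> \<in> carrier_mat n n"
  shows "apply_channel m (Ks @ Ls) \<rho> = apply_channel m Ks \<rho> + apply_channel m Ls \<rho>"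
  using assms(1)
proof (induction Ks)
  case Nil
  then have "apply_channel m Ls \<rho> \<in> carrier_mat m m"
    using assms(2) by (intro apply_channel_carrier) auto
  then show ?case by (simp add: apply_channel_def)
next
  case (Cons K Ks)
  have c: "apply_channel m Ls \<rho> \<in> carrier_mat m m" "apply_channel m Ks \<rho> \<in> carrier_mat m m"
    "K * \<rho> * adj K \<in> carrier_mat m m"
    using assms(2) Cons.prems by (auto intro!: apply_channel_carrier conjugate_carrier)
  have "apply_channel m ((K # Ks) @ Ls) \<rho> = K * \<rho> * adj K + apply_channel m (Ks @ Ls) \<rho>"
    by (simp add: apply_channel_def)
  also have "\<dots> = K * \<rho> * adj K + apply_channel m Ks \<rho> + apply_channel m Ls \<rho>"
    using Cons c by (simp add: assoc_add_mat[OF c(3,2,1)])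
  finally show ?case by (simp add: apply_channel_def)
qed

definition comp_channel :: "complex mat list \<Rightarrow> complex mat list \<Rightarrow> complex mat list" where
  "comp_channel Ls Ks = concat (map (\<lambda>L. map (\<lambda>K. L * K) Ks) Ls)"

lemma sum_list_concat_map:
  fixes g :: "'a \<Rightarrow> 'b::comm_monoid_add"
  shows "(\<Sum>x\<leftarrow>concat (map (\<lambda>l. map (h l) ks) ls). g x) = (\<Sum>l\<leftarrow>ls. \<Sum>k\<leftarrow>ks. g (h l k))"
  by (induction ls) (auto simp: comp_def)

lemma sum_list_swap_sum:
  fixes g :: "'a \<Rightarrow> 'b \<Rightarrow> 'c::comm_monoid_add"
  shows "(\<Sum>x\<leftarrow>xs. sum (g x) S) = (\<Sum>s\<in>S. \<Sum>x\<leftarrow>xs. g x s)"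
  by (induction xs) (auto simp: sum.distrib)

lemma sum_list_swap:
  fixes g :: "'a \<Rightarrow> 'b \<Rightarrow> 'c::comm_monoid_add"
  shows "(\<Sum>x\<leftarrow>xs. \<Sum>y\<leftarrow>ys. g x y) = (\<Sum>y\<leftarrow>ys. \<Sum>x\<leftarrow>xs. g x y)"
  by (induction xs) (auto simp: sum_list_addf)

lemma comp_channel_is_channel:
  assumes "is_channel n k Ks" "is_channel k m Ls"
  shows "is_channel n m (comp_channel Ls Ks)"
  unfolding is_channel_iff
proof (intro conjI allI impI)
  have K: "\<And>K. K \<in> set Ks \<Longrightarrow> K \<in> carrier_mat k n" and L: "\<And>L. L \<in> set Ls \<Longrightarrow> L \<in> carrier_mat m k"
    using assms by (auto simp: is_channel_def)
  show "\<forall>M\<in>set (comp_channel Ls Ks). M \<in> carrier_mat m n"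
    using K L by (auto simp: comp_channel_def intro: mult_carrier_mat)
  fix i j assume ij: "i < n" "j < n"
  \<comment> \<open>Isolates the inner factor \<open>adj L * L\<close>, so that for fixed
    \<open>K\<close> the sum over \<open>L\<close> can be taken by completeness of
    \<open>Ls\<close>.\<close>
  have LK: "(adj (L * K) * (L * K)) $$ (i, j)
      = (\<Sum>p<k. \<Sum>q<k. (cnj (K $$ (p, i)) * K $$ (q, j)) * (adj L * L) $$ (p, q))"
    if "L \<in> set Ls" "K \<in> set Ks" for L K
  proof -
    note c = K[OF that(2)] L[OF that(1)]
    have "adj (L * K) * (L * K) = adj K * (adj L * L * K)"
      using c by (simp add: adj_mult[OF c(2,1)]
          assoc_mult_mat[of _ n k _ m _ n] assoc_mult_mat[of _ k m _ k _ n])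
    also have "\<dots> $$ (i, j) = (\<Sum>p<k. adj K $$ (i, p) * (\<Sum>q<k. (adj L * L) $$ (p, q) * K $$ (q, j)))"
      using c ij by (subst mult_mat_index[of _ n k _ n])
        (auto intro!: sum.cong mult_mat_index[of _ k k _ n] gram_carrier simp del: index_mult_mat(1))
    finally show ?thesis using c ij
      by (auto simp: sum_distrib_left mult_ac intro!: sum.cong simp del: index_mult_mat(1))
  qed
  have "(\<Sum>M\<leftarrow>comp_channel Ls Ks. (adj M * M) $$ (i, j))
     = (\<Sum>L\<leftarrow>Ls. \<Sum>K\<leftarrow>Ks. (adj (L * K) * (L * K)) $$ (i, j))"
    unfolding comp_channel_def by (rule sum_list_concat_map)
  also have "\<dots> = (\<Sum>L\<leftarrow>Ls. \<Sum>K\<leftarrow>Ks. \<Sum>p<k. \<Sum>q<k. (cnj (K $$ (p, i)) * K $$ (q, j)) * (adj L * L) $$ (p, q))"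
    by (intro arg_cong[where f=sum_list] map_cong refl LK)
  also have "\<dots> = (\<Sum>K\<leftarrow>Ks. \<Sum>p<k. \<Sum>q<k. (cnj (K $$ (p, i)) * K $$ (q, j)) * (\<Sum>L\<leftarrow>Ls. (adj L * L) $$ (p, q)))"
    by (subst sum_list_swap) (simp only: sum_list_swap_sum sum_list_const_mult)
  also have "\<dots> = (\<Sum>K\<leftarrow>Ks. \<Sum>p<k. \<Sum>q<k. (cnj (K $$ (p, i)) * K $$ (q, j)) * (if p = q then 1 else 0))"
    using assms(2) unfolding is_channel_iff
    by (intro arg_cong[where f=sum_list] map_cong refl sum.cong) (simp del: index_mult_mat(1))
  also have "\<dots> = (\<Sum>K\<leftarrow>Ks. \<Sum>p<k. cnj (K $$ (p, i)) * K $$ (p, j))"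
    by (simp add: if_distrib cong: if_cong)
  also have "\<dots> = (\<Sum>K\<leftarrow>Ks. (adj K * K) $$ (i, j))"
    using K ij by (intro arg_cong[where f=sum_list] map_cong refl) (simp add: gram_index[of _ k n])
  finally show "(\<Sum>M\<leftarrow>comp_channel Ls Ks. (adj M * M) $$ (i, j)) = (if i = j then 1 else 0)"
    using assms(1) ij by (simp add: is_channel_iff del: index_mult_mat(1))
qed

lemma apply_comp_channel:
  assumes "\<And>K. K \<in> set Ks \<Longrightarrow> K \<in> carrier_mat k n" "\<And>L. L \<in> set Ls \<Longrightarrow> L \<in> carrier_mat m k"
    and "\<rho> \<in> carrier_mat n n"
  shows "apply_channel m Ls (apply_channel k Ks \<rho>) = apply_channel m (comp_channel Ls Ks) \<rho>"
proof -
  have *: "L * apply_channel k Ks \<rho> * adj L = apply_channel m (map (\<lambda>K. L * K) Ks) \<rho>"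
    if L: "L \<in> carrier_mat m k" for L
    using assms(1)
  proof (induction Ks)
    case Nil
    then show ?case using L by (auto simp: apply_channel_def)
  next
    case (Cons K Ks)
    have c: "K \<in> carrier_mat k n" "K * \<rho> * adj K \<in> carrier_mat k k"
      "apply_channel k Ks \<rho> \<in> carrier_mat k k"
      using Cons.prems assms(3) by (auto intro!: apply_channel_carrier conjugate_carrier)
    have aL: "adj L \<in> carrier_mat k m" using L by simp
    have "L * apply_channel k (K # Ks) \<rho> * adj L
        = L * (K * \<rho> * adj K + apply_channel k Ks \<rho>) * adj L"
      by (simp add: apply_channel_def)
    also have "\<dots> = L * (K * \<rho> * adj K) * adj L + L * apply_channel k Ks \<rho> * adj L"
      using L c aL by (simp add: mult_add_distrib_mat[OF L c(2,3)]
          add_mult_distrib_mat[of _ m k _ "adj L" m])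
    also have "L * (K * \<rho> * adj K) * adj L = L * K * \<rho> * adj (L * K)"
    proof -
      have aK: "adj K \<in> carrier_mat n k" "K * \<rho> \<in> carrier_mat k n" "L * K \<in> carrier_mat m n"
        "L * K * \<rho> \<in> carrier_mat m n"
        using c(1) L assms(3) by (auto intro: mult_carrier_mat)
      have "L * (K * \<rho> * adj K) = L * K * \<rho> * adj K"
        using assoc_mult_mat[OF L c(1) assms(3)] assoc_mult_mat[OF L aK(2,1)] by simp
      then show ?thesis
        using assoc_mult_mat[OF aK(4,1) aL] by (simp add: adj_mult[OF L c(1)])
    qed
    finally show ?case using Cons by (simp add: apply_channel_def)
  qed
  show ?thesis using assms(2)
  proof (induction Ls)
    case Nil
    then show ?case by (simp add: apply_channel_def comp_channel_def)
  next
    case (Cons L Ls)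
    have "apply_channel m (L # Ls) (apply_channel k Ks \<rho>)
        = L * apply_channel k Ks \<rho> * adj L + apply_channel m (comp_channel Ls Ks) \<rho>"
      using Cons by (simp add: apply_channel_def)
    also have "\<dots> = apply_channel m (map (\<lambda>K. L * K) Ks @ comp_channel Ls Ks) \<rho>"
      using Cons.prems assms(1,3) *[of L]
      by (subst apply_channel_append) (auto simp: comp_channel_def intro: mult_carrier_mat)
    finally show ?case by (simp add: comp_channel_def)
  qed
qed

lemma tensor_channel_is_channel:
  assumes "is_channel n m Ks" "is_channel n' m' Ls"
  shows "is_channel (n * n') (m * m') (tensor_channel Ks Ls)"
  unfolding is_channel_iff
proof (intro conjI allI impI)
  have K: "\<And>K. K \<in> set Ks \<Longrightarrow> K \<in> carrier_mat m n" and L: "\<And>L. L \<in> set Ls \<Longrightarrow> L \<in> carrier_mat m' n'"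
    using assms by (auto simp: is_channel_def)
  show "\<forall>M\<in>set (tensor_channel Ks Ls). M \<in> carrier_mat (m * m') (n * n')"
    using K L by (auto simp: tensor_channel_def intro: kron_carrier)
  fix r c assume rc: "r < n * n'" "c < n * n'"
  obtain i i' where i: "i < n" "i' < n'" "r = i * n' + i'" using rc(1) by (rule pair_index_cases)
  obtain j j' where j: "j < n" "j' < n'" "c = j * n' + j'" using rc(2) by (rule pair_index_cases)
  have "(\<Sum>M\<leftarrow>tensor_channel Ks Ls. (adj M * M) $$ (r, c))
      = (\<Sum>K\<leftarrow>Ks. \<Sum>L\<leftarrow>Ls. (adj (kron K L) * kron K L) $$ (r, c))"
    unfolding tensor_channel_def by (rule sum_list_concat_map)
  also have "\<dots> = (\<Sum>K\<leftarrow>Ks. \<Sum>L\<leftarrow>Ls. (adj K * K) $$ (i, j) * (adj L * L) $$ (i', j'))"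
  proof (intro arg_cong[where f=sum_list] map_cong refl)
    fix K L assume "K \<in> set Ks" "L \<in> set Ls"
    note c = K[OF this(1)] L[OF this(2)]
    have "adj (kron K L) * kron K L = kron (adj K * K) (adj L * L)"
      using c by (simp add: adj_kron kron_mult[of _ n m _ n' m' _ n _ n'])
    then show "(adj (kron K L) * kron K L) $$ (r, c) = (adj K * K) $$ (i, j) * (adj L * L) $$ (i', j')"
      unfolding i j using c i j
      by (simp only:) (rule kron_index[OF gram_carrier gram_carrier])
  qed
  also have "\<dots> = (\<Sum>K\<leftarrow>Ks. (adj K * K) $$ (i, j)) * (\<Sum>L\<leftarrow>Ls. (adj L * L) $$ (i', j'))"
    by (simp add: sum_list_const_mult sum_list_mult_const del: index_mult_mat(1))
  also have "\<dots> = (if r = c then 1 else 0)"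
    using assms i j by (simp add: is_channel_iff pair_index_eq_iff del: index_mult_mat(1))
  finally show "(\<Sum>M\<leftarrow>tensor_channel Ks Ls. (adj M * M) $$ (r, c)) = (if r = c then 1 else 0)" .
qed

lemma smult_smult_mat: "k \<cdot>\<^sub>m (l \<cdot>\<^sub>m A) = (k * l :: 'a :: semigroup_mult) \<cdot>\<^sub>m A"
  by (rule eq_matI) (auto simp: mult.assoc)

text \<open>Completeness forces the squared moduli of the factors to sum to 1, so probabilities of
  individual outcomes never have to be computed.\<close>

lemma apply_channel_scaled_unitary:
  assumes U: "is_unitary N U" and ch: "is_channel N N Ms"
    and sc: "\<And>M. M \<in> set Ms \<Longrightarrow> \<exists>c. M = c \<cdot>\<^sub>m U" and rho: "\<rho> \<in> carrier_mat N N" and "N > 0"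
  shows "apply_channel N Ms \<rho> = U * \<rho> * adj U"
proof -
  obtain c where c: "\<And>M. M \<in> set Ms \<Longrightarrow> M = c M \<cdot>\<^sub>m U" using sc by metis
  have Uc: "U \<in> carrier_mat N N" "adj U * U = 1\<^sub>m N" using U by (auto simp: is_unitary_def)
  have adjs: "adj (k \<cdot>\<^sub>m U) = cnj k \<cdot>\<^sub>m adj U" for k by (auto intro!: eq_matI)
  \<comment> \<open>One diagonal entry of the completeness relation suffices; entry (0, 0) exists
    because \<open>N\<close> is positive.\<close>
  have "(\<Sum>M\<leftarrow>Ms. (adj M * M) $$ (0, 0)) = 1" using ch \<open>N > 0\<close> by (simp add: is_channel_iff)
  also have "(\<Sum>M\<leftarrow>Ms. (adj M * M) $$ (0, 0)) = (\<Sum>M\<leftarrow>Ms. c M * cnj (c M))"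
  proof (intro arg_cong[where f=sum_list] map_cong refl)
    fix M assume "M \<in> set Ms"
    then have "adj M * M = (cnj (c M) \<cdot>\<^sub>m adj U) * (c M \<cdot>\<^sub>m U)" using c adjs by metis
    also have "\<dots> = (c M * cnj (c M)) \<cdot>\<^sub>m 1\<^sub>m N"
      using Uc by (simp add: mult_smult_distrib[of _ N N _ N] mult_smult_assoc_mat[of _ N N _ N]
          smult_smult_mat)
    finally show "(adj M * M) $$ (0, 0) = c M * cnj (c M)" using \<open>N > 0\<close> by simp
  qed
  finally have s: "(\<Sum>M\<leftarrow>Ms. c M * cnj (c M)) = 1" .
  have Mc: "M \<in> carrier_mat N N" if "M \<in> set Ms" for M
    using ch that by (auto simp: is_channel_def)
  show ?thesis
  proof (rule eq_matI)
    fix i j assume "i < dim_row (U * \<rho> * adj U)" "j < dim_col (U * \<rho> * adj U)"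
    then have ij: "i < N" "j < N" using Uc by auto
    have "apply_channel N Ms \<rho> $$ (i, j) = (\<Sum>M\<leftarrow>Ms. (M * \<rho> * adj M) $$ (i, j))"
      unfolding apply_channel_def using Mc rho ij
      by (intro foldr_add_mat_index conjugate_carrier)
    also have "\<dots> = (\<Sum>M\<leftarrow>Ms. c M * cnj (c M) * (U * \<rho> * adj U) $$ (i, j))"
    proof (intro arg_cong[where f=sum_list] map_cong refl)
      fix M assume "M \<in> set Ms"
      then have "M * \<rho> * adj M = (c M \<cdot>\<^sub>m U) * \<rho> * (cnj (c M) \<cdot>\<^sub>m adj U)" using c adjs by metis
      also have "\<dots> = (c M * cnj (c M)) \<cdot>\<^sub>m (U * \<rho> * adj U)"
        using Uc rho by (simp add: mult_smult_distrib[of _ N N _ N] mult_smult_assoc_mat[of _ N N _ N]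
          smult_smult_mat mult.commute)
      finally show "(M * \<rho> * adj M) $$ (i, j) = c M * cnj (c M) * (U * \<rho> * adj U) $$ (i, j)"
        using ij Uc rho by simp
    qed
    also have "\<dots> = (U * \<rho> * adj U) $$ (i, j)"
      by (simp add: sum_list_mult_const s del: index_mult_mat(1))
    finally show "apply_channel N Ms \<rho> $$ (i, j) = (U * \<rho> * adj U) $$ (i, j)" .
  qed (use Uc apply_channel_carrier[OF Mc rho] in auto)
qed

section \<open>Protocols given by families of Kraus operators\<close>

lemma swap_mat_carrier: "swap_mat d1 d2 \<in> carrier_mat (d1 * d2) (d1 * d2)"
  by (simp add: swap_mat_def)

lemma swap_mat_index:
  assumes "r < d1 * d2" "i < d1" "j < d2"
  shows "swap_mat d1 d2 $$ (r, i * d2 + j) = (if r = j * d1 + i then 1 else 0)"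
  using assms by (simp add: swap_mat_def pair_index_less)

lemma swap_mat_unitary: "adj (swap_mat d1 d2) * swap_mat d1 d2 = 1\<^sub>m (d1 * d2)"
proof (rule eq_matI)
  fix r c assume "r < dim_row (1\<^sub>m (d1 * d2))" "c < dim_col (1\<^sub>m (d1 * d2))"
  then have rc: "r < d1 * d2" "c < d1 * d2" by auto
  obtain i j where i: "i < d1" "j < d2" "r = i * d2 + j" using rc(1) by (rule pair_index_cases)
  obtain i' j' where j: "i' < d1" "j' < d2" "c = i' * d2 + j'" using rc(2) by (rule pair_index_cases)
  have lt: "j * d1 + i < d1 * d2" "j' * d1 + i' < d1 * d2"
    using pair_index_less[of j d2 i d1] pair_index_less[of j' d2 i' d1] i j by (auto simp: mult.commute)
  have "(adj (swap_mat d1 d2) * swap_mat d1 d2) $$ (r, c)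
      = (\<Sum>k<d1 * d2. cnj (swap_mat d1 d2 $$ (k, r)) * swap_mat d1 d2 $$ (k, c))"
    using rc by (rule gram_index[OF swap_mat_carrier])
  also have "\<dots> = (\<Sum>k<d1 * d2. if k = j * d1 + i then (if k = j' * d1 + i' then 1 else 0) else 0)"
    unfolding i j using i j by (intro sum.cong refl) (simp add: swap_mat_index)
  also have "\<dots> = 1\<^sub>m (d1 * d2) $$ (r, c)"
    using lt i j rc by (simp add: pair_index_eq_iff)
  finally show "(adj (swap_mat d1 d2) * swap_mat d1 d2) $$ (r, c) = 1\<^sub>m (d1 * d2) $$ (r, c)" .
qed (auto simp: swap_mat_def)

lemma kron_one_unitary:
  assumes "P \<in> carrier_mat d d" "adj P * P = 1\<^sub>m d"
  shows "adj (kron (1\<^sub>m k) P) * kron (1\<^sub>m k) P = 1\<^sub>m (k * d)"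
proof -
  have "adj (1\<^sub>m k) = 1\<^sub>m k" by (rule eq_matI) auto
  then show ?thesis
    using assms by (simp add: adj_kron kron_mult[of _ k k _ d d _ k _ d] kron_one)
qed

text \<open>Lets both swaps in \<open>nlqc_channel\<close> be read as relabellings of rows, so that
  no permutation matrix survives in \<open>nlqc_kraus_index\<close>.\<close>

lemma kron_one_swap_mult_index:
  assumes X: "X \<in> carrier_mat (dA * (d1 * d2)) n"
    and "i < dA" "f < d1" "e < d2" "c < n"
  shows "(kron (1\<^sub>m dA) (swap_mat d1 d2) * X) $$ (i * (d1 * d2) + (e * d1 + f), c)
       = X $$ (i * (d1 * d2) + (f * d2 + e), c)"
proof -
  have ef: "e * d1 + f < d1 * d2"
    using pair_index_less[of e d2 f d1] assms by (simp add: mult.commute)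
  have "(kron (1\<^sub>m dA) (swap_mat d1 d2) * X) $$ (i * (d1 * d2) + (e * d1 + f), c)
      = (\<Sum>i'<dA. \<Sum>f'<d1. \<Sum>e'<d2.
          kron (1\<^sub>m dA) (swap_mat d1 d2) $$ (i * (d1 * d2) + (e * d1 + f), i' * (d1 * d2) + (f' * d2 + e'))
          * X $$ (i' * (d1 * d2) + (f' * d2 + e'), c))"
    using assms ef
    by (subst mult_mat_index[OF kron_carrier[OF one_carrier_mat swap_mat_carrier] X])
       (auto simp: pair_index_less sum_lessThan_mult)
  also have "\<dots> = (\<Sum>i'<dA. \<Sum>f'<d1. \<Sum>e'<d2. if i' = i then if f' = f then if e' = e then
          X $$ (i * (d1 * d2) + (f * d2 + e), c) else 0 else 0 else 0)"
  proof (intro sum.cong refl)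
    fix i' f' e' assume *: "i' \<in> {..<dA}" "f' \<in> {..<d1}" "e' \<in> {..<d2}"
    then have "kron (1\<^sub>m dA) (swap_mat d1 d2) $$ (i * (d1 * d2) + (e * d1 + f), i' * (d1 * d2) + (f' * d2 + e'))
        = 1\<^sub>m dA $$ (i, i') * swap_mat d1 d2 $$ (e * d1 + f, f' * d2 + e')"
      using assms ef by (intro kron_index[OF one_carrier_mat swap_mat_carrier]) (auto simp: pair_index_less)
    also have "\<dots> = (if i' = i then if f' = f then if e' = e then 1 else 0 else 0 else 0)"
      using * assms ef by (simp add: swap_mat_index pair_index_eq_iff)
    finally show "kron (1\<^sub>m dA) (swap_mat d1 d2) $$ (i * (d1 * d2) + (e * d1 + f), i' * (d1 * d2) + (f' * d2 + e'))
          * X $$ (i' * (d1 * d2) + (f' * d2 + e'), c) = (if i' = i then if f' = f then if e' = e then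
          X $$ (i * (d1 * d2) + (f * d2 + e), c) else 0 else 0 else 0)"
      by simp
  qed
  also have "\<dots> = (\<Sum>i'<dA. if i' = i then (\<Sum>f'<d1. if f' = f then (\<Sum>e'<d2. if e' = e then
          X $$ (i * (d1 * d2) + (f * d2 + e), c) else 0) else 0) else 0)"
    by (simp only: sum_if_const)
  finally show ?thesis using assms by (simp add: sum_if_const)
qed

text \<open>The isometry that appends \<open>m\<close> EPR pairs to a register of dimension
  \<open>N\<close>. As a single Kraus operator it makes the resource state one more link in a chain
  of channels.\<close>

definition epr_iso :: "nat \<Rightarrow> nat \<Rightarrow> complex mat" where
  "epr_iso N m = mat (N * (2^m * 2^m)) N (\<lambda>(r, c).
     if r div (2^m * 2^m) = c \<and> r mod (2^m * 2^m) div 2^m = r mod (2^m * 2^m) mod 2^m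
     then 1 / complex_of_real (sqrt (2^m)) else 0)"

lemma epr_iso_carrier: "epr_iso N m \<in> carrier_mat (N * (2^m * 2^m)) N"
  by (simp add: epr_iso_def)

lemma epr_iso_index:
  assumes "i < N" "l < 2^m" "r < 2^m" "c < N"
  shows "epr_iso N m $$ (i * (2^m * 2^m) + (l * 2^m + r), c)
       = (if i = c then if l = r then 1 / complex_of_real (sqrt (2^m)) else 0 else 0)"
  using assms by (simp add: epr_iso_def pair_index_less)

lemma sqrt_sqr_complex: "1 / complex_of_real (sqrt (2^m)) * (1 / complex_of_real (sqrt (2^m))) = 1 / 2^m"
  by (simp flip: of_real_mult)

lemma epr_iso_isometry: "adj (epr_iso N m) * epr_iso N m = 1\<^sub>m N"
proof (rule eq_matI)
  fix r c assume "r < dim_row (1\<^sub>m N)" "c < dim_col (1\<^sub>m N)"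
  then have rc: "r < N" "c < N" by auto
  have "(adj (epr_iso N m) * epr_iso N m) $$ (r, c)
      = (\<Sum>i<N. \<Sum>k<2^m::nat. \<Sum>l<2^m::nat. if i = r then if k = l then if i = c then 1 / 2^m else 0 else 0 else 0)"
    unfolding gram_index[OF epr_iso_carrier rc] sum_lessThan_mult using rc
    by (intro sum.cong refl) (simp add: epr_iso_index flip: sqrt_sqr_complex)
  also have "\<dots> = (\<Sum>i<N. if i = r then (\<Sum>k<2^m::nat. \<Sum>l<2^m::nat. if k = l then if i = c then 1 / 2^m else 0 else 0) else 0)"
    by (simp only: sum_if_const)
  finally show "(adj (epr_iso N m) * epr_iso N m) $$ (r, c) = 1\<^sub>m N $$ (r, c)"
    using rc by simp
qed (auto simp: epr_iso_def)

lemma kron_epr_state: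
  assumes "\<rho> \<in> carrier_mat N N"
  shows "kron \<rho> (epr_state m) = epr_iso N m * \<rho> * adj (epr_iso N m)"
proof (rule eq_matI)
  let ?E = "2^m * 2^m :: nat"
  have ec: "epr_state m \<in> carrier_mat ?E ?E" by (simp add: epr_state_def)
  note ic = epr_iso_carrier[of N m]
  fix r c assume "r < dim_row (epr_iso N m * \<rho> * adj (epr_iso N m))"
    "c < dim_col (epr_iso N m * \<rho> * adj (epr_iso N m))"
  then have rc: "r < N * ?E" "c < N * ?E" using ic by auto
  obtain i e where i: "i < N" "e < ?E" "r = i * ?E + e" using rc(1) by (rule pair_index_cases)
  obtain l p where e: "l < 2^m" "p < 2^m" "e = l * 2^m + p" using i(2) by (rule pair_index_cases)
  obtain i' e' where i': "i' < N" "e' < ?E" "c = i' * ?E + e'" using rc(2) by (rule pair_index_cases)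
  obtain l' p' where e': "l' < 2^m" "p' < 2^m" "e' = l' * 2^m + p'" using i'(2) by (rule pair_index_cases)
  have "(epr_iso N m * \<rho> * adj (epr_iso N m)) $$ (r, c)
      = (\<Sum>k<N. (\<Sum>k'<N. epr_iso N m $$ (r, k') * \<rho> $$ (k', k)) * cnj (epr_iso N m $$ (c, k)))"
    using assms rc ic
    by (subst mult_mat_index[of _ "N * ?E" N _ "N * ?E"])
       (auto simp: mult_mat_index[of _ "N * ?E" N _ N] intro!: sum.cong mult_carrier_mat
         simp del: index_mult_mat(1))
  also have "\<dots> = (if l = p then if l' = p' then 1 / 2^m else 0 else 0) * \<rho> $$ (i, i')"
    unfolding i e i' e' using i e i' e' sqrt_sqr_complex[of m]
    by (simp add: epr_iso_index if_distrib[of cnj] if_distrib[of "\<lambda>x. x * _"] if_distrib[of "\<lambda>x. _ * x"] cong: if_cong)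
  also have "\<dots> = kron \<rho> (epr_state m) $$ (r, c)"
    unfolding i(3) i'(3) using i i' e e'
    by (subst kron_index[OF assms ec]) (auto simp: epr_state_def)
  finally show "kron \<rho> (epr_state m) $$ (r, c) = (epr_iso N m * \<rho> * adj (epr_iso N m)) $$ (r, c)" ..
qed (use assms in \<open>auto simp: epr_iso_def epr_state_def\<close>)

text \<open>One branch of the whole protocol. The EPR pairs force equal labels \<open>l\<close> on
  both sides and the swaps only regroup indices; what remains is a contraction of four local
  amplitudes, times the amplitude 2^(-m/2) of the EPR pairs.\<close>

lemma nlqc_kraus_index:
  fixes m :: nat and dA dB :: nat
  defines "M \<equiv> 2^m"
  assumes W: "W \<in> carrier_mat dA (dKa * dMa)" and W': "W' \<in> carrier_mat dB (dKb * dMb)"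
    and V: "V \<in> carrier_mat (dKa * dMb) (dA * M)" and V': "V' \<in> carrier_mat (dMa * dKb) (M * dB)"
    and o: "oA < dA" "oB < dB" "iA < dA" "iB < dB"
  shows "(kron W W' * (kron (1\<^sub>m dKa) (swap_mat dMb (dMa * dKb)) * (kron V V' *
      (kron (1\<^sub>m dA) (swap_mat dB (M * M)) * epr_iso (dA * dB) m)))) $$ (oA * dB + oB, iA * dB + iB)
    = (\<Sum>ka<dKa. \<Sum>ma<dMa. \<Sum>kb<dKb. \<Sum>mb<dMb. W $$ (oA, ka * dMa + ma) * W' $$ (oB, kb * dMb + mb) *
        (\<Sum>l<M. V $$ (ka * dMb + mb, iA * M + l) * V' $$ (ma * dKb + kb, l * dB + iB)))
      * (1 / complex_of_real (sqrt (2^m)))" (is "?L = _")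
proof -
  let ?s = "1 / complex_of_real (sqrt (2^m))"
  define Y where "Y = kron (1\<^sub>m dA) (swap_mat dB (M * M)) * epr_iso (dA * dB) m"
  define X where "X = kron V V' * Y"
  define Z where "Z = kron (1\<^sub>m dKa) (swap_mat dMb (dMa * dKb)) * X"
  let ?c = "iA * dB + iB"
  have c: "?c < dA * dB" using o by (simp add: pair_index_less)
  have Ec: "epr_iso (dA * dB) m \<in> carrier_mat (dA * (dB * (M * M))) (dA * dB)"
    using epr_iso_carrier[of "dA * dB" m] by (simp add: M_def mult.assoc)
  have Yc: "Y \<in> carrier_mat (dA * (dB * (M * M))) (dA * dB)"
    unfolding Y_def by (intro mult_carrier_mat[OF kron_carrier Ec] swap_mat_carrier) simp
  have Yc': "Y \<in> carrier_mat (dA * M * (M * dB)) (dA * dB)" using Yc by (simp add: mult_ac)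
  have Xc: "X \<in> carrier_mat (dKa * dMb * (dMa * dKb)) (dA * dB)"
    unfolding X_def by (intro mult_carrier_mat[OF kron_carrier[OF V V'] Yc'])
  have Xc': "X \<in> carrier_mat (dKa * (dMb * (dMa * dKb))) (dA * dB)" using Xc by (simp add: mult_ac)
  have Zc: "Z \<in> carrier_mat (dKa * (dMb * (dMa * dKb))) (dA * dB)"
    unfolding Z_def by (intro mult_carrier_mat[OF kron_carrier Xc'] swap_mat_carrier) simp
  have Zc': "Z \<in> carrier_mat (dKa * dMa * (dKb * dMb)) (dA * dB)" using Zc by (simp add: mult_ac)
  have Y: "Y $$ ((jA * M + l) * (M * dB) + (r * dB + jB), ?c)
      = (if jA = iA then if jB = iB then if l = r then ?s else 0 else 0 else 0)"
    if "jA < dA" "l < M" "r < M" "jB < dB" for jA l r jB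
  proof -
    have lr: "l * M + r < M * M" using that by (simp add: pair_index_less)
    \<comment> \<open>Mixed-radix regrouping: the swap turns the order A B L R into A L R B.\<close>
    have "(jA * M + l) * (M * dB) + (r * dB + jB) = jA * (dB * (M * M)) + ((l * M + r) * dB + jB)"
      by (simp add: algebra_simps)
    then have "Y $$ ((jA * M + l) * (M * dB) + (r * dB + jB), ?c)
        = epr_iso (dA * dB) m $$ (jA * (dB * (M * M)) + (jB * (M * M) + (l * M + r)), ?c)"
      unfolding Y_def using that lr c by (simp only: kron_one_swap_mult_index[OF Ec])
    also have "jA * (dB * (M * M)) + (jB * (M * M) + (l * M + r)) = (jA * dB + jB) * (2^m * 2^m) + (l * 2^m + r)"
      by (simp add: algebra_simps M_def)
    also have "epr_iso (dA * dB) m $$ ((jA * dB + jB) * (2^m * 2^m) + (l * 2^m + r), ?c)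
        = (if jA * dB + jB = ?c then if l = r then ?s else 0 else 0)"
      using that c by (intro epr_iso_index) (auto simp: M_def pair_index_less)
    finally show ?thesis using that o by (simp add: pair_index_eq_iff)
  qed
  have X: "X $$ ((ka * dMb + mb) * (dMa * dKb) + (ma * dKb + kb), ?c)
      = (\<Sum>l<M. V $$ (ka * dMb + mb, iA * M + l) * V' $$ (ma * dKb + kb, l * dB + iB)) * ?s"
    if "ka < dKa" "mb < dMb" "ma < dMa" "kb < dKb" for ka mb ma kb
  proof -
    have lt: "ka * dMb + mb < dKa * dMb" "ma * dKb + kb < dMa * dKb"
      using that by (auto simp: pair_index_less)
    have "X $$ ((ka * dMb + mb) * (dMa * dKb) + (ma * dKb + kb), ?c)
        = (\<Sum>jA<dA. \<Sum>l<M. \<Sum>r<M. \<Sum>jB<dB. V $$ (ka * dMb + mb, jA * M + l) * V' $$ (ma * dKb + kb, r * dB + jB)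
            * (if jA = iA then if jB = iB then if l = r then ?s else 0 else 0 else 0))"
      unfolding X_def using lt c
      by (subst mult_mat_index[OF kron_carrier[OF V V'] Yc'])
         (auto simp: pair_index_less sum_lessThan_mult[of _ _ "M * dB"] sum_lessThan_mult[of _ M dB]
           sum_lessThan_mult[of _ dA M] kron_index[OF V V'] Y intro!: sum.cong)
    also have "\<dots> = (\<Sum>jA<dA. \<Sum>l<M. \<Sum>r<M. \<Sum>jB<dB. if jA = iA then if jB = iB then if l = r then
         V $$ (ka * dMb + mb, jA * M + l) * V' $$ (ma * dKb + kb, r * dB + jB) * ?s else 0 else 0 else 0)"
      by (intro sum.cong refl) simp
    also have "\<dots> = (\<Sum>l<M. V $$ (ka * dMb + mb, iA * M + l) * V' $$ (ma * dKb + kb, l * dB + iB) * ?s)"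
      using o by (simp add: sum_if_const)
    finally show ?thesis by (simp only: sum_distrib_right)
  qed
  have Z: "Z $$ ((ka * dMa + ma) * (dKb * dMb) + (kb * dMb + mb), ?c)
      = (\<Sum>l<M. V $$ (ka * dMb + mb, iA * M + l) * V' $$ (ma * dKb + kb, l * dB + iB)) * ?s"
    if "ka < dKa" "mb < dMb" "ma < dMa" "kb < dKb" for ka mb ma kb
  proof -
    have lt: "ma * dKb + kb < dMa * dKb" using that by (simp add: pair_index_less)
    \<comment> \<open>The exchange of messages turns the order K_a M_b M_a K_b into K_a M_a K_b
      M_b.\<close>
    have "(ka * dMa + ma) * (dKb * dMb) + (kb * dMb + mb)
        = ka * (dMb * (dMa * dKb)) + ((ma * dKb + kb) * dMb + mb)"
      by (simp add: algebra_simps)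
    then have "Z $$ ((ka * dMa + ma) * (dKb * dMb) + (kb * dMb + mb), ?c)
        = X $$ (ka * (dMb * (dMa * dKb)) + (mb * (dMa * dKb) + (ma * dKb + kb)), ?c)"
      unfolding Z_def using that lt c by (simp only: kron_one_swap_mult_index[OF Xc'])
    also have "ka * (dMb * (dMa * dKb)) + (mb * (dMa * dKb) + (ma * dKb + kb))
        = (ka * dMb + mb) * (dMa * dKb) + (ma * dKb + kb)"
      by (simp add: algebra_simps)
    finally show ?thesis using X[OF that] by simp
  qed
  have lt: "oA * dB + oB < dA * dB" using o by (simp add: pair_index_less)
  have "?L = (kron W W' * Z) $$ (oA * dB + oB, ?c)" by (simp add: Z_def X_def Y_def)
  also have "\<dots> = (\<Sum>ka<dKa. \<Sum>ma<dMa. \<Sum>kb<dKb. \<Sum>mb<dMb. W $$ (oA, ka * dMa + ma) * W' $$ (oB, kb * dMb + mb) *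
       ((\<Sum>l<M. V $$ (ka * dMb + mb, iA * M + l) * V' $$ (ma * dKb + kb, l * dB + iB)) * ?s))"
    using lt c o
    by (subst mult_mat_index[OF kron_carrier[OF W W'] Zc'])
       (auto simp: pair_index_less sum_lessThan_mult[of _ _ "dKb * dMb"] sum_lessThan_mult[of _ dKb dMb]
           sum_lessThan_mult[of _ dKa dMa] kron_index[OF W W'] Z intro!: sum.cong simp del: index_mult_mat(1))
  finally show ?thesis by (simp only: sum_distrib_right mult.assoc)
qed

text \<open>The interface to the rest of the proof. Alice's operation \<open>v q\<close> yields her
  own part and the part sent to Bob, \<open>t \<beta>\<close> is a rank-one measurement by Bob, and
  \<open>wA\<close>, \<open>wB\<close> act once both outcomes are known. Each branch need only be
  proportional to \<open>U\<close>; the normalization is supplied by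
  \<open>apply_channel_scaled_unitary\<close>.\<close>

lemma nlqc_from_kraus:
  fixes a b m nQ nB :: nat
    and v :: "nat \<Rightarrow> nat \<Rightarrow> nat \<Rightarrow> nat \<Rightarrow> nat \<Rightarrow> complex" and t :: "nat \<Rightarrow> nat \<Rightarrow> nat \<Rightarrow> complex"
    and wA wB :: "nat \<Rightarrow> nat \<Rightarrow> nat \<Rightarrow> nat \<Rightarrow> complex"
  assumes U: "is_unitary (2^a * 2^b) U"
    and v: "\<And>i l i' l'. i < 2^a \<Longrightarrow> l < 2^m \<Longrightarrow> i' < 2^a \<Longrightarrow> l' < 2^m \<Longrightarrow>
      (\<Sum>q<nQ. \<Sum>j<2^a. \<Sum>k<2^b. cnj (v q j k i l) * v q j k i' l') = (if i = i' then if l = l' then 1 else 0 else 0)"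
    and t: "\<And>l k l' k'. l < 2^m \<Longrightarrow> k < 2^b \<Longrightarrow> l' < 2^m \<Longrightarrow> k' < 2^b \<Longrightarrow>
      (\<Sum>\<beta><nB. cnj (t \<beta> l k) * t \<beta> l' k') = (if l = l' then if k = k' then 1 else 0 else 0)"
    and wA: "\<And>q \<beta> i i'. q < nQ \<Longrightarrow> \<beta> < nB \<Longrightarrow> i < 2^a \<Longrightarrow> i' < 2^a \<Longrightarrow>
      (\<Sum>j<2^a. cnj (wA q \<beta> j i) * wA q \<beta> j i') = (if i = i' then 1 else 0)"
    and wB: "\<And>q \<beta> k k'. q < nQ \<Longrightarrow> \<beta> < nB \<Longrightarrow> k < 2^b \<Longrightarrow> k' < 2^b \<Longrightarrow>
      (\<Sum>j<2^b. cnj (wB q \<beta> j k) * wB q \<beta> j k') = (if k = k' then 1 else 0)"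
    and eff: "\<And>q \<beta>. q < nQ \<Longrightarrow> \<beta> < nB \<Longrightarrow> \<exists>c. \<forall>j<2^a. \<forall>k<2^b. \<forall>i<2^a. \<forall>h<2^b.
      (\<Sum>j'<2^a. \<Sum>k'<2^b. wA q \<beta> j j' * wB q \<beta> k k' * (\<Sum>l<2^m. v q j' k' i l * t \<beta> l h))
        = c * U $$ (j * 2^b + k, i * 2^b + h)"
  shows "nlqc_implements a b m U"
proof -
  define dA dB M :: nat where "dA = 2^a" and "dB = 2^b" and "M = 2^m"
  note fd = dA_def[symmetric] dB_def[symmetric] M_def[symmetric]
  \<comment> \<open>The outcome \<open>q\<close> is written both into the register that is kept and
    into the one that is sent, so both parties know it after the exchange. \<open>V'\<close> does
    the same with \<open>\<beta>\<close>.\<close>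
  define V where "V q = mat (nQ * dA * (nQ * dB)) (dA * M) (\<lambda>(r, c).
      if r div (nQ * dB) div dA = q then if r mod (nQ * dB) div dB = q
      then v q (r div (nQ * dB) mod dA) (r mod (nQ * dB) mod dB) (c div M) (c mod M) else 0 else 0)" for q
  define V' where "V' \<beta> = mat (nB * nB) (M * dB) (\<lambda>(r, c).
      if r div nB = \<beta> then if r mod nB = \<beta> then t \<beta> (c div dB) (c mod dB) else 0 else 0)" for \<beta>
  \<comment> \<open>Each operator projects on one pair of labels; together these projections exhaust
    the label registers, which gives completeness.\<close>
  define W where "W q \<beta> = mat dA (nQ * dA * nB) (\<lambda>(r, c).
      if c div nB div dA = q then if c mod nB = \<beta> then wA q \<beta> r (c div nB mod dA) else 0 else 0)" for q \<beta>
  define W' where "W' q \<beta> = mat dB (nB * (nQ * dB)) (\<lambda>(r, c).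
      if c div (nQ * dB) = \<beta> then if c mod (nQ * dB) div dB = q then wB q \<beta> r (c mod (nQ * dB) mod dB) else 0 else 0)" for q \<beta>
  have carrier: "V q \<in> carrier_mat (nQ * dA * (nQ * dB)) (dA * M)" "V' \<beta> \<in> carrier_mat (nB * nB) (M * dB)"
    "W q \<beta> \<in> carrier_mat dA (nQ * dA * nB)" "W' q \<beta> \<in> carrier_mat dB (nB * (nQ * dB))" for q \<beta>
    by (simp_all add: V_def V'_def W_def W'_def)
  have Vi: "V q $$ ((p * dA + j) * (nQ * dB) + (p' * dB + k), i * M + l)
      = (if p = q then if p' = q then v q j k i l else 0 else 0)"
    if "p < nQ" "j < dA" "p' < nQ" "k < dB" "i < dA" "l < M" for q p j p' k i l
  proof -
    have "p * dA + j < nQ * dA" "p' * dB + k < nQ * dB" "i * M + l < dA * M"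
      using that by (simp_all add: pair_index_less)
    then show ?thesis using that by (simp add: V_def pair_index_less)
  qed
  have V'i: "V' \<beta> $$ (p * nB + p', l * dB + h) = (if p = \<beta> then if p' = \<beta> then t \<beta> l h else 0 else 0)"
    if "p < nB" "p' < nB" "l < M" "h < dB" for \<beta> p p' l h
    using that by (simp add: V'_def pair_index_less)
  have Wi: "W q \<beta> $$ (j, (p * dA + i) * nB + p') = (if p = q then if p' = \<beta> then wA q \<beta> j i else 0 else 0)"
    if "j < dA" "p < nQ" "i < dA" "p' < nB" for q \<beta> j p i p'
    using that by (simp add: W_def pair_index_less)
  have W'i: "W' q \<beta> $$ (j, p' * (nQ * dB) + (p * dB + k)) = (if p' = \<beta> then if p = q then wB q \<beta> j k else 0 else 0)"
    if "j < dB" "p < nQ" "k < dB" "p' < nB" for q \<beta> j p k p'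
    using that by (simp add: W'_def pair_index_less)
  define Vs where "Vs = map V [0..<nQ]"
  define V's where "V's = map V' [0..<nB]"
  define Ws where "Ws = concat (map (\<lambda>q. map (W q) [0..<nB]) [0..<nQ])"
  define W's where "W's = concat (map (\<lambda>q. map (W' q) [0..<nB]) [0..<nQ])"
  have chV: "is_channel (dA * M) (nQ * dA * (nQ * dB)) Vs"
    unfolding is_channel_iff
  proof (intro conjI allI impI)
    fix r c assume "r < dA * M" "c < dA * M"
    obtain i l where r: "i < dA" "l < M" "r = i * M + l" using \<open>r < dA * M\<close> by (rule pair_index_cases)
    obtain i' l' where c: "i' < dA" "l' < M" "c = i' * M + l'" using \<open>c < dA * M\<close> by (rule pair_index_cases)
    have "(\<Sum>K\<leftarrow>Vs. (adj K * K) $$ (r, c)) = (\<Sum>q<nQ. (adj (V q) * V q) $$ (r, c))"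
      unfolding Vs_def by (simp add: comp_def interv_sum_list_conv_sum_set_nat atLeast0LessThan del: index_mult_mat(1))
    also have "\<dots> = (\<Sum>q<nQ. \<Sum>p<nQ. \<Sum>j<dA. \<Sum>p'<nQ. \<Sum>k<dB.
        if p = q then if p' = q then cnj (v q j k i l) * v q j k i' l' else 0 else 0)"
      unfolding gram_index[OF carrier(1) \<open>r < dA * M\<close> \<open>c < dA * M\<close>] sum_lessThan_mult[of _ "nQ * dA"] sum_lessThan_mult[of _ nQ]
      using r c by (intro sum.cong refl) (simp add: Vi)
    also have "\<dots> = (\<Sum>q<nQ. \<Sum>j<dA. \<Sum>k<dB. cnj (v q j k i l) * v q j k i' l')"
      by (simp add: sum_if_const)
    also have "\<dots> = (if r = c then 1 else 0)"
      using v[of i l i' l'] r c unfolding fd by (simp add: pair_index_eq_iff)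
    finally show "(\<Sum>K\<leftarrow>Vs. (adj K * K) $$ (r, c)) = (if r = c then 1 else 0)" .
  qed (use carrier in \<open>auto simp: Vs_def\<close>)
  have chV': "is_channel (M * dB) (nB * nB) V's"
    unfolding is_channel_iff
  proof (intro conjI allI impI)
    fix r c assume "r < M * dB" "c < M * dB"
    obtain l h where r: "l < M" "h < dB" "r = l * dB + h" using \<open>r < M * dB\<close> by (rule pair_index_cases)
    obtain l' h' where c: "l' < M" "h' < dB" "c = l' * dB + h'" using \<open>c < M * dB\<close> by (rule pair_index_cases)
    have "(\<Sum>K\<leftarrow>V's. (adj K * K) $$ (r, c)) = (\<Sum>q<nB. (adj (V' q) * V' q) $$ (r, c))"
      unfolding V's_def by (simp add: comp_def interv_sum_list_conv_sum_set_nat atLeast0LessThan del: index_mult_mat(1))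
    also have "\<dots> = (\<Sum>q<nB. \<Sum>p<nB. \<Sum>p'<nB. if p = q then if p' = q then cnj (t q l h) * t q l' h' else 0 else 0)"
      unfolding gram_index[OF carrier(2) \<open>r < M * dB\<close> \<open>c < M * dB\<close>] sum_lessThan_mult
      using r c by (intro sum.cong refl) (simp add: V'i)
    also have "\<dots> = (\<Sum>q<nB. cnj (t q l h) * t q l' h')"
      by (simp add: sum_if_const)
    also have "\<dots> = (if r = c then 1 else 0)"
      using t[of l h l' h'] r c unfolding fd by (simp add: pair_index_eq_iff)
    finally show "(\<Sum>K\<leftarrow>V's. (adj K * K) $$ (r, c)) = (if r = c then 1 else 0)" .
  qed (use carrier in \<open>auto simp: V's_def\<close>)
  have chW: "is_channel (nQ * dA * nB) dA Ws"
    unfolding is_channel_iff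
  proof (intro conjI allI impI)
    fix r c assume rc: "r < nQ * dA * nB" "c < nQ * dA * nB"
    obtain s p' where s: "s < nQ * dA" "p' < nB" "r = s * nB + p'" using rc(1) by (rule pair_index_cases)
    obtain p i where r: "p < nQ" "i < dA" "s = p * dA + i" using s(1) by (rule pair_index_cases)
    obtain s2 p2' where s2: "s2 < nQ * dA" "p2' < nB" "c = s2 * nB + p2'" using rc(2) by (rule pair_index_cases)
    obtain p2 i2 where c: "p2 < nQ" "i2 < dA" "s2 = p2 * dA + i2" using s2(1) by (rule pair_index_cases)
    have "(\<Sum>K\<leftarrow>Ws. (adj K * K) $$ (r, c)) = (\<Sum>q<nQ. \<Sum>\<beta><nB. (adj (W q \<beta>) * W q \<beta>) $$ (r, c))"
      unfolding Ws_def sum_list_concat_map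
      by (simp add: interv_sum_list_conv_sum_set_nat atLeast0LessThan del: index_mult_mat(1))
    also have "\<dots> = (\<Sum>q<nQ. \<Sum>\<beta><nB. \<Sum>j<dA. if p = q then if p' = \<beta> then if p2 = q then if p2' = \<beta> then
        cnj (wA q \<beta> j i) * wA q \<beta> j i2 else 0 else 0 else 0 else 0)"
      unfolding gram_index[OF carrier(3) rc] unfolding s s2 r c
      using r c s s2 by (intro sum.cong refl) (simp add: Wi)
    also have "\<dots> = (if p2 = p then if p2' = p' then (\<Sum>j<dA. cnj (wA p p' j i) * wA p p' j i2) else 0 else 0)"
      using r s by (simp add: sum_if_const)
    also have "\<dots> = (if r = c then 1 else 0)"
      unfolding s r s2 c using wA[of p p' i i2] s s2 r c unfolding fd by (auto simp: pair_index_eq_iff)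
    finally show "(\<Sum>K\<leftarrow>Ws. (adj K * K) $$ (r, c)) = (if r = c then 1 else 0)" .
  qed (use carrier in \<open>auto simp: Ws_def\<close>)
  have chW': "is_channel (nB * (nQ * dB)) dB W's"
    unfolding is_channel_iff
  proof (intro conjI allI impI)
    fix r c assume rc: "r < nB * (nQ * dB)" "c < nB * (nQ * dB)"
    obtain p' s where s: "p' < nB" "s < nQ * dB" "r = p' * (nQ * dB) + s" using rc(1) by (rule pair_index_cases)
    obtain p i where r: "p < nQ" "i < dB" "s = p * dB + i" using s(2) by (rule pair_index_cases)
    obtain p2' s2 where s2: "p2' < nB" "s2 < nQ * dB" "c = p2' * (nQ * dB) + s2" using rc(2) by (rule pair_index_cases)
    obtain p2 i2 where c: "p2 < nQ" "i2 < dB" "s2 = p2 * dB + i2" using s2(2) by (rule pair_index_cases)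
    have "(\<Sum>K\<leftarrow>W's. (adj K * K) $$ (r, c)) = (\<Sum>q<nQ. \<Sum>\<beta><nB. (adj (W' q \<beta>) * W' q \<beta>) $$ (r, c))"
      unfolding W's_def sum_list_concat_map
      by (simp add: interv_sum_list_conv_sum_set_nat atLeast0LessThan del: index_mult_mat(1))
    also have "\<dots> = (\<Sum>q<nQ. \<Sum>\<beta><nB. \<Sum>j<dB. if p = q then if p' = \<beta> then if p2 = q then if p2' = \<beta> then
        cnj (wB q \<beta> j i) * wB q \<beta> j i2 else 0 else 0 else 0 else 0)"
      unfolding gram_index[OF carrier(4) rc] unfolding s s2 r c
      using r c s s2 by (intro sum.cong refl) (simp add: W'i)
    also have "\<dots> = (if p2 = p then if p2' = p' then (\<Sum>j<dB. cnj (wB p p' j i) * wB p p' j i2) else 0 else 0)"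
      using r s by (simp add: sum_if_const)
    also have "\<dots> = (if r = c then 1 else 0)"
      unfolding s r s2 c using wB[of p p' i i2] s s2 r c unfolding fd by (auto simp: pair_index_eq_iff)
    finally show "(\<Sum>K\<leftarrow>W's. (adj K * K) $$ (r, c)) = (if r = c then 1 else 0)" .
  qed (use carrier in \<open>auto simp: W's_def\<close>)
  let ?P1 = "kron (1\<^sub>m dA) (swap_mat dB (M * M))"
  let ?P2 = "kron (1\<^sub>m (nQ * dA)) (swap_mat (nQ * dB) (nB * nB))"
  let ?E = "epr_iso (dA * dB) m"
  define d1 where "d1 = dA * (dB * (M * M))"
  define d2 where "d2 = nQ * dA * (nQ * dB * (nB * nB))"
  have d1': "d1 = dA * M * (M * dB)" "d1 = dA * dB * (M * M)" and d2': "d2 = nQ * dA * (nQ * dB) * (nB * nB)"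
    "d2 = nQ * dA * nB * (nB * (nQ * dB))"
    by (simp_all add: d1_def d2_def mult_ac)
  have P1: "?P1 \<in> carrier_mat d1 d1" "adj ?P1 * ?P1 = 1\<^sub>m d1"
    unfolding d1_def by (intro kron_carrier swap_mat_carrier kron_one_unitary swap_mat_unitary one_carrier_mat)+
  have P2: "?P2 \<in> carrier_mat d2 d2" "adj ?P2 * ?P2 = 1\<^sub>m d2"
    unfolding d2_def by (intro kron_carrier swap_mat_carrier kron_one_unitary swap_mat_unitary one_carrier_mat)+
  have E: "?E \<in> carrier_mat d1 (dA * dB)"
    using epr_iso_carrier[of "dA * dB" m] unfolding fd d1'(2) .
  have chVV: "is_channel d1 d2 (tensor_channel Vs V's)"
    using tensor_channel_is_channel[OF chV chV'] unfolding d1' d2'(1) .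
  have chWW: "is_channel d2 (dA * dB) (tensor_channel Ws W's)"
    using tensor_channel_is_channel[OF chW chW'] unfolding d2'(2) .
  define Ms where "Ms = comp_channel (tensor_channel Ws W's) (comp_channel [?P2] (comp_channel (tensor_channel Vs V's)
     (comp_channel [?P1] [?E])))"
  have ch1: "is_channel (dA * dB) d1 [?E]" by (rule is_channel_single[OF E epr_iso_isometry])
  have ch2: "is_channel (dA * dB) d1 (comp_channel [?P1] [?E])"
    by (rule comp_channel_is_channel[OF ch1 is_channel_single[OF P1]])
  note ch3 = comp_channel_is_channel[OF ch2 chVV]
  note ch4 = comp_channel_is_channel[OF ch3 is_channel_single[OF P2]]
  note ch5 = comp_channel_is_channel[OF ch4 chWW, folded Ms_def]
  have eff': "\<exists>c. X = c \<cdot>\<^sub>m U" if "X \<in> set Ms" for X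
  proof -
    obtain q \<beta> q' \<beta>' p p' where lt: "q < nQ" "\<beta> < nB" "q' < nQ" "\<beta>' < nB" "p < nQ" "p' < nB"
      and X: "X = kron (W q \<beta>) (W' q' \<beta>') * (?P2 * (kron (V p) (V' p') * (?P1 * ?E)))"
      using \<open>X \<in> set Ms\<close> unfolding Ms_def comp_channel_def tensor_channel_def Vs_def V's_def Ws_def W's_def by auto
    obtain c where c: "\<And>j k i h. j < dA \<Longrightarrow> k < dB \<Longrightarrow> i < dA \<Longrightarrow> h < dB \<Longrightarrow>
      (\<Sum>j'<dA. \<Sum>k'<dB. wA q \<beta> j j' * wB q \<beta> k k' * (\<Sum>l<M. v q j' k' i l * t \<beta> l h))
        = c * U $$ (j * dB + k, i * dB + h)"
      using eff[OF lt(1,2)] unfolding fd by blast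
    \<comment> \<open>The four channels choose their Kraus operators independently. Branches with
      conflicting labels vanish, and zero is still a multiple of \<open>U\<close>.\<close>
    define c' where "c' = (if q' = q \<and> \<beta>' = \<beta> \<and> p = q \<and> p' = \<beta> then c * (1 / complex_of_real (sqrt (2^m))) else 0)"
    have "X = c' \<cdot>\<^sub>m U"
    proof (rule eq_matI)
      have Uc: "U \<in> carrier_mat (dA * dB) (dA * dB)" using U by (simp add: is_unitary_def fd)
      have Xc: "X \<in> carrier_mat (dA * dB) (dA * dB)" using ch5 \<open>X \<in> set Ms\<close> by (simp add: is_channel_def)
      show "dim_row X = dim_row (c' \<cdot>\<^sub>m U)" "dim_col X = dim_col (c' \<cdot>\<^sub>m U)" using Uc Xc by auto
      fix r s assume "r < dim_row (c' \<cdot>\<^sub>m U)" "s < dim_col (c' \<cdot>\<^sub>m U)"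
      then have rs: "r < dA * dB" "s < dA * dB" using Uc by auto
      obtain j k where r: "j < dA" "k < dB" "r = j * dB + k" using rs(1) by (rule pair_index_cases)
      obtain i h where s: "i < dA" "h < dB" "s = i * dB + h" using rs(2) by (rule pair_index_cases)
      have "X $$ (r, s) = (\<Sum>ka<nQ * dA. \<Sum>ma<nB. \<Sum>kb<nB. \<Sum>mb<nQ * dB.
          W q \<beta> $$ (j, ka * nB + ma) * W' q' \<beta>' $$ (k, kb * (nQ * dB) + mb) *
          (\<Sum>l<M. V p $$ (ka * (nQ * dB) + mb, i * M + l) * V' p' $$ (ma * nB + kb, l * dB + h)))
           * (1 / complex_of_real (sqrt (2^m)))"
        unfolding X r s using r s unfolding M_def
        by (intro nlqc_kraus_index carrier[unfolded M_def])
      also have "(\<Sum>ka<nQ * dA. \<Sum>ma<nB. \<Sum>kb<nB. \<Sum>mb<nQ * dB.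
          W q \<beta> $$ (j, ka * nB + ma) * W' q' \<beta>' $$ (k, kb * (nQ * dB) + mb) *
          (\<Sum>l<M. V p $$ (ka * (nQ * dB) + mb, i * M + l) * V' p' $$ (ma * nB + kb, l * dB + h)))
        = (\<Sum>q1<nQ. \<Sum>j'<dA. \<Sum>ma<nB. \<Sum>kb<nB. \<Sum>q2<nQ. \<Sum>k'<dB.
           if q1 = q then if ma = \<beta> then if kb = \<beta>' then if q2 = q' then if q1 = p then if q2 = p then
           if ma = p' then if kb = p' then
           wA q \<beta> j j' * wB q' \<beta>' k k' * (\<Sum>l<M. v p j' k' i l * t p' l h) else 0 else 0 else 0 else 0 else 0 else 0 else 0 else 0)"
        unfolding sum_lessThan_mult using r s
        by (intro sum.cong refl) (simp add: Vi V'i Wi W'i)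
      also have "\<dots> = (if q' = q \<and> \<beta>' = \<beta> \<and> p = q \<and> p' = \<beta> then
          (\<Sum>j'<dA. \<Sum>k'<dB. wA q \<beta> j j' * wB q \<beta> k k' * (\<Sum>l<M. v q j' k' i l * t \<beta> l h)) else 0)"
        using lt by (simp add: sum_if_const)
      also have "\<dots> * (1 / complex_of_real (sqrt (2^m))) = c' * U $$ (r, s)"
        using c[OF r(1,2) s(1,2)] unfolding r s by (simp add: c'_def)
      finally show "X $$ (r, s) = (c' \<cdot>\<^sub>m U) $$ (r, s)" using Uc rs by simp
    qed
    then show ?thesis ..
  qed
  have main: "nlqc_channel a b m (nQ * dA) nB nB (nQ * dB) Vs V's Ws W's \<rho> = U * \<rho> * adj U"
    if rho: "\<rho> \<in> carrier_mat (dA * dB) (dA * dB)" for \<rho>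
  proof -
    have "nlqc_channel a b m (nQ * dA) nB nB (nQ * dB) Vs V's Ws W's \<rho>
      = apply_channel (dA * dB) (tensor_channel Ws W's) (?P2 *
          apply_channel d2 (tensor_channel Vs V's) (?P1 * (?E * \<rho> * adj ?E) * adj ?P1) * adj ?P2)"
      using kron_epr_state[OF rho, of m] unfolding nlqc_channel_def Let_def fd d2'(1) by simp
    also have "?P1 * (?E * \<rho> * adj ?E) * adj ?P1 = apply_channel d1 [?P1] (apply_channel d1 [?E] \<rho>)"
      using E P1 rho by (simp add: apply_channel_single[of _ d1 "dA * dB"] apply_channel_single[of _ d1 d1] conjugate_carrier)
    also have "\<dots> = apply_channel d1 (comp_channel [?P1] [?E]) \<rho>"
      using E P1 rho by (intro apply_comp_channel) auto
    also have "apply_channel d2 (tensor_channel Vs V's) \<dots>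
        = apply_channel d2 (comp_channel (tensor_channel Vs V's) (comp_channel [?P1] [?E])) \<rho>"
      using ch2 chVV rho by (intro apply_comp_channel) (auto simp: is_channel_def)
    also have "?P2 * \<dots> * adj ?P2 = apply_channel d2 [?P2] \<dots>"
      using ch3 rho P2 by (intro apply_channel_single[symmetric, of _ d2 d2] apply_channel_carrier[of _ d2 "dA * dB"]) (auto simp: is_channel_def)
    also have "\<dots> = apply_channel d2 (comp_channel [?P2] (comp_channel (tensor_channel Vs V's) (comp_channel [?P1] [?E]))) \<rho>"
      using ch3 rho P2 by (intro apply_comp_channel) (auto simp: is_channel_def)
    also have "apply_channel (dA * dB) (tensor_channel Ws W's) \<dots> = apply_channel (dA * dB) Ms \<rho>"
      unfolding Ms_def using ch4 chWW rho by (intro apply_comp_channel) (auto simp: is_channel_def)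
    also have "\<dots> = U * \<rho> * adj U"
    proof (rule apply_channel_scaled_unitary[OF _ ch5 eff' rho])
      show "is_unitary (dA * dB) U" using U by (simp add: fd)
    qed (simp_all add: dA_def dB_def)
    finally show ?thesis .
  qed
  show ?thesis
    unfolding nlqc_implements_def fd
    by (rule exI[of _ "nQ * dA"], rule exI[of _ nB], rule exI[of _ nB], rule exI[of _ "nQ * dB"],
        rule exI[of _ Vs], rule exI[of _ V's], rule exI[of _ Ws], rule exI[of _ W's])
       (intro conjI ballI chV chV' chW chW' main)
qed

section \<open>States reachable with teleportation\<close>

text \<open>Addition of bit vectors over the two-element field. Membership as an inequality of truth
  values lets \<open>auto\<close> settle its identities.\<close>

definition sd :: "'a set \<Rightarrow> 'a set \<Rightarrow> 'a set" where
  "sd A B = {x. (x \<in> A) \<noteq> (x \<in> B)}"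

lemma in_sd [simp]: "x \<in> sd A B \<longleftrightarrow> (x \<in> A) \<noteq> (x \<in> B)"
  by (simp add: sd_def)

lemma sd_simps [simp]: "sd A {} = A" "sd {} A = A" "sd A A = {}" "sd (sd A B) B = A" "sd A (sd A B) = B"
  by auto

lemma sd_commute: "sd A B = sd B A"
  by auto

lemma sd_assoc: "sd (sd A B) C = sd A (sd B C)"
  by auto

lemma sd_eq_iff: "sd A C = sd B C \<longleftrightarrow> A = B"
  by auto

lemma sd_subset: "A \<subseteq> C \<Longrightarrow> B \<subseteq> C \<Longrightarrow> sd A B \<subseteq> C"
  by auto

lemma finite_sd: "finite A \<Longrightarrow> finite B \<Longrightarrow> finite (sd A B)"
  by (rule finite_subset[of _ "A \<union> B"]) auto

lemma Int_sd: "A \<inter> sd B C = sd (A \<inter> B) (A \<inter> C)" "sd B C \<inter> A = sd (B \<inter> A) (C \<inter> A)"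
  by auto

lemma vimage_sd: "f -` sd A B = sd (f -` A) (f -` B)"
  by auto

lemma card_sd:
  assumes "finite A" "finite B"
  shows "card (sd A B) + 2 * card (A \<inter> B) = card A + card B"
proof -
  have "sd A B = (A \<union> B) - (A \<inter> B)" by auto
  then have "card (sd A B) = card (A \<union> B) - card (A \<inter> B)"
    using assms by (simp add: card_Diff_subset le_supI1)
  moreover have "card (A \<inter> B) \<le> card (A \<union> B)" using assms by (intro card_mono) auto
  ultimately show ?thesis using card_Un_Int[OF assms] by simp
qed

lemma odd_card_sd:
  assumes "finite A" "finite B"
  shows "odd (card (sd A B)) \<longleftrightarrow> odd (card A) \<noteq> odd (card B)"
proof -
  have "even (card (sd A B) + 2 * card (A \<inter> B)) \<longleftrightarrow> even (card A + card B)"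
    using card_sd[OF assms] by simp
  then show ?thesis by simp
qed

text \<open>Used as \<open>sg (z \<inter> s)\<close>, this is the character (-1)^(z.s) on bit
  vectors.\<close>

definition sg :: "'a set \<Rightarrow> complex" where
  "sg A = (-1) ^ card A"

lemma sg_alt: "sg A = (if odd (card A) then -1 else 1)"
  by (simp add: sg_def)

lemma sg_sd: "finite A \<Longrightarrow> finite B \<Longrightarrow> sg (sd A B) = sg A * sg B"
  by (simp add: sg_alt odd_card_sd)

lemma sg_simps [simp]: "sg {} = 1" "sg A * sg A = 1" "cnj (sg A) = sg A" "sg A * (sg A * c) = c"
  by (simp_all add: sg_alt)

lemma sum_sd_reindex:
  assumes "s \<subseteq> R"
  shows "(\<Sum>x\<in>Pow R. f (sd s x)) = (\<Sum>x\<in>Pow R. f x)"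
  by (rule sum.reindex_bij_witness[where i = "sd s" and j = "sd s"]) (use assms in auto)

text \<open>Orthogonality of characters: translation by some \<open>k\<close> in \<open>s\<close>
  flips every sign, so the sum equals its own negative.\<close>

lemma sum_sg_Pow:
  assumes "finite R" "s \<subseteq> R"
  shows "(\<Sum>z\<in>Pow R. sg (z \<inter> s)) = (if s = {} then 2 ^ card R else 0)"
proof (cases "s = {}")
  case False
  then obtain k where k: "k \<in> s" by auto
  have "(\<Sum>z\<in>Pow R. sg (z \<inter> s)) = (\<Sum>z\<in>Pow R. sg (sd {k} z \<inter> s))"
    using k assms by (intro sum_sd_reindex[symmetric, where f = "\<lambda>z. sg (z \<inter> s)"]) auto
  also have "\<dots> = (\<Sum>z\<in>Pow R. - sg (z \<inter> s))"
  proof (rule sum.cong[OF refl])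
    fix z assume "z \<in> Pow R"
    then have "finite (z \<inter> s)" "finite s" using assms by (auto intro: finite_subset)
    moreover have "sd {k} z \<inter> s = sd {k} (z \<inter> s)" using k by auto
    ultimately show "sg (sd {k} z \<inter> s) = - sg (z \<inter> s)" by (simp add: sg_sd) (simp add: sg_def)
  qed
  finally show ?thesis using False by (simp add: sum_negf)
qed (use assms in \<open>simp add: card_Pow\<close>)

lemma sum_swap_factor:
  fixes k :: "'c :: comm_semiring_0"
  shows "(\<Sum>z\<in>A. k * (\<Sum>t\<in>B. g z * f t)) = (\<Sum>t\<in>B. k * (\<Sum>z\<in>A. g z) * f t)"
  by (simp add: sum_distrib_left sum_distrib_right mult.assoc) (rule sum.swap)

lemma sum_sg_orthogonal:
  assumes "finite R" "s \<subseteq> R" "s' \<subseteq> R"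
  shows "(\<Sum>z\<in>Pow R. sg (z \<inter> s) * sg (z \<inter> s')) = (if s = s' then 2 ^ card R else 0)"
proof -
  have "(\<Sum>z\<in>Pow R. sg (z \<inter> s) * sg (z \<inter> s')) = (\<Sum>z\<in>Pow R. sg (z \<inter> sd s s'))"
    using assms by (intro sum.cong refl) (auto simp: Int_sd sg_sd finite_subset)
  also have "\<dots> = (if sd s s' = {} then 2 ^ card R else 0)"
    using assms by (intro sum_sg_Pow sd_subset)
  also have "sd s s' = {} \<longleftrightarrow> s = s'" by auto
  finally show ?thesis .
qed

text \<open>Operators on vectors whose basis is labelled by sets of qubits (those in state 1):
  \<open>pauli x z\<close> is \<open>Z\<^sup>z X\<^sup>x\<close>, and \<open>pm p\<close> moves qubit \<open>k\<close> to position \<open>p k\<close>.\<close>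
definition pauli :: "nat set \<Rightarrow> nat set \<Rightarrow> (nat set \<Rightarrow> complex) \<Rightarrow> nat set \<Rightarrow> complex" where
  "pauli x z \<phi> = (\<lambda>S. sg (z \<inter> S) * \<phi> (sd S x))"

definition pm :: "(nat \<Rightarrow> nat) \<Rightarrow> (nat set \<Rightarrow> complex) \<Rightarrow> nat set \<Rightarrow> complex" where
  "pm p \<phi> = (\<lambda>S. \<phi> (p -` S))"

text \<open>A history lists the X and Z outcomes of one party's Bell measurements, one pair per
  round. In a \<open>state\<close> the first argument labels the data qubits and the second the
  rails.\<close>

type_synonym history = "(nat set \<times> nat set) list"
type_synonym state = "nat set \<Rightarrow> nat set \<Rightarrow> complex"

locale protocol =
  fixes a b W :: nat
begin

abbreviation "DA \<equiv> {..<a}"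
abbreviation "DB \<equiv> {a..<a + b}"
abbreviation "D \<equiv> {..<a + b}"
abbreviation "R \<equiv> {..<W}"

definition ip :: "state \<Rightarrow> state \<Rightarrow> complex" where
  "ip \<psi> \<phi> = (\<Sum>T\<in>Pow D. \<Sum>S\<in>Pow R. cnj (\<psi> T S) * \<phi> T S)"

definition alice_complete ::
  "history set \<Rightarrow> history set \<Rightarrow> (history \<Rightarrow> nat set \<Rightarrow> history \<Rightarrow> state) \<Rightarrow> bool" where
  "alice_complete HA LL v \<longleftrightarrow> (\<forall>i\<in>Pow DA. \<forall>l\<in>LL. \<forall>i'\<in>Pow DA. \<forall>l'\<in>LL.
     (\<Sum>\<alpha>\<in>HA. ip (v \<alpha> i l) (v \<alpha> i' l')) = (if i = i' \<and> l = l' then 1 else 0))"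

definition bob_complete ::
  "history set \<Rightarrow> history set \<Rightarrow> (history \<Rightarrow> history \<Rightarrow> nat set \<Rightarrow> complex) \<Rightarrow> bool" where
  "bob_complete HB LL \<tau> \<longleftrightarrow> (\<forall>l\<in>LL. \<forall>j\<in>Pow DB. \<forall>l'\<in>LL. \<forall>j'\<in>Pow DB.
     (\<Sum>\<beta>\<in>HB. cnj (\<tau> \<beta> l j) * \<tau> \<beta> l' j') = (if l = l' \<and> j = j' then 1 else 0))"

definition contracts ::
  "history set \<Rightarrow> history set \<Rightarrow> history set \<Rightarrow> (history \<Rightarrow> nat set \<Rightarrow> history \<Rightarrow> state) \<Rightarrow>
   (history \<Rightarrow> history \<Rightarrow> nat set \<Rightarrow> complex) \<Rightarrow> (history \<Rightarrow> history \<Rightarrow> nat set \<Rightarrow> nat set \<Rightarrow> state) \<Rightarrow> bool" where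
  "contracts HA HB LL v \<tau> G \<longleftrightarrow> (\<forall>\<alpha>\<in>HA. \<forall>\<beta>\<in>HB. \<exists>c. \<forall>i\<in>Pow DA. \<forall>j\<in>Pow DB. \<forall>T\<in>Pow D. \<forall>S\<in>Pow R.
     (\<Sum>l\<in>LL. \<tau> \<beta> l j * v \<alpha> i l T S) = c * G \<alpha> \<beta> i j T S)"

text \<open>States that the protocol can produce with \<open>m\<close> EPR pairs. Alice's operation with outcome \<open>\<alpha>\<close> is
  \<open>v \<alpha>\<close>, Bob's rank-one measurement with outcome \<open>\<beta>\<close> is \<open>\<tau> \<beta>\<close>, and \<open>LL\<close> labels the basis of the shared
  halves; contracting the EPR pairs, the joint outcome maps \<open>|i,j\<rangle>\<close> to a multiple of \<open>G \<alpha> \<beta> i j\<close>, held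
  entirely by Alice.\<close>
definition reach ::
  "history set \<Rightarrow> history set \<Rightarrow> nat \<Rightarrow> (history \<Rightarrow> history \<Rightarrow> nat set \<Rightarrow> nat set \<Rightarrow> state) \<Rightarrow> bool" where
  "reach HA HB m G \<longleftrightarrow> finite HA \<and> finite HB \<and> (\<exists>LL v \<tau>. finite LL \<and> card LL = 2 ^ m \<and>
     alice_complete HA LL v \<and> bob_complete HB LL \<tau> \<and> contracts HA HB LL v \<tau> G)"

text \<open>Each joint outcome carries its own unspecified scalar in \<open>contracts\<close>.
  Phases that arise from moving Paulis past gates may therefore be dropped, as long as they depend
  on the outcomes only.\<close>

lemma reach_scale:
  assumes "reach HA HB m G"
    and "\<And>\<alpha> \<beta>. \<alpha> \<in> HA \<Longrightarrow> \<beta> \<in> HB \<Longrightarrow>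
      \<exists>c. \<forall>i\<in>Pow DA. \<forall>j\<in>Pow DB. \<forall>T\<in>Pow D. \<forall>S\<in>Pow R. G \<alpha> \<beta> i j T S = c * G' \<alpha> \<beta> i j T S"
  shows "reach HA HB m G'"
proof -
  obtain LL v \<tau> where fin: "finite HA" "finite HB" "finite LL" and card: "card LL = 2 ^ m"
    and v: "alice_complete HA LL v" and \<tau>: "bob_complete HB LL \<tau>"
    and G: "contracts HA HB LL v \<tau> G"
    using assms(1) unfolding reach_def by (elim conjE exE)
  have "contracts HA HB LL v \<tau> G'"
    unfolding contracts_def
  proof (intro ballI)
    fix \<alpha> \<beta> assume ab: "\<alpha> \<in> HA" "\<beta> \<in> HB"
    from bspec[OF bspec[OF G[unfolded contracts_def] ab(1)] ab(2)]
    obtain c where c: "\<forall>i\<in>Pow DA. \<forall>j\<in>Pow DB. \<forall>T\<in>Pow D. \<forall>S\<in>Pow R.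
        (\<Sum>l\<in>LL. \<tau> \<beta> l j * v \<alpha> i l T S) = c * G \<alpha> \<beta> i j T S" by (elim exE)
    from assms(2)[OF ab] obtain c' where c': "\<forall>i\<in>Pow DA. \<forall>j\<in>Pow DB. \<forall>T\<in>Pow D. \<forall>S\<in>Pow R.
        G \<alpha> \<beta> i j T S = c' * G' \<alpha> \<beta> i j T S" by (elim exE)
    show "\<exists>c. \<forall>i\<in>Pow DA. \<forall>j\<in>Pow DB. \<forall>T\<in>Pow D. \<forall>S\<in>Pow R.
        (\<Sum>l\<in>LL. \<tau> \<beta> l j * v \<alpha> i l T S) = c * G' \<alpha> \<beta> i j T S"
      using c c' by (intro exI[of _ "c * c'"]) simp
  qed
  then show ?thesis unfolding reach_def using fin card v \<tau> by blast
qed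

text \<open>States are functions on all sets, although only labels inside \<open>D\<close> and
  \<open>R\<close> are meaningful; the last clause says that values elsewhere have no influence.
  Linearity is stated for sums indexed by histories because this is the form of the contraction over
  \<open>LL\<close>.\<close>

definition lin_iso :: "(state \<Rightarrow> state) \<Rightarrow> bool" where
  "lin_iso Q \<longleftrightarrow>
     (\<forall>(L :: history set) c f. finite L \<longrightarrow> Q (\<lambda>T S. \<Sum>l\<in>L. c l * f l T S) = (\<lambda>T S. \<Sum>l\<in>L. c l * Q (f l) T S)) \<and>
     (\<forall>\<psi> \<phi>. ip (Q \<psi>) (Q \<phi>) = ip \<psi> \<phi>) \<and>
     (\<forall>\<psi> \<phi>. (\<forall>T\<in>Pow D. \<forall>S\<in>Pow R. \<psi> T S = \<phi> T S) \<longrightarrow> (\<forall>T\<in>Pow D. \<forall>S\<in>Pow R. Q \<psi> T S = Q \<phi> T S))"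

lemma lin_iso_sum:
  assumes "lin_iso Q" "finite L"
  shows "Q (\<lambda>T S. \<Sum>l\<in>L. c l * f (l :: history) T S) = (\<lambda>T S. \<Sum>l\<in>L. c l * Q (f l) T S)"
  using assms by (simp add: lin_iso_def)

lemma lin_iso_local:
  assumes "lin_iso Q" "\<forall>T\<in>Pow D. \<forall>S\<in>Pow R. \<psi> T S = \<phi> T S" "T \<in> Pow D" "S \<in> Pow R"
  shows "Q \<psi> T S = Q \<phi> T S"
  using assms by (simp add: lin_iso_def)

lemma lin_iso_scale:
  assumes "lin_iso Q"
  shows "Q (\<lambda>T S. c * \<psi> T S) = (\<lambda>T S. c * Q \<psi> T S)"
proof -
  \<comment> \<open>A scalar multiple is a sum with a single summand, here indexed by the empty
    history.\<close>
  have "Q (\<lambda>T S. \<Sum>l\<in>{[]::history}. c * \<psi> T S) = (\<lambda>T S. \<Sum>l\<in>{[]::history}. c * Q \<psi> T S)"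
    by (rule lin_iso_sum[OF assms]) simp
  then show ?thesis by simp
qed

text \<open>A permutation of basis labels combined with unit phases; this covers rail permutations,
  phase gates, T gates and wire swaps.\<close>

lemma lin_iso_monomial:
  assumes "bij_betw \<sigma> (Pow D \<times> Pow R) (Pow D \<times> Pow R)" "\<And>T S. cnj (u T S) * u T S = 1"
  shows "lin_iso (\<lambda>\<psi> T S. u T S * \<psi> (fst (\<sigma> (T, S))) (snd (\<sigma> (T, S))))"
  unfolding lin_iso_def
proof (intro conjI allI impI ballI)
  fix \<psi> \<phi> :: state
  have "ip (\<lambda>T S. u T S * \<psi> (fst (\<sigma> (T, S))) (snd (\<sigma> (T, S)))) (\<lambda>T S. u T S * \<phi> (fst (\<sigma> (T, S))) (snd (\<sigma> (T, S))))
      = (\<Sum>p\<in>Pow D \<times> Pow R. (\<lambda>q. cnj (\<psi> (fst q) (snd q)) * \<phi> (fst q) (snd q)) (\<sigma> p))"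
    unfolding ip_def sum.cartesian_product
  proof (intro sum.cong refl, clarify)
    fix T S
    have "cnj (u T S * x) * (u T S * y) = (cnj (u T S) * u T S) * (cnj x * y)" for x y
      by simp
    then show "cnj (u T S * \<psi> (fst (\<sigma> (T, S))) (snd (\<sigma> (T, S)))) * (u T S * \<phi> (fst (\<sigma> (T, S))) (snd (\<sigma> (T, S))))
      = cnj (\<psi> (fst (\<sigma> (T, S))) (snd (\<sigma> (T, S)))) * \<phi> (fst (\<sigma> (T, S))) (snd (\<sigma> (T, S)))"
      using assms(2) by simp
  qed
  also have "\<dots> = ip \<psi> \<phi>"
    unfolding ip_def sum.cartesian_product by (subst sum.reindex_bij_betw[OF assms(1)]) (simp add: case_prod_beta)
  finally show "ip (\<lambda>T S. u T S * \<psi> (fst (\<sigma> (T, S))) (snd (\<sigma> (T, S))))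
     (\<lambda>T S. u T S * \<phi> (fst (\<sigma> (T, S))) (snd (\<sigma> (T, S)))) = ip \<psi> \<phi>" .
next
  fix \<psi> \<phi> :: state and T S assume *: "\<forall>T\<in>Pow D. \<forall>S\<in>Pow R. \<psi> T S = \<phi> T S" "T \<in> Pow D" "S \<in> Pow R"
  then have "\<sigma> (T, S) \<in> \<sigma> ` (Pow D \<times> Pow R)" by blast
  then have "\<sigma> (T, S) \<in> Pow D \<times> Pow R" using bij_betw_imp_surj_on[OF assms(1)] by metis
  then show "u T S * \<psi> (fst (\<sigma> (T, S))) (snd (\<sigma> (T, S))) = u T S * \<phi> (fst (\<sigma> (T, S))) (snd (\<sigma> (T, S)))"
    using * by (auto simp: mem_Times_iff)
qed (simp add: sum_distrib_left mult_ac)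

text \<open>Bob's contraction is a linear combination of Alice's states, hence commutes with her
  isometry. The isometry may depend on her outcome but not on Bob's.\<close>

lemma reach_local:
  assumes "reach HA HB m G" and Q: "\<And>\<alpha>. \<alpha> \<in> HA \<Longrightarrow> lin_iso (Q \<alpha>)"
  shows "reach HA HB m (\<lambda>\<alpha> \<beta> i j. Q \<alpha> (G \<alpha> \<beta> i j))"
proof -
  obtain LL v \<tau> where fin: "finite HA" "finite HB" "finite LL" and card: "card LL = 2 ^ m"
    and v: "alice_complete HA LL v" and \<tau>: "bob_complete HB LL \<tau>"
    and G: "contracts HA HB LL v \<tau> G"
    using assms(1) unfolding reach_def by (elim conjE exE)
  have "alice_complete HA LL (\<lambda>\<alpha> i l. Q \<alpha> (v \<alpha> i l))"
    unfolding alice_complete_def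
  proof (intro ballI)
    fix i l i' l' assume *: "i \<in> Pow DA" "l \<in> LL" "i' \<in> Pow DA" "l' \<in> LL"
    have "(\<Sum>\<alpha>\<in>HA. ip (Q \<alpha> (v \<alpha> i l)) (Q \<alpha> (v \<alpha> i' l'))) = (\<Sum>\<alpha>\<in>HA. ip (v \<alpha> i l) (v \<alpha> i' l'))"
      using Q by (intro sum.cong refl) (auto simp: lin_iso_def)
    then show "(\<Sum>\<alpha>\<in>HA. ip (Q \<alpha> (v \<alpha> i l)) (Q \<alpha> (v \<alpha> i' l'))) = (if i = i' \<and> l = l' then 1 else 0)"
      using v * by (simp add: alice_complete_def)
  qed
  moreover have "contracts HA HB LL (\<lambda>\<alpha> i l. Q \<alpha> (v \<alpha> i l)) \<tau> (\<lambda>\<alpha> \<beta> i j. Q \<alpha> (G \<alpha> \<beta> i j))"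
    unfolding contracts_def
  proof (intro ballI)
    fix \<alpha> \<beta> assume ab: "\<alpha> \<in> HA" "\<beta> \<in> HB"
    obtain c where c: "\<forall>i\<in>Pow DA. \<forall>j\<in>Pow DB. \<forall>T\<in>Pow D. \<forall>S\<in>Pow R.
          (\<Sum>l\<in>LL. \<tau> \<beta> l j * v \<alpha> i l T S) = c * G \<alpha> \<beta> i j T S"
      using bspec[OF bspec[OF G[unfolded contracts_def] ab(1)] ab(2)] by (elim exE)
    have "\<forall>i\<in>Pow DA. \<forall>j\<in>Pow DB. \<forall>T\<in>Pow D. \<forall>S\<in>Pow R.
          (\<Sum>l\<in>LL. \<tau> \<beta> l j * Q \<alpha> (v \<alpha> i l) T S) = c * Q \<alpha> (G \<alpha> \<beta> i j) T S"
    proof (intro ballI)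
      fix i j T S assume *: "i \<in> Pow DA" "j \<in> Pow DB" "T \<in> Pow D" "S \<in> Pow R"
      have "(\<lambda>T S. \<Sum>l\<in>LL. \<tau> \<beta> l j * Q \<alpha> (v \<alpha> i l) T S) = Q \<alpha> (\<lambda>T S. \<Sum>l\<in>LL. \<tau> \<beta> l j * v \<alpha> i l T S)"
        using Q[OF ab(1)] fin(3) by (simp add: lin_iso_def)
      then have "(\<Sum>l\<in>LL. \<tau> \<beta> l j * Q \<alpha> (v \<alpha> i l) T S) = Q \<alpha> (\<lambda>T S. \<Sum>l\<in>LL. \<tau> \<beta> l j * v \<alpha> i l T S) T S"
        by (rule fun_cong[OF fun_cong])
      also have "\<dots> = Q \<alpha> (\<lambda>T S. c * G \<alpha> \<beta> i j T S) T S"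
        by (rule lin_iso_local[OF Q[OF ab(1)] bspec[OF bspec[OF c *(1)] *(2)] *(3,4)])
      finally show "(\<Sum>l\<in>LL. \<tau> \<beta> l j * Q \<alpha> (v \<alpha> i l) T S) = c * Q \<alpha> (G \<alpha> \<beta> i j) T S"
        using lin_iso_scale[OF Q[OF ab(1)]] by simp
    qed
    then show "\<exists>c. \<forall>i\<in>Pow DA. \<forall>j\<in>Pow DB. \<forall>T\<in>Pow D. \<forall>S\<in>Pow R.
          (\<Sum>l\<in>LL. \<tau> \<beta> l j * Q \<alpha> (v \<alpha> i l) T S) = c * Q \<alpha> (G \<alpha> \<beta> i j) T S" ..
  qed
  ultimately show ?thesis unfolding reach_def using fin card \<tau> by blast
qed

text \<open>Serves for histories and for EPR labels alike. As a label, the new pair describes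
  \<open>2 * W\<close> EPR pairs: the first component those that carry the rails to Bob, the second
  those that carry them back.\<close>

definition ext :: "history set \<Rightarrow> history set" where
  "ext H = (\<lambda>(h, e). h @ [e]) ` (H \<times> (Pow R \<times> Pow R))"

lemma in_ext_iff: "h \<in> ext H \<longleftrightarrow> (\<exists>h' x z. h = h' @ [(x, z)] \<and> h' \<in> H \<and> x \<subseteq> R \<and> z \<subseteq> R)"
  by (auto simp: ext_def)

lemma finite_ext: "finite H \<Longrightarrow> finite (ext H)"
  by (simp add: ext_def)

lemma sum_ext: "(\<Sum>h\<in>ext H. f h) = (\<Sum>h\<in>H. \<Sum>x\<in>Pow R. \<Sum>z\<in>Pow R. f (h @ [(x, z)]))"
proof -
  have "inj_on (\<lambda>(h, e). h @ [e]) (H \<times> (Pow R \<times> Pow R))" by (auto simp: inj_on_def)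
  then show ?thesis
    unfolding ext_def by (subst sum.reindex) (simp_all add: sum.cartesian_product case_prod_beta comp_def)
qed

lemma card_ext: "card (ext H) = card H * 2 ^ (2 * W)"
proof -
  have "inj_on (\<lambda>(h, e). h @ [e]) (H \<times> (Pow R \<times> Pow R))" by (auto simp: inj_on_def)
  then show ?thesis
    by (simp add: ext_def card_image card_cartesian_product card_Pow power_add mult_2)
qed

text \<open>Teleporting all rails to Bob, who permutes them by \<open>p \<beta>\<close> and teleports them back.
  The first Pauli error is known to Alice, the second one to Bob.\<close>
lemma reach_round_trip:
  assumes "reach HA HB m G" and p: "\<And>\<beta>. \<beta> \<in> HB \<Longrightarrow> p \<beta> permutes R"
  shows "reach (ext HA) (ext HB) (m + 2 * W) (\<lambda>\<alpha> \<beta> i j T.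
     pauli (fst (last \<beta>)) (snd (last \<beta>)) (pm (p (butlast \<beta>))
       (pauli (fst (last \<alpha>)) (snd (last \<alpha>)) (G (butlast \<alpha>) (butlast \<beta>) i j T))))"
    (is "reach _ _ _ ?G")
proof -
  obtain LL v \<tau> where fin: "finite HA" "finite HB" "finite LL" and card: "card LL = 2 ^ m"
    and v: "alice_complete HA LL v" and \<tau>: "bob_complete HB LL \<tau>"
    and G: "contracts HA HB LL v \<tau> G"
    using assms(1) unfolding reach_def by (elim conjE exE)
  note v = v[unfolded alice_complete_def, rule_format] and \<tau> = \<tau>[unfolded bob_complete_def, rule_format]
  \<comment> \<open>The normalization 2^(-W/2) of a Bell basis vector on \<open>W\<close>
    rails.\<close>
  define \<kappa> where "\<kappa> = 1 / complex_of_real (sqrt (2 ^ W))"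
  have \<kappa>: "cnj \<kappa> = \<kappa>" "\<kappa> * (\<kappa> * 2 ^ W) = 1" "\<kappa> * \<kappa> * 2 ^ W = 1"
    by (simp_all add: \<kappa>_def field_simps flip: of_real_mult)
  \<comment> \<open>Alice measures her rails in the Bell basis together with the first group of
    pairs; her halves of the second group become the new rails, whence
    \<open>S = snd (last l)\<close>.\<close>
  define v' where "v' \<alpha> i l T S = (if S = snd (last l) then
      \<kappa> * pauli (fst (last \<alpha>)) (snd (last \<alpha>)) (v (butlast \<alpha>) i (butlast l) T) (fst (last l)) else 0)"
    for \<alpha> i and l :: history and T S
  \<comment> \<open>Bob receives the rails on the first group, permutes them, and measures them in
    the Bell basis with his halves of the second group.\<close>
  define \<tau>' where "\<tau>' \<beta> l j = \<kappa> * (pauli (fst (last \<beta>)) (snd (last \<beta>)) (pm (p (butlast \<beta>))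
      (\<lambda>s. if s = fst (last l) then 1 else 0)) (snd (last l)) * \<tau> (butlast \<beta>) (butlast l) j)"
    for \<beta> and l :: history and j
  have v'c: "(\<Sum>\<alpha>\<in>ext HA. ip (v' \<alpha> i l) (v' \<alpha> i' l')) = (if i = i' \<and> l = l' then 1 else 0)"
    if *: "i \<in> Pow DA" "l \<in> ext LL" "i' \<in> Pow DA" "l' \<in> ext LL" for i l i' l'
  proof -
    obtain k s t where l: "l = k @ [(s, t)]" "k \<in> LL" "s \<subseteq> R" "t \<subseteq> R" using *(2) by (auto simp: in_ext_iff)
    obtain k' s' t' where l': "l' = k' @ [(s', t')]" "k' \<in> LL" "s' \<subseteq> R" "t' \<subseteq> R"
      using *(4) by (auto simp: in_ext_iff)
    have ipv: "ip (v' (\<alpha> @ [(x, z)]) i l) (v' (\<alpha> @ [(x, z)]) i' l')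
        = (if t = t' then \<kappa> * \<kappa> * (\<Sum>T\<in>Pow D. sg (z \<inter> s) * sg (z \<inter> s') *
             (cnj (v \<alpha> i k T (sd s x)) * v \<alpha> i' k' T (sd s' x))) else 0)" for \<alpha> x z
    proof -
      have "ip (v' (\<alpha> @ [(x, z)]) i l) (v' (\<alpha> @ [(x, z)]) i' l')
          = (\<Sum>T\<in>Pow D. \<Sum>S\<in>Pow R. if S = t then if t = t' then
             \<kappa> * \<kappa> * (sg (z \<inter> s) * sg (z \<inter> s') * (cnj (v \<alpha> i k T (sd s x)) * v \<alpha> i' k' T (sd s' x))) else 0 else 0)"
        unfolding ip_def by (intro sum.cong refl) (auto simp: v'_def l l' pauli_def \<kappa>)
      also have "\<dots> = (if t = t' then \<kappa> * \<kappa> * (\<Sum>T\<in>Pow D. sg (z \<inter> s) * sg (z \<inter> s') *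
             (cnj (v \<alpha> i k T (sd s x)) * v \<alpha> i' k' T (sd s' x))) else 0)"
        using l by (simp add: sum_distrib_left)
      finally show ?thesis .
    qed
    show ?thesis
    proof (cases "t = t'")
      case True
      \<comment> \<open>Summing over the Z outcome first forces s = s'; after that the X outcome
        merely translates the rail label.\<close>
      have "(\<Sum>\<alpha>\<in>ext HA. ip (v' \<alpha> i l) (v' \<alpha> i' l'))
          = (\<Sum>\<alpha>\<in>HA. \<Sum>x\<in>Pow R. \<Sum>T\<in>Pow D. \<kappa> * \<kappa> * (\<Sum>z\<in>Pow R. sg (z \<inter> s) * sg (z \<inter> s')) *
               (cnj (v \<alpha> i k T (sd s x)) * v \<alpha> i' k' T (sd s' x)))"
        unfolding sum_ext ipv using True
        by (simp only: if_P[OF refl] sum_swap_factor)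
      also have "\<dots> = (if s = s' then (\<Sum>\<alpha>\<in>HA. \<Sum>T\<in>Pow D. \<Sum>x\<in>Pow R. cnj (v \<alpha> i k T (sd s x)) * v \<alpha> i' k' T (sd s x)) else 0)"
        using l l' by (simp add: sum_sg_orthogonal \<kappa> sum.swap[of _ "Pow R" "Pow D"])
      also have "\<dots> = (if s = s' then (\<Sum>\<alpha>\<in>HA. ip (v \<alpha> i k) (v \<alpha> i' k')) else 0)"
        unfolding ip_def
        by (simp only: sum_sd_reindex[OF l(3), of "\<lambda>S. cnj (v \<alpha> i k T S) * v \<alpha> i' k' T S" for \<alpha> T])
      finally show ?thesis using v[OF *(1) l(2) *(3) l'(2)] True l l' by auto
    next
      case False
      then show ?thesis unfolding sum_ext ipv using l l' by simp
    qed
  qed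
  have \<tau>'c: "(\<Sum>\<beta>\<in>ext HB. cnj (\<tau>' \<beta> l j) * \<tau>' \<beta> l' j') = (if l = l' \<and> j = j' then 1 else 0)"
    if *: "l \<in> ext LL" "j \<in> Pow DB" "l' \<in> ext LL" "j' \<in> Pow DB" for l j l' j'
  proof -
    obtain k s t where l: "l = k @ [(s, t)]" "k \<in> LL" "s \<subseteq> R" "t \<subseteq> R" using *(1) by (auto simp: in_ext_iff)
    obtain k' s' t' where l': "l' = k' @ [(s', t')]" "k' \<in> LL" "s' \<subseteq> R" "t' \<subseteq> R"
      using *(3) by (auto simp: in_ext_iff)
    have "(\<Sum>x\<in>Pow R. \<Sum>z\<in>Pow R. cnj (\<tau>' (\<beta> @ [(x, z)]) l j) * \<tau>' (\<beta> @ [(x, z)]) l' j')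
        = (if s = s' \<and> t = t' then cnj (\<tau> \<beta> k j) * \<tau> \<beta> k' j' else 0)" if b: "\<beta> \<in> HB" for \<beta>
    proof -
      note pb = p[OF b]
      have pre: "p \<beta> -` sd t x = s \<longleftrightarrow> sd t x = p \<beta> ` s" for s t x
        using permutes_bij[OF pb] by (metis bij_betw_imp_surj bij_is_inj inj_vimage_image_eq surj_image_vimage_eq)
      have img: "p \<beta> ` s \<subseteq> R" if "s \<subseteq> R" for s
        using permutes_image[OF pb] that by blast
      have "(\<Sum>x\<in>Pow R. \<Sum>z\<in>Pow R. cnj (\<tau>' (\<beta> @ [(x, z)]) l j) * \<tau>' (\<beta> @ [(x, z)]) l' j')
          = (\<Sum>x\<in>Pow R. \<Sum>z\<in>Pow R. \<kappa> * \<kappa> * (if sd t x = p \<beta> ` s then if sd t' x = p \<beta> ` s' then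
              sg (z \<inter> t) * sg (z \<inter> t') else 0 else 0) * (cnj (\<tau> \<beta> k j) * \<tau> \<beta> k' j'))"
        by (intro sum.cong refl) (simp add: \<tau>'_def l l' pauli_def pm_def \<kappa> pre)
      also have "\<dots> = (\<Sum>x\<in>Pow R. \<kappa> * \<kappa> * (if sd t x = p \<beta> ` s then if sd t' x = p \<beta> ` s' then
              (\<Sum>z\<in>Pow R. sg (z \<inter> t) * sg (z \<inter> t')) else 0 else 0) * (cnj (\<tau> \<beta> k j) * \<tau> \<beta> k' j'))"
        by (intro sum.cong refl) (auto simp: sum_distrib_left sum_distrib_right)
      also have "\<dots> = (\<Sum>x\<in>Pow R. if sd t x = p \<beta> ` s then if sd t' x = p \<beta> ` s' then if t = t' then
              cnj (\<tau> \<beta> k j) * \<tau> \<beta> k' j' else 0 else 0 else 0)"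
        using l l' by (intro sum.cong refl) (simp add: sum_sg_orthogonal \<kappa>)
      \<comment> \<open>Once t = t', the X outcome determines the image of the label s under
        \<open>p \<beta>\<close>, and injectivity gives s = s'.\<close>
      also have "\<dots> = (\<Sum>x\<in>Pow R. if sd t x = p \<beta> ` s then if t = t' \<and> s = s' then
              cnj (\<tau> \<beta> k j) * \<tau> \<beta> k' j' else 0 else 0)"
        using inj_image_eq_iff[OF permutes_inj[OF pb]] by (intro sum.cong refl) auto
      also have "\<dots> = (if s = s' \<and> t = t' then cnj (\<tau> \<beta> k j) * \<tau> \<beta> k' j' else 0)"
        using img[OF l(3)] by (subst sum_sd_reindex[OF l(4), of "\<lambda>y. if y = p \<beta> ` s then if t = t' \<and> s = s' then
              cnj (\<tau> \<beta> k j) * \<tau> \<beta> k' j' else 0 else 0"]) auto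
      finally show ?thesis .
    qed
    then have "(\<Sum>\<beta>\<in>ext HB. cnj (\<tau>' \<beta> l j) * \<tau>' \<beta> l' j')
        = (\<Sum>\<beta>\<in>HB. if s = s' \<and> t = t' then cnj (\<tau> \<beta> k j) * \<tau> \<beta> k' j' else 0)"
      unfolding sum_ext by (intro sum.cong refl)
    also have "\<dots> = (if s = s' \<and> t = t' then (\<Sum>\<beta>\<in>HB. cnj (\<tau> \<beta> k j) * \<tau> \<beta> k' j') else 0)" by (rule sum_if_const)
    finally show ?thesis using \<tau>[OF l(2) *(2) l'(2) *(4)] l l' by auto
  qed
  have G': "\<exists>c. \<forall>i\<in>Pow DA. \<forall>j\<in>Pow DB. \<forall>T\<in>Pow D. \<forall>S\<in>Pow R.
      (\<Sum>l\<in>ext LL. \<tau>' \<beta> l j * v' \<alpha> i l T S) = c * ?G \<alpha> \<beta> i j T S"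
    if ab: "\<alpha> \<in> ext HA" "\<beta> \<in> ext HB" for \<alpha> \<beta>
  proof -
    obtain \<alpha>0 x z where \<alpha>: "\<alpha> = \<alpha>0 @ [(x, z)]" "\<alpha>0 \<in> HA" "x \<subseteq> R" "z \<subseteq> R" using ab(1) by (auto simp: in_ext_iff)
    obtain \<beta>0 x2 z2 where \<beta>: "\<beta> = \<beta>0 @ [(x2, z2)]" "\<beta>0 \<in> HB" "x2 \<subseteq> R" "z2 \<subseteq> R" using ab(2) by (auto simp: in_ext_iff)
    obtain c where c: "\<forall>i\<in>Pow DA. \<forall>j\<in>Pow DB. \<forall>T\<in>Pow D. \<forall>S\<in>Pow R.
          (\<Sum>l\<in>LL. \<tau> \<beta>0 l j * v \<alpha>0 i l T S) = c * G \<alpha>0 \<beta>0 i j T S"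
      using bspec[OF bspec[OF G[unfolded contracts_def] \<alpha>(2)] \<beta>(2)] by (elim exE)
    note c = c[rule_format]
    have "(\<Sum>l\<in>ext LL. \<tau>' \<beta> l j * v' \<alpha> i l T S) = \<kappa> * \<kappa> * c * ?G \<alpha> \<beta> i j T S"
      if *: "i \<in> Pow DA" "j \<in> Pow DB" "T \<in> Pow D" "S \<in> Pow R" for i j T S
    proof -
      \<comment> \<open>Bob's outcome and permutation fix the first component of the new label and
        Alice's new rails fix the second, so a single term survives.\<close>
      let ?s = "p \<beta>0 -` sd S x2"
      have s: "?s \<subseteq> R" using *(4) \<beta>(3) permutes_in_image[OF p[OF \<beta>(2)]] by fastforce
      have "(\<Sum>l\<in>ext LL. \<tau>' \<beta> l j * v' \<alpha> i l T S)
          = (\<Sum>l\<in>LL. \<Sum>s\<in>Pow R. \<Sum>t\<in>Pow R. if t = S then if s = ?s then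
              \<kappa> * \<kappa> * (sg (z2 \<inter> S) * sg (z \<inter> ?s)) * (\<tau> \<beta>0 l j * v \<alpha>0 i l T (sd ?s x)) else 0 else 0)"
        unfolding sum_ext by (intro sum.cong refl) (auto simp: \<tau>'_def v'_def \<alpha> \<beta> pauli_def pm_def)
      also have "\<dots> = \<kappa> * \<kappa> * (sg (z2 \<inter> S) * sg (z \<inter> ?s)) * (\<Sum>l\<in>LL. \<tau> \<beta>0 l j * v \<alpha>0 i l T (sd ?s x))"
        using * s by (simp add: sum_distrib_left)
      also have "(\<Sum>l\<in>LL. \<tau> \<beta>0 l j * v \<alpha>0 i l T (sd ?s x)) = c * G \<alpha>0 \<beta>0 i j T (sd ?s x)"
        by (rule c[OF *(1-3) PowI[OF sd_subset[OF s \<alpha>(3)]]])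
      finally show ?thesis by (simp add: \<alpha> \<beta> pauli_def pm_def)
    qed
    then show ?thesis by blast
  qed
  have card': "card (ext LL) = 2 ^ (m + 2 * W)" using card by (simp add: card_ext power_add)
  show ?thesis unfolding reach_def alice_complete_def bob_complete_def contracts_def
    by (intro conjI exI[of _ "ext LL"] exI[of _ v'] exI[of _ \<tau>'] finite_ext fin card' ballI v'c \<tau>'c G')
qed

text \<open>The outset of the protocol. Only Bob measures; Alice's history is padded by an empty
  pair so that both histories have length 1. All rails start in state 0.\<close>

lemma reach_teleport:
  "reach {[({}, {})]} ((\<lambda>e. [e]) ` (Pow DB \<times> Pow DB)) b
     (\<lambda>\<alpha> \<beta> i j T S. pauli (fst (hd \<beta>)) (snd (hd \<beta>)) (\<lambda>s. if s = i \<union> j then 1 else 0) T * (if S = {} then 1 else 0))"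
    (is "reach ?HA ?HB b ?G")
proof -
  let ?LL = "(\<lambda>s. [(s, {})]) ` Pow DB :: history set"
  define \<kappa> where "\<kappa> = 1 / complex_of_real (sqrt (2 ^ b))"
  have \<kappa>: "cnj \<kappa> = \<kappa>" "\<kappa> * (\<kappa> * 2 ^ b) = 1" "\<kappa> * \<kappa> * 2 ^ b = 1"
    by (simp_all add: \<kappa>_def field_simps flip: of_real_mult)
  define v where "v \<alpha> i l T S = (if T = i \<union> fst (hd l) then if S = {} then 1 else 0 else (0::complex))"
    for \<alpha> :: history and i and l :: history and T and S :: "nat set"
  define \<tau> where "\<tau> \<beta> l j = \<kappa> * pauli (fst (hd \<beta>)) (snd (hd \<beta>)) (\<lambda>s. if s = j then 1 else 0) (fst (hd l))"
    for \<beta> l :: history and j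
  have union: "i \<union> l = i' \<union> l' \<longleftrightarrow> i = i' \<and> l = l'"
    if "i \<subseteq> DA" "i' \<subseteq> DA" "l \<subseteq> DB" "l' \<subseteq> DB" for i i' l l'
  proof
    assume "i \<union> l = i' \<union> l'"
    moreover have "i = (i \<union> l) \<inter> DA" "i' = (i' \<union> l') \<inter> DA" "l = (i \<union> l) \<inter> DB" "l' = (i' \<union> l') \<inter> DB"
      using that by fastforce+
    ultimately show "i = i' \<and> l = l'" by metis
  qed simp
  have "(\<Sum>\<alpha>\<in>?HA. ip (v \<alpha> i l) (v \<alpha> i' l')) = (if i = i' \<and> l = l' then 1 else 0)"
    if *: "i \<in> Pow DA" "l \<in> ?LL" "i' \<in> Pow DA" "l' \<in> ?LL" for i l i' l'
  proof -
    obtain s s' where l: "l = [(s, {})]" "s \<subseteq> DB" "l' = [(s', {})]" "s' \<subseteq> DB" using * by auto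
    have "(\<Sum>\<alpha>\<in>?HA. ip (v \<alpha> i l) (v \<alpha> i' l'))
        = (\<Sum>T\<in>Pow D. \<Sum>S\<in>Pow R. if S = {} then if T = i \<union> s then if i \<union> s = i' \<union> s' then 1 else 0 else 0 else 0)"
      unfolding ip_def by (simp only: sum.insert sum.empty finite.emptyI empty_iff not_False_eq_True add_0_right)
        (intro sum.cong refl, auto simp: v_def l)
    also have "\<dots> = (\<Sum>T\<in>Pow D. if T = i \<union> s then if i \<union> s = i' \<union> s' then 1 else 0 else 0)"
      by simp
    also have "\<dots> = (if i \<union> s = i' \<union> s' then 1 else 0)"
      using * l by (subst sum.delta) auto
    finally show ?thesis using union[of i i' s s'] * l by auto
  qed
  moreover have "(\<Sum>\<beta>\<in>?HB. cnj (\<tau> \<beta> l j) * \<tau> \<beta> l' j') = (if l = l' \<and> j = j' then 1 else 0)"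
    if *: "l \<in> ?LL" "j \<in> Pow DB" "l' \<in> ?LL" "j' \<in> Pow DB" for l j l' j'
  proof -
    obtain s s' where l: "l = [(s, {})]" "s \<subseteq> DB" "l' = [(s', {})]" "s' \<subseteq> DB" using * by auto
    have "(\<Sum>\<beta>\<in>?HB. cnj (\<tau> \<beta> l j) * \<tau> \<beta> l' j') = (\<Sum>x\<in>Pow DB. \<Sum>z\<in>Pow DB. cnj (\<tau> [(x, z)] l j) * \<tau> [(x, z)] l' j')"
      by (subst sum.reindex) (auto simp: inj_on_def sum.cartesian_product case_prod_beta)
    also have "\<dots> = (\<Sum>x\<in>Pow DB. \<Sum>z\<in>Pow DB. if sd s x = j then if sd s' x = j' then
         \<kappa> * \<kappa> * (sg (z \<inter> s) * sg (z \<inter> s')) else 0 else 0)"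
      by (intro sum.cong refl) (simp add: \<tau>_def l pauli_def \<kappa>)
    also have "\<dots> = (\<Sum>x\<in>Pow DB. if sd s x = j then if sd s' x = j' then
         \<kappa> * \<kappa> * (\<Sum>z\<in>Pow DB. sg (z \<inter> s) * sg (z \<inter> s')) else 0 else 0)"
      by (intro sum.cong refl) (auto simp: sum_distrib_left)
    also have "\<dots> = (\<Sum>x\<in>Pow DB. if sd s x = j then if s = s' \<and> j = j' then 1 else 0 else 0)"
    proof -
      have "(\<Sum>z\<in>Pow DB. sg (z \<inter> s) * sg (z \<inter> s')) = (if s = s' then 2 ^ b else 0)"
        using sum_sg_orthogonal[of DB s s'] l by simp
      then show ?thesis by (intro sum.cong refl) (auto simp only: \<kappa> mult_zero_right sd_eq_iff split: if_splits)
    qed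
    also have "\<dots> = (if s = s' \<and> j = j' then 1 else 0)"
      using * by (subst sum_sd_reindex[OF l(2), of "\<lambda>y. if y = j then if s = s' \<and> j = j' then 1 else 0 else 0"]) auto
    finally show ?thesis using l by simp
  qed
  moreover have "(\<Sum>l\<in>?LL. \<tau> \<beta> l j * v \<alpha> i l T S) = \<kappa> * ?G \<alpha> \<beta> i j T S"
    if *: "i \<in> Pow DA" "j \<in> Pow DB" "T \<in> Pow D" "S \<in> Pow R" "\<beta> \<in> ?HB" for \<alpha> \<beta> i j T S
  proof -
    obtain x z where \<beta>: "\<beta> = [(x, z)]" "x \<subseteq> DB" "z \<subseteq> DB" using *(5) by auto
    have "(\<Sum>l\<in>?LL. \<tau> \<beta> l j * v \<alpha> i l T S) = (\<Sum>s\<in>Pow DB. \<tau> \<beta> [(s, {})] j * v \<alpha> i [(s, {})] T S)"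
      by (subst sum.reindex) (auto simp: inj_on_def)
    also have "\<dots> = (\<Sum>s\<in>Pow DB. if s = T \<inter> DB then if T \<inter> DA = i then \<tau> \<beta> [(s, {})] j * (if S = {} then 1 else 0) else 0 else 0)"
    proof (intro sum.cong refl)
      fix s assume "s \<in> Pow DB"
      moreover have "T = (T \<inter> DA) \<union> (T \<inter> DB)" using * by fastforce
      ultimately have "T = i \<union> s \<longleftrightarrow> T \<inter> DA = i \<and> s = T \<inter> DB"
        using union[of "T \<inter> DA" i "T \<inter> DB" s] * by auto
      then show "\<tau> \<beta> [(s, {})] j * v \<alpha> i [(s, {})] T S
          = (if s = T \<inter> DB then if T \<inter> DA = i then \<tau> \<beta> [(s, {})] j * (if S = {} then 1 else 0) else 0 else 0)"
        by (auto simp: v_def)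
    qed
    also have "\<dots> = (if T \<inter> DA = i then \<tau> \<beta> [(T \<inter> DB, {})] j * (if S = {} then 1 else 0) else 0)"
      by (subst sum.delta) auto
    also have "\<dots> = \<kappa> * ?G \<alpha> \<beta> i j T S"
    proof -
      have "sd T x = (T \<inter> DA) \<union> sd (T \<inter> DB) x" using * \<beta> by fastforce
      then have "sd T x = i \<union> j \<longleftrightarrow> T \<inter> DA = i \<and> sd (T \<inter> DB) x = j"
        using union[of "T \<inter> DA" i "sd (T \<inter> DB) x" j] * sd_subset[of "T \<inter> DB" DB x] \<beta>(2) by simp
      moreover have "z \<inter> (T \<inter> DB) = z \<inter> T" using \<beta> by auto
      ultimately show ?thesis by (simp add: \<tau>_def \<beta> pauli_def)
    qed
    finally show ?thesis .
  qed
  moreover have "card ?LL = 2 ^ b" by (subst card_image) (auto simp: inj_on_def card_Pow)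
  ultimately show ?thesis unfolding reach_def alice_complete_def bob_complete_def contracts_def
    by (intro conjI exI[of _ ?LL] exI[of _ v] exI[of _ \<tau>] ballI exI[of _ \<kappa>]) (auto simp only: finite_imageI finite_Pow_iff finite_cartesian_product finite_atLeastLessThan finite.intros)
qed

end

section \<open>Routing networks\<close>

lemma pauli_scale: "pauli x z (\<lambda>S. c * \<phi> S) = (\<lambda>S. c * pauli x z \<phi> S)"
  by (simp add: pauli_def mult.left_commute)

lemma pauli_pauli:
  assumes "finite x" "finite z" "finite z'"
  shows "pauli x z (pauli x' z' \<phi>) = (\<lambda>S. sg (z' \<inter> x) * pauli (sd x x') (sd z z') \<phi> S)"
  using assms by (simp add: pauli_def Int_sd sg_sd sd_assoc mult_ac)

lemma pm_scale: "pm p (\<lambda>S. c * \<phi> S) = (\<lambda>S. c * pm p \<phi> S)"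
  by (simp add: pm_def)

lemma pm_pm: "pm p (pm q \<phi>) = pm (p \<circ> q) \<phi>"
  by (simp add: pm_def vimage_comp)

lemma pm_pauli:
  assumes "bij p"
  shows "pm p (pauli x z \<phi>) = pauli (p ` x) (p ` z) (pm p \<phi>)"
proof -
  have inj: "inj p" using assms by (rule bij_is_inj)
  have "p ` (z \<inter> p -` S) = p ` z \<inter> S" for S by auto
  then have "sg (z \<inter> p -` S) = sg (p ` z \<inter> S)" for S
    unfolding sg_def using card_image[of p "z \<inter> p -` S"] inj by (metis inj_on_subset subset_UNIV)
  then show ?thesis using inj by (simp add: pm_def pauli_def vimage_sd inj_vimage_image_eq)
qed

text \<open>The inverse phase gate diag(1, -i) on qubit \<open>k\<close>, the correction that undoes
  a stray S.\<close>

definition sphase :: "nat \<Rightarrow> (nat set \<Rightarrow> complex) \<Rightarrow> nat set \<Rightarrow> complex" where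
  "sphase k \<phi> = (\<lambda>S. (if k \<in> S then - \<i> else 1) * \<phi> S)"

lemma sphase_scale: "sphase k (\<lambda>S. c * \<phi> S) = (\<lambda>S. c * sphase k \<phi> S)"
  by (simp add: sphase_def mult.left_commute)

lemma pm_sphase: "pm p (sphase k \<phi>) = sphase (p k) (pm p \<phi>)"
  by (simp add: pm_def sphase_def)

text \<open>The relation behind it is S^-1 X = i Z X S^-1: an X error met by the correction leaves
  an additional Z error.\<close>

lemma sphase_pauli:
  assumes "finite z"
  shows "sphase k (pauli x z \<phi>) = (\<lambda>S. (if k \<in> x then \<i> else 1) * pauli x (sd z (x \<inter> {k})) (sphase k \<phi>) S)"
proof
  fix S
  have "sg (sd z (x \<inter> {k}) \<inter> S) = sg (z \<inter> S) * sg (x \<inter> {k} \<inter> S)"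
    using assms by (simp add: Int_sd sg_sd)
  moreover have "x \<inter> {k} \<inter> S = (if k \<in> x \<and> k \<in> S then {k} else {})" by auto
  ultimately show "sphase k (pauli x z \<phi>) S
      = (if k \<in> x then \<i> else 1) * pauli x (sd z (x \<inter> {k})) (sphase k \<phi>) S"
    by (auto simp: sphase_def pauli_def sg_def)
qed

text \<open>A routing network: each step permutes the rails, controlled by the history of Alice
  (\<open>True\<close>) or of Bob (\<open>False\<close>).\<close>
type_synonym 'r net = "(bool \<times> (history \<Rightarrow> 'r \<Rightarrow> 'r)) list"

fun run :: "'r net \<Rightarrow> history \<Rightarrow> history \<Rightarrow> 'r \<Rightarrow> 'r" where
  "run [] \<alpha> \<beta> k = k"
| "run ((s, p) # net) \<alpha> \<beta> k = run net \<alpha> \<beta> (p (if s then \<alpha> else \<beta>) k)"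

definition inv_net :: "'r net \<Rightarrow> 'r net" where
  "inv_net net = rev (map (\<lambda>(s, p). (s, \<lambda>\<gamma>. Hilbert_Choice.inv (p \<gamma>))) net)"

lemma run_append: "run (net @ net') \<alpha> \<beta> k = run net' \<alpha> \<beta> (run net \<alpha> \<beta> k)"
  by (induction net arbitrary: k) auto

lemma run_inv_net:
  assumes "\<And>s p \<gamma>. (s, p) \<in> set net \<Longrightarrow> inj (p \<gamma>)"
  shows "run (inv_net net) \<alpha> \<beta> (run net \<alpha> \<beta> k) = k"
  using assms
proof (induction net arbitrary: k)
  case (Cons l net)
  obtain s p where l: "l = (s, p)" by force
  have "run (inv_net net) \<alpha> \<beta> (run net \<alpha> \<beta> k) = k" for k
    using Cons.prems by (intro Cons.IH) auto
  moreover have "inj (p \<gamma>)" for \<gamma> using Cons.prems l by auto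
  ultimately show ?case by (simp add: inv_net_def l run_append)
qed (simp add: inv_net_def)

text \<open>Only Bob's steps are counted: the rails rest with Alice, so her permutations need no
  teleportation.\<close>

definition rounds :: "'r net \<Rightarrow> nat" where
  "rounds net = length (filter (\<lambda>(s, p). \<not> s) net)"

lemma rounds_simps [simp]:
  "rounds [] = 0" "rounds ((True, p) # net) = rounds net" "rounds ((False, p) # net) = Suc (rounds net)"
  by (simp_all add: rounds_def)

lemma rounds_inv_net [simp]: "rounds (inv_net net) = rounds net"
  by (induction net) (auto simp: rounds_def inv_net_def)

lemma rounds_le_length: "rounds net \<le> length net"
  by (simp add: rounds_def)

lemma length_inv_net [simp]: "length (inv_net net) = length net"
  by (simp add: inv_net_def)

text \<open>\<open>h\<close> bounds the part of the history that the steps depend on, \<open>w\<close> is the number of rails.\<close>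
definition net_ok :: "nat \<Rightarrow> nat \<Rightarrow> nat net \<Rightarrow> bool" where
  "net_ok h w net \<longleftrightarrow> (\<forall>(s, p)\<in>set net. \<forall>\<gamma>. p \<gamma> permutes {..<w} \<and> p (take h \<gamma>) = p \<gamma>)"

lemma net_ok_simps [simp]:
  "net_ok h w []"
  "net_ok h w ((s, p) # net) \<longleftrightarrow> (\<forall>\<gamma>. p \<gamma> permutes {..<w} \<and> p (take h \<gamma>) = p \<gamma>) \<and> net_ok h w net"
  "net_ok h w (net @ net') \<longleftrightarrow> net_ok h w net \<and> net_ok h w net'"
  by (auto simp: net_ok_def)

lemma net_ok_inj: "net_ok h w net \<Longrightarrow> (s, p) \<in> set net \<Longrightarrow> inj (p \<gamma>)"
  unfolding net_ok_def using permutes_inj by fastforce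

lemma net_ok_inv: "net_ok h w net \<Longrightarrow> net_ok h w (inv_net net)"
  by (fastforce simp: net_ok_def inv_net_def permutes_inv)

lemma net_ok_mono:
  assumes "net_ok h w net" "h \<le> h'" "w \<le> w'"
  shows "net_ok h' w' net"
  unfolding net_ok_def
proof (intro ballI, clarify, intro conjI)
  fix s p \<gamma> assume *: "(s, p) \<in> set net"
  then have p: "\<And>\<gamma>. p \<gamma> permutes {..<w}" "\<And>\<gamma>. p (take h \<gamma>) = p \<gamma>"
    using assms(1) by (auto simp: net_ok_def)
  show "p \<gamma> permutes {..<w'}" using p(1)[of \<gamma>] by (rule permutes_subset) (use assms(3) in auto)
  have "take h (take h' \<gamma>) = take h \<gamma>" using assms(2) by (simp add: min_absorb1)
  then show "p (take h' \<gamma>) = p \<gamma>" by (metis p(2))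
qed

lemma run_bij: "net_ok h w net \<Longrightarrow> bij (run net \<alpha> \<beta>)"
proof (induction net)
  case (Cons l net)
  obtain s p where l: "l = (s, p)" by force
  have eq: "run (l # net) \<alpha> \<beta> = run net \<alpha> \<beta> \<circ> p (if s then \<alpha> else \<beta>)" by (auto simp: l)
  have "bij (p (if s then \<alpha> else \<beta>))" "net_ok h w net" using Cons.prems l permutes_bij by auto
  then show ?case unfolding eq by (intro bij_comp Cons.IH)
qed (simp add: bij_betw_def inj_on_def)

lemma run_permutes: "net_ok h w net \<Longrightarrow> run net \<alpha> \<beta> permutes {..<w}"
proof (induction net)
  case Nil
  have "run [] \<alpha> \<beta> = id" by auto
  show ?case unfolding \<open>run [] \<alpha> \<beta> = id\<close> by (rule permutes_id)
next
  case (Cons l net)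
  obtain s p where l: "l = (s, p)" by force
  have eq: "run (l # net) \<alpha> \<beta> = run net \<alpha> \<beta> \<circ> p (if s then \<alpha> else \<beta>)" by (auto simp: l)
  have "p (if s then \<alpha> else \<beta>) permutes {..<w}" "net_ok h w net" using Cons.prems l by auto
  then show ?case unfolding eq by (intro permutes_compose Cons.IH)
qed

text \<open>The controls are settled by the first \<open>h\<close> outcomes, so a network built at
  one stage stays valid when the histories grow.\<close>

lemma run_take:
  assumes "net_ok h w net"
  shows "run net (take h \<alpha>) (take h \<beta>) k = run net \<alpha> \<beta> k"
  using assms by (induction net arbitrary: k) (auto split: if_splits)

definition computes :: "nat net \<Rightarrow> history \<Rightarrow> history \<Rightarrow> bool \<Rightarrow> bool" where
  "computes net \<alpha> \<beta> f \<longleftrightarrow> (\<forall>q. run net \<alpha> \<beta> (of_bool q) = of_bool (q \<noteq> f))"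

lemma computes_append:
  "computes net \<alpha> \<beta> f \<Longrightarrow> computes net' \<alpha> \<beta> f' \<Longrightarrow> computes (net @ net') \<alpha> \<beta> (f \<noteq> f')"
  by (cases f; cases f') (simp_all add: computes_def run_append)

lemma computes_take: "net_ok h w net \<Longrightarrow> computes net (take h \<alpha>) (take h \<beta>) f \<Longrightarrow> computes net \<alpha> \<beta> f"
  by (simp add: computes_def run_take)

text \<open>The physical effect of a network: Bob's steps are round trips of all rails, with Pauli errors.\<close>
fun exec :: "nat net \<Rightarrow> nat \<Rightarrow> history \<Rightarrow> history \<Rightarrow> (nat set \<Rightarrow> complex) \<Rightarrow> nat set \<Rightarrow> complex" where
  "exec [] h \<alpha> \<beta> \<phi> = \<phi>"
| "exec ((True, p) # net) h \<alpha> \<beta> \<phi> = exec net h \<alpha> \<beta> (pm (p \<alpha>) \<phi>)"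
| "exec ((False, p) # net) h \<alpha> \<beta> \<phi> = exec net (Suc h) \<alpha> \<beta>
     (pauli (fst (\<beta> ! h)) (snd (\<beta> ! h)) (pm (p \<beta>) (pauli (fst (\<alpha> ! h)) (snd (\<alpha> ! h)) \<phi>)))"

text \<open>Tracking the error on the datum: a rail is split into eight, labelled by the rail, the
  accumulated X and Z errors of the datum, and a result bit.\<close>
type_synonym trail = "nat \<times> bool \<times> bool \<times> bool"

fun route_step :: "(nat \<Rightarrow> nat) \<Rightarrow> trail \<Rightarrow> trail" where
  "route_step p (k, x, z, r) = (p k, x, z, r)"
fun error_step :: "nat set \<times> nat set \<Rightarrow> trail \<Rightarrow> trail" where
  "error_step e (k, x, z, r) = (k, x \<noteq> (k \<in> fst e), z \<noteq> (k \<in> snd e), r)"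
text \<open>The Z error that \<open>sphase_pauli\<close> creates from an X error, present only on
  rail 1, where the correction is applied.\<close>

fun phase_step :: "trail \<Rightarrow> trail" where
  "phase_step (k, x, z, r) = (k, x, z \<noteq> (x \<and> k = 1), r)"
text \<open>\<open>u\<close> and \<open>v\<close> are the coefficients of a linear functional of the
  two error bits. Adding its value to the result bit keeps the step invertible.\<close>

fun result_step :: "bool \<Rightarrow> bool \<Rightarrow> trail \<Rightarrow> trail" where
  "result_step u v (k, x, z, r) = (k, x, z, r \<noteq> ((u \<and> x) \<noteq> (v \<and> z)))"

text \<open>A round trip becomes one step of Alice and one of Bob, because each of its two errors is
  known to one party only. This accounts for the factor 2 in \<open>length_track\<close>.\<close>

fun track :: "nat net \<Rightarrow> nat \<Rightarrow> trail net" where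
  "track [] h = []"
| "track ((True, p) # net) h = (True, \<lambda>\<gamma>. route_step (p \<gamma>)) # track net h"
| "track ((False, p) # net) h = (True, \<lambda>\<gamma>. error_step (\<gamma> ! h))
     # (False, \<lambda>\<gamma>. error_step (\<gamma> ! h) \<circ> route_step (p \<gamma>)) # track net (Suc h)"

lemma length_track: "length (track net h) \<le> 2 * length net"
  by (induction net h rule: track.induct) auto

text \<open>Paulis can be pushed through all later permutations to the end, where they merge into
  one. A datum that starts on rail \<open>k\<close> sees the part of this Pauli at its final rail,
  and the same part is what the tracking network accumulates along the way.\<close>

lemma exec_pauli:
  assumes "net_ok h0 W net"
    and "\<And>k. h \<le> k \<Longrightarrow> k < h + rounds net \<Longrightarrow>
      fst (\<alpha> ! k) \<subseteq> {..<W} \<and> snd (\<alpha> ! k) \<subseteq> {..<W} \<and> fst (\<beta> ! k) \<subseteq> {..<W} \<and> snd (\<beta> ! k) \<subseteq> {..<W}"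
  obtains c x z where "x \<subseteq> {..<W}" "z \<subseteq> {..<W}"
    "\<And>\<phi>. exec net h \<alpha> \<beta> \<phi> = (\<lambda>S. c * pauli x z (pm (run net \<alpha> \<beta>) \<phi>) S)"
    "\<And>k q r s. run (track net h) \<alpha> \<beta> (k, q, r, s)
       = (run net \<alpha> \<beta> k, q \<noteq> (run net \<alpha> \<beta> k \<in> x), r \<noteq> (run net \<alpha> \<beta> k \<in> z), s)"
proof -
  have "\<exists>c x z. x \<subseteq> {..<W} \<and> z \<subseteq> {..<W} \<and>
    (\<forall>\<phi>. exec net h \<alpha> \<beta> \<phi> = (\<lambda>S. c * pauli x z (pm (run net \<alpha> \<beta>) \<phi>) S)) \<and>
    (\<forall>k q r s. run (track net h) \<alpha> \<beta> (k, q, r, s)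
       = (run net \<alpha> \<beta> k, q \<noteq> (run net \<alpha> \<beta> k \<in> x), r \<noteq> (run net \<alpha> \<beta> k \<in> z), s))"
    using assms
  proof (induction net h rule: track.induct)
    case (1 h)
    show ?case by (rule exI[of _ 1], rule exI[of _ "{}"], rule exI[of _ "{}"]) (simp add: pauli_def pm_def)
  next
    case (2 p net h)
    obtain c x z where *: "x \<subseteq> {..<W}" "z \<subseteq> {..<W}"
      "\<And>\<phi>. exec net h \<alpha> \<beta> \<phi> = (\<lambda>S. c * pauli x z (pm (run net \<alpha> \<beta>) \<phi>) S)"
      "\<And>k q r s. run (track net h) \<alpha> \<beta> (k, q, r, s)
       = (run net \<alpha> \<beta> k, q \<noteq> (run net \<alpha> \<beta> k \<in> x), r \<noteq> (run net \<alpha> \<beta> k \<in> z), s)"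
      using 2 by auto
    have "run ((True, p) # net) \<alpha> \<beta> = run net \<alpha> \<beta> \<circ> p \<alpha>" by auto
    then show ?case using * by - (rule exI[of _ c], rule exI[of _ x], rule exI[of _ z], simp add: pm_pm comp_def)
  next
    case (3 p net h)
    have "\<exists>c x z. x \<subseteq> {..<W} \<and> z \<subseteq> {..<W} \<and>
      (\<forall>\<phi>. exec net (Suc h) \<alpha> \<beta> \<phi> = (\<lambda>S. c * pauli x z (pm (run net \<alpha> \<beta>) \<phi>) S)) \<and>
      (\<forall>k q r s. run (track net (Suc h)) \<alpha> \<beta> (k, q, r, s)
       = (run net \<alpha> \<beta> k, q \<noteq> (run net \<alpha> \<beta> k \<in> x), r \<noteq> (run net \<alpha> \<beta> k \<in> z), s))"
      using 3(2) by (intro 3(1) 3(3)) auto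
    then obtain c x z where *: "x \<subseteq> {..<W}" "z \<subseteq> {..<W}"
      "\<And>\<phi>. exec net (Suc h) \<alpha> \<beta> \<phi> = (\<lambda>S. c * pauli x z (pm (run net \<alpha> \<beta>) \<phi>) S)"
      "\<And>k q r s. run (track net (Suc h)) \<alpha> \<beta> (k, q, r, s)
       = (run net \<alpha> \<beta> k, q \<noteq> (run net \<alpha> \<beta> k \<in> x), r \<noteq> (run net \<alpha> \<beta> k \<in> z), s)"
      by blast
    obtain x1 z1 where a: "\<alpha> ! h = (x1, z1)" by force
    obtain x2 z2 where b: "\<beta> ! h = (x2, z2)" by force
    have e: "x1 \<subseteq> {..<W}" "z1 \<subseteq> {..<W}" "x2 \<subseteq> {..<W}" "z2 \<subseteq> {..<W}"
      using 3(3)[of h] a b by auto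
    let ?\<pi> = "run net \<alpha> \<beta>"
    have ok: "net_ok h0 W net" and p: "p \<beta> permutes {..<W}" using 3(2) by auto
    note bp = permutes_bij[OF p] and b\<pi> = run_bij[OF ok, of \<alpha> \<beta>]
    have im: "p \<beta> ` A \<subseteq> {..<W}" "?\<pi> ` A \<subseteq> {..<W}" if "A \<subseteq> {..<W}" for A
      using permutes_image[OF p] permutes_image[OF run_permutes[OF ok, of \<alpha> \<beta>]] that by blast+
    have fin: "finite A" if "A \<subseteq> {..<W}" for A using that finite_subset by blast
    let ?x = "sd x2 (p \<beta> ` x1)" and ?z = "sd z2 (p \<beta> ` z1)"
    have xz: "?x \<subseteq> {..<W}" "?z \<subseteq> {..<W}" by (intro sd_subset im e)+
    \<comment> \<open>Both signs come from reordering Z past X when Paulis are merged: first within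
      this round trip, then with the errors of the later steps.\<close>
    define c' where "c' = sg (p \<beta> ` z1 \<inter> x2) * (c * sg (?\<pi> ` ?z \<inter> x))"
    have r: "run ((False, p) # net) \<alpha> \<beta> = ?\<pi> \<circ> p \<beta>" by auto
    have "exec ((False, p) # net) h \<alpha> \<beta> \<phi>
        = (\<lambda>S. c' * pauli (sd x (?\<pi> ` ?x)) (sd z (?\<pi> ` ?z)) (pm (?\<pi> \<circ> p \<beta>) \<phi>) S)" for \<phi>
    proof -
      have "pauli x2 z2 (pm (p \<beta>) (pauli x1 z1 \<phi>)) = (\<lambda>S. sg (p \<beta> ` z1 \<inter> x2) * pauli ?x ?z (pm (p \<beta>) \<phi>) S)"
        using e im fin by (simp add: pm_pauli[OF bp] pauli_pauli)
      then have "exec ((False, p) # net) h \<alpha> \<beta> \<phi>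
          = (\<lambda>S. c * (sg (p \<beta> ` z1 \<inter> x2) * pauli x z (pauli (?\<pi> ` ?x) (?\<pi> ` ?z) (pm (?\<pi> \<circ> p \<beta>) \<phi>)) S))"
        by (simp add: a b *(3) pm_scale pauli_scale pm_pauli[OF b\<pi>] pm_pm)
      also have "pauli x z (pauli (?\<pi> ` ?x) (?\<pi> ` ?z) (pm (?\<pi> \<circ> p \<beta>) \<phi>))
          = (\<lambda>S. sg (?\<pi> ` ?z \<inter> x) * pauli (sd x (?\<pi> ` ?x)) (sd z (?\<pi> ` ?z)) (pm (?\<pi> \<circ> p \<beta>) \<phi>) S)"
        using * xz im fin by (intro pauli_pauli) auto
      finally show ?thesis by (simp add: c'_def mult_ac)
    qed
    \<comment> \<open>Errors are carried along by the permutations, so by injectivity an error met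
      now is visible as membership of the final rail in an image.\<close>
    moreover have "run (track ((False, p) # net) h) \<alpha> \<beta> (k, q, r, s)
       = (?\<pi> (p \<beta> k), q \<noteq> (?\<pi> (p \<beta> k) \<in> sd x (?\<pi> ` ?x)), r \<noteq> (?\<pi> (p \<beta> k) \<in> sd z (?\<pi> ` ?z)), s)" for k q r s
      using inj_image_mem_iff[OF bij_is_inj[OF bp]] inj_image_mem_iff[OF bij_is_inj[OF b\<pi>]]
      by (simp add: a b *(4)) blast
    moreover have "sd x (?\<pi> ` ?x) \<subseteq> {..<W}" "sd z (?\<pi> ` ?z) \<subseteq> {..<W}"
      by (intro sd_subset im * xz)+
    ultimately show ?case unfolding r
      by - (rule exI[of _ c'], rule exI[of _ "sd x (?\<pi> ` ?x)"], rule exI[of _ "sd z (?\<pi> ` ?z)"], simp add: comp_def)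
  qed
  then show ?thesis using that by blast
qed

text \<open>The inverse network reuses the controls of \<open>net\<close> but suffers fresh errors,
  read from position \<open>h + rounds net\<close> of the histories.\<close>

definition gadget :: "nat net \<Rightarrow> nat \<Rightarrow> history \<Rightarrow> history \<Rightarrow> (nat set \<Rightarrow> complex) \<Rightarrow> nat set \<Rightarrow> complex" where
  "gadget net h \<alpha> \<beta> \<phi> = exec (inv_net net) (h + rounds net) \<alpha> \<beta> (sphase 1 (exec net h \<alpha> \<beta> \<phi>))"

definition track_gadget :: "nat net \<Rightarrow> nat \<Rightarrow> trail net" where
  "track_gadget net h = track net h @ [(True, \<lambda>_. phase_step)] @ track (inv_net net) (h + rounds net)"

text \<open>The two networks cancel as permutations, which moves the correction from rail 1 back to
  the rail \<open>t\<close> that \<open>net\<close> sends there. The remaining errors form one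
  Pauli, and the tracked bits are its components at rail 0, where the datum ends.\<close>

lemma gadget_pauli:
  assumes ok: "net_ok h0 W net"
    and hist: "\<And>k. h \<le> k \<Longrightarrow> k < h + 2 * rounds net \<Longrightarrow>
      fst (\<alpha> ! k) \<subseteq> {..<W} \<and> snd (\<alpha> ! k) \<subseteq> {..<W} \<and> fst (\<beta> ! k) \<subseteq> {..<W} \<and> snd (\<beta> ! k) \<subseteq> {..<W}"
  obtains c x z t where "x \<subseteq> {..<W}" "z \<subseteq> {..<W}" "run net \<alpha> \<beta> t = 1"
    "\<And>\<phi>. gadget net h \<alpha> \<beta> \<phi> = (\<lambda>S. c * pauli x z (sphase t \<phi>) S)"
    "\<And>s. run (track_gadget net h) \<alpha> \<beta> (0, False, False, s) = (0, 0 \<in> x, 0 \<in> z, s)"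
proof -
  let ?\<pi> = "run net \<alpha> \<beta>" and ?\<pi>' = "run (inv_net net) \<alpha> \<beta>"
  note ok' = net_ok_inv[OF ok]
  obtain c1 x1 z1 where 1: "x1 \<subseteq> {..<W}" "z1 \<subseteq> {..<W}"
    "\<And>\<phi>. exec net h \<alpha> \<beta> \<phi> = (\<lambda>S. c1 * pauli x1 z1 (pm ?\<pi> \<phi>) S)"
    "\<And>k q r s. run (track net h) \<alpha> \<beta> (k, q, r, s) = (?\<pi> k, q \<noteq> (?\<pi> k \<in> x1), r \<noteq> (?\<pi> k \<in> z1), s)"
    by (rule exec_pauli[OF ok, of h \<alpha> \<beta>]) (use hist in auto)
  obtain c2 x2 z2 where 2: "x2 \<subseteq> {..<W}" "z2 \<subseteq> {..<W}"
    "\<And>\<phi>. exec (inv_net net) (h + rounds net) \<alpha> \<beta> \<phi> = (\<lambda>S. c2 * pauli x2 z2 (pm ?\<pi>' \<phi>) S)"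
    "\<And>k q r s. run (track (inv_net net) (h + rounds net)) \<alpha> \<beta> (k, q, r, s)
      = (?\<pi>' k, q \<noteq> (?\<pi>' k \<in> x2), r \<noteq> (?\<pi>' k \<in> z2), s)"
    by (rule exec_pauli[OF ok', of "h + rounds net" \<alpha> \<beta>]) (use hist in auto)
  have inv: "?\<pi>' (?\<pi> k) = k" for k using run_inv_net net_ok_inj[OF ok] by metis
  note b\<pi> = run_bij[OF ok, of \<alpha> \<beta>] and b\<pi>' = run_bij[OF ok', of \<alpha> \<beta>]
  have im: "?\<pi>' ` A \<subseteq> {..<W}" if "A \<subseteq> {..<W}" for A
    using permutes_image[OF run_permutes[OF ok', of \<alpha> \<beta>]] that by blast
  have fin: "finite A" if "A \<subseteq> {..<W}" for A using that finite_subset by blast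
  define z1' where "z1' = sd z1 (x1 \<inter> {1})"
  have z1': "z1' \<subseteq> {..<W}" unfolding z1'_def using 1 by (intro sd_subset) auto
  define c where "c = c1 * c2 * (if 1 \<in> x1 then \<i> else 1) * sg (?\<pi>' ` z1' \<inter> x2)"
  define x where "x = sd x2 (?\<pi>' ` x1)"
  define z where "z = sd z2 (?\<pi>' ` z1')"
  show ?thesis
  proof (rule that)
    show "x \<subseteq> {..<W}" "z \<subseteq> {..<W}" unfolding x_def z_def by (intro sd_subset im 1 2 z1')+
    show "?\<pi> (?\<pi>' 1) = 1" using inv b\<pi> by (metis bij_pointE)
    have "?\<pi>' \<circ> ?\<pi> = id" using inv by auto
    then have id: "pm ?\<pi>' (pm ?\<pi> \<phi>) = \<phi>" for \<phi> by (simp add: pm_pm comp_def) (simp add: pm_def)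
    show "gadget net h \<alpha> \<beta> \<phi> = (\<lambda>S. c * pauli x z (sphase (?\<pi>' 1) \<phi>) S)" for \<phi>
    proof -
      have "gadget net h \<alpha> \<beta> \<phi>
        = (\<lambda>S. c2 * (c1 * ((if 1 \<in> x1 then \<i> else 1) * pauli x2 z2 (pauli (?\<pi>' ` x1) (?\<pi>' ` z1') (sphase (?\<pi>' 1) \<phi>)) S)))"
        unfolding gadget_def 1 2 sphase_scale sphase_pauli[OF fin[OF 1(2)]] pm_scale pauli_scale
          z1'_def[symmetric] pm_pauli[OF b\<pi>'] pm_sphase id ..
      also have "pauli x2 z2 (pauli (?\<pi>' ` x1) (?\<pi>' ` z1') (sphase (?\<pi>' 1) \<phi>))
          = (\<lambda>S. sg (?\<pi>' ` z1' \<inter> x2) * pauli x z (sphase (?\<pi>' 1) \<phi>) S)"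
        unfolding x_def z_def using 2 fin im[OF z1'] by (intro pauli_pauli) auto
      finally show ?thesis by (simp add: c_def mult_ac)
    qed
    show "run (track_gadget net h) \<alpha> \<beta> (0, False, False, s) = (0, 0 \<in> x, 0 \<in> z, s)" for s
    proof -
      have mem: "0 \<in> ?\<pi>' ` A \<longleftrightarrow> ?\<pi> 0 \<in> A" for A
        using inv[of 0] inj_image_mem_iff[OF bij_is_inj[OF b\<pi>'], of "?\<pi> 0" A] by simp
      show ?thesis
        unfolding track_gadget_def run_append
        by (simp add: 1(4) 2(4) inv x_def z_def z1'_def mem) blast
    qed
  qed
qed

text \<open>Trails range over an infinite type, so the steps are bijections of all trails.
  Preservation of \<open>fst t < w\<close> in both directions makes their restriction to
  \<open>w\<close> rails a permutation as well.\<close>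

definition trail_net_ok :: "nat \<Rightarrow> nat \<Rightarrow> trail net \<Rightarrow> bool" where
  "trail_net_ok h w net \<longleftrightarrow> (\<forall>(s, p)\<in>set net. \<forall>\<gamma>. bij (p \<gamma>) \<and> (\<forall>t. fst (p \<gamma> t) < w \<longleftrightarrow> fst t < w) \<and> p (take h \<gamma>) = p \<gamma>)"

lemma trail_net_ok_append [simp]:
  "trail_net_ok h w (net @ net') \<longleftrightarrow> trail_net_ok h w net \<and> trail_net_ok h w net'"
  by (simp only: trail_net_ok_def set_append ball_Un)

lemma involution_bij: "(\<And>x. f (f x) = x) \<Longrightarrow> bij f"
  by (metis bijI' )

lemma bij_steps:
  "bij p \<Longrightarrow> bij (route_step p)" "bij (error_step e)" "bij phase_step" "bij (result_step u v)"
proof -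
  show "bij (route_step p)" if "bij p"
  proof (rule bij_betw_byWitness[where f' = "route_step (Hilbert_Choice.inv p)"])
    show "\<forall>t\<in>UNIV. route_step (Hilbert_Choice.inv p) (route_step p t) = t" "\<forall>t\<in>UNIV. route_step p (route_step (Hilbert_Choice.inv p) t) = t"
      using that by (auto simp: bij_is_inj bij_is_surj surj_f_inv_f)
  qed auto
  show "bij (error_step e)" by (rule involution_bij) auto
  show "bij phase_step" by (rule involution_bij) auto
  show "bij (result_step u v)" by (rule involution_bij) auto
qed

lemma fst_steps:
  "fst (route_step p t) = p (fst t)" "fst (error_step e t) = fst t" "fst (phase_step t) = fst t"
  "fst (result_step u v t) = fst t"
  by (cases t; simp)+

lemma trail_net_ok_track:
  "net_ok h0 w net \<Longrightarrow> h0 \<le> h' \<Longrightarrow> h + rounds net \<le> h' \<Longrightarrow> trail_net_ok h' w (track net h)"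
proof (induction net h rule: track.induct)
  case (2 p net h)
  \<comment> \<open>The step is wrapped into a network of length one so that
    \<open>net_ok_mono\<close> can extend the bound on the history that it reads.\<close>
  then have "net_ok h' w [(True, p)]" by (intro net_ok_mono[of h0 w _ h' w]) auto
  then have p: "\<And>\<gamma>. p \<gamma> permutes {..<w}" "\<And>\<gamma>. p (take h' \<gamma>) = p \<gamma>" by auto
  have "p \<gamma> k < w \<longleftrightarrow> k < w" for \<gamma> k using permutes_in_image[OF p(1)[of \<gamma>]] by auto
  moreover have "bij (p \<gamma>)" for \<gamma> using p(1) by (rule permutes_bij)
  ultimately show ?case using 2 p by (auto simp: trail_net_ok_def fst_steps bij_steps)
next
  case (3 p net h)
  then have "net_ok h' w [(True, p)]" by (intro net_ok_mono[of h0 w _ h' w]) auto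
  then have p: "\<And>\<gamma>. p \<gamma> permutes {..<w}" "\<And>\<gamma>. p (take h' \<gamma>) = p \<gamma>" by auto
  have "p \<gamma> k < w \<longleftrightarrow> k < w" for \<gamma> k using permutes_in_image[OF p(1)[of \<gamma>]] by auto
  moreover have "bij (p \<gamma>)" for \<gamma> using p(1) by (rule permutes_bij)
  ultimately show ?case using 3 p
    by (auto simp: trail_net_ok_def fst_steps bij_steps intro!: bij_comp)
qed (simp add: trail_net_ok_def)

lemma trail_net_ok_inv: "trail_net_ok h w net \<Longrightarrow> trail_net_ok h w (inv_net net)"
  unfolding trail_net_ok_def
proof (intro ballI, clarify, intro conjI allI)
  fix s p \<gamma> t assume ok: "\<forall>(s, p)\<in>set net. \<forall>\<gamma>. bij (p \<gamma>) \<and> (\<forall>t. fst (p \<gamma> t) < w \<longleftrightarrow> fst t < w) \<and> p (take h \<gamma>) = p \<gamma>"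
    and "(s, p) \<in> set (inv_net net)"
  then obtain q where q: "(s, q) \<in> set net" "p = (\<lambda>\<gamma>. Hilbert_Choice.inv (q \<gamma>))"
    by (auto simp: inv_net_def)
  have b: "bij (q \<gamma>)" and f: "\<And>t. fst (q \<gamma> t) < w \<longleftrightarrow> fst t < w" and t: "q (take h \<gamma>) = q \<gamma>"
    using bspec[OF ok q(1)] by (simp_all del: split_paired_All)
  show "bij (p \<gamma>)" using b by (simp add: q bij_imp_bij_inv)
  show "p (take h \<gamma>) = p \<gamma>" using t by (simp add: q)
  have "q \<gamma> (p \<gamma> t) = t" using b by (simp add: q bij_is_surj surj_f_inv_f)
  then show "fst (p \<gamma> t) < w \<longleftrightarrow> fst t < w" using f[of "p \<gamma> t"] by simp
qed

text \<open>The result bit is the lowest bit: on rail 0 with clean error bits the code is the result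
  bit itself, which matches the convention of \<open>computes\<close>.\<close>

fun encode :: "trail \<Rightarrow> nat" where
  "encode (k, x, z, r) = 8 * k + 4 * of_bool x + 2 * of_bool z + of_bool r"

definition decode :: "nat \<Rightarrow> trail" where
  "decode m = (m div 8, odd (m div 4), odd (m div 2), odd m)"

lemma decode_encode [simp]: "decode (encode t) = t"
proof -
  obtain k x z r where t: "t = (k, x, z, r)" by (cases t)
  show ?thesis unfolding t by (cases x; cases z; cases r; simp add: decode_def; presburger)
qed

lemma encode_decode [simp]: "encode (decode m) = m"
proof -
  have "encode (decode m) = 8 * (m div 8) + 4 * ((m div 4) mod 2) + 2 * ((m div 2) mod 2) + m mod 2"
    by (simp add: decode_def mod2_eq_if)
  moreover have "m = 2 * (m div 2) + m mod 2" "m div 2 = 2 * (m div 4) + (m div 2) mod 2"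
    "m div 4 = 2 * (m div 8) + (m div 4) mod 2"
    using div_mult2_eq[of m 2 2] div_mult2_eq[of m 4 2] by (simp_all add: mult.commute)
  ultimately show ?thesis by linarith
qed

lemma encode_less: "encode t < 8 * w \<longleftrightarrow> fst t < w"
  by (cases t) auto

text \<open>Fixing all numbers from \<open>8 * w\<close> on is what \<open>permutes\<close> demands
  outside the set.\<close>

definition flatten_step :: "nat \<Rightarrow> (trail \<Rightarrow> trail) \<Rightarrow> nat \<Rightarrow> nat" where
  "flatten_step w g m = (if m < 8 * w then encode (g (decode m)) else m)"

lemma flatten_step_permutes:
  assumes "bij g" "\<And>t. fst (g t) < w \<longleftrightarrow> fst t < w"
  shows "flatten_step w g permutes {..<8 * w}"
proof (rule bij_imp_permutes)
  have g: "g (Hilbert_Choice.inv g t) = t" "Hilbert_Choice.inv g (g t) = t" for t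
    using assms(1) by (simp_all add: bij_is_inj bij_is_surj surj_f_inv_f)
  have 1: "encode (g (decode m)) < 8 * w \<longleftrightarrow> m < 8 * w" for m
    by (metis assms(2) encode_decode encode_less)
  have 2: "encode (Hilbert_Choice.inv g (decode m)) < 8 * w \<longleftrightarrow> m < 8 * w" for m
    by (metis 1 decode_encode encode_decode g(1))
  show "bij_betw (flatten_step w g) {..<8 * w} {..<8 * w}"
    by (rule bij_betw_byWitness[where f' = "\<lambda>m. encode (Hilbert_Choice.inv g (decode m))"])
       (auto simp: flatten_step_def 1 2 g)
qed (simp add: flatten_step_def)

definition flatten :: "nat \<Rightarrow> trail net \<Rightarrow> nat net" where
  "flatten w net = map (\<lambda>(s, p). (s, \<lambda>\<gamma>. flatten_step w (p \<gamma>))) net"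

lemma flatten_ok: "trail_net_ok h w net \<Longrightarrow> net_ok h (8 * w) (flatten w net)"
  unfolding trail_net_ok_def net_ok_def flatten_def by (auto intro!: flatten_step_permutes)

lemma run_flatten:
  assumes "trail_net_ok h w net" "fst t < w"
  shows "run (flatten w net) \<alpha> \<beta> (encode t) = encode (run net \<alpha> \<beta> t)"
  using assms
proof (induction net arbitrary: t)
  case (Cons l net)
  obtain s p where l: "l = (s, p)" by force
  have "fst (p (if s then \<alpha> else \<beta>) t) < w" "trail_net_ok h w net"
    using Cons.prems by (auto simp: trail_net_ok_def l simp del: split_paired_All)
  moreover have "encode t < 8 * w" using Cons.prems by (simp add: encode_less)
  ultimately show ?case using Cons.IH by (simp add: flatten_def l flatten_step_def)
qed (simp add: flatten_def)

text \<open>Compute-copy-uncompute with the error-tracking network turns the errors of the gadget on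
  the datum into bits computed by a new network.\<close>
definition error_net :: "nat \<Rightarrow> nat net \<Rightarrow> nat \<Rightarrow> bool \<Rightarrow> bool \<Rightarrow> nat net" where
  "error_net w net h u v = flatten w (track_gadget net h @ [(True, \<lambda>_. result_step u v)]
     @ inv_net (track_gadget net h))"

text \<open>For a network of length L the tracked gadget has at most 4 L + 1 steps. It occurs twice,
  once inverted, around one copying step.\<close>

lemma length_error_net: "length (error_net w net h u v) \<le> 8 * length net + 3"
  using length_track[of net h] length_track[of "inv_net net" "h + rounds net"]
  by (simp add: error_net_def flatten_def track_gadget_def)

lemma trail_net_ok_gadget:
  assumes "net_ok h0 w net" "h0 \<le> h"
  shows "trail_net_ok (h + 2 * rounds net) w (track_gadget net h)"
proof -
  have "trail_net_ok (h + 2 * rounds net) w [(True, \<lambda>_. phase_step)]"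
    by (simp add: trail_net_ok_def bij_steps fst_steps)
  moreover have "trail_net_ok (h + 2 * rounds net) w (track net h)"
    using assms by (intro trail_net_ok_track[of h0]) auto
  moreover have "trail_net_ok (h + 2 * rounds net) w (track (inv_net net) (h + rounds net))"
    using assms by (intro trail_net_ok_track[of h0] net_ok_inv) auto
  ultimately show ?thesis unfolding track_gadget_def by (simp only: trail_net_ok_append simp_thms)
qed

lemma error_net_ok:
  assumes "net_ok h0 w net" "h0 \<le> h"
  shows "net_ok (h + 2 * rounds net) (8 * w) (error_net w net h u v)"
proof -
  have "trail_net_ok (h + 2 * rounds net) w [(True, \<lambda>_. result_step u v)]"
    by (simp add: trail_net_ok_def bij_steps fst_steps)
  then show ?thesis
    unfolding error_net_def using trail_net_ok_gadget[OF assms] trail_net_ok_inv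
    by (intro flatten_ok) (simp only: trail_net_ok_append simp_thms)
qed

text \<open>Assumption \<open>tr\<close> holds for every result bit, so the inverse pass still
  undoes the tracking after the functional has been added. It restores rail 0 and clean error bits,
  leaving only the changed result bit.\<close>

lemma error_net_computes:
  assumes ok: "net_ok h0 w net" "h0 \<le> h" and "w > 0"
    and tr: "\<And>s. run (track_gadget net h) \<alpha> \<beta> (0, False, False, s) = (0, ex, ez, s)"
  shows "computes (error_net w net h u v) \<alpha> \<beta> ((u \<and> ex) \<noteq> (v \<and> ez))"
  unfolding computes_def
proof
  fix q
  note g = trail_net_ok_gadget[OF ok]
  have "inj (p \<gamma>)" if "(s, p) \<in> set (track_gadget net h)" for s p \<gamma>
    using g that by (auto simp: trail_net_ok_def bij_is_inj)
  then have "run (inv_net (track_gadget net h)) \<alpha> \<beta> (run (track_gadget net h) \<alpha> \<beta> (0, False, False, s)) = (0, False, False, s)" for s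
    by (rule run_inv_net)
  then have inv: "run (inv_net (track_gadget net h)) \<alpha> \<beta> (0, ex, ez, s) = (0, False, False, s)" for s
    by (simp add: tr)
  have "trail_net_ok (h + 2 * rounds net) w [(True, \<lambda>_. result_step u v)]"
    by (simp add: trail_net_ok_def bij_steps fst_steps)
  then have ok': "trail_net_ok (h + 2 * rounds net) w (track_gadget net h @ [(True, \<lambda>_. result_step u v)]
     @ inv_net (track_gadget net h))"
    using g trail_net_ok_inv by (simp only: trail_net_ok_append simp_thms)
  have "run (error_net w net h u v) \<alpha> \<beta> (of_bool q) = run (error_net w net h u v) \<alpha> \<beta> (encode (0, False, False, q))"
    by simp
  also have "\<dots> = encode (0, False, False, q \<noteq> ((u \<and> ex) \<noteq> (v \<and> ez)))"
    unfolding error_net_def using \<open>w > 0\<close>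
    by (subst run_flatten[OF ok']) (simp_all add: run_append tr inv)
  finally show "run (error_net w net h u v) \<alpha> \<beta> (of_bool q) = of_bool (q \<noteq> ((u \<and> ex) \<noteq> (v \<and> ez)))" by simp
qed

section \<open>T layers and Clifford layers on encrypted data\<close>

lemma choice2:
  assumes "\<forall>\<alpha>\<in>A. \<forall>\<beta>\<in>B. \<exists>x y z. P \<alpha> \<beta> x y z"
  shows "\<exists>f g h. \<forall>\<alpha>\<in>A. \<forall>\<beta>\<in>B. P \<alpha> \<beta> (f \<alpha> \<beta>) (g \<alpha> \<beta>) (h \<alpha> \<beta>)"
  using assms by metis

lemma exec_take:
  assumes "net_ok h0 w net" "h0 \<le> k" "h + rounds net \<le> k"
  shows "exec net h (take k \<alpha>) (take k \<beta>) \<phi> = exec net h \<alpha> \<beta> \<phi>"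
  using assms
proof (induction net h arbitrary: \<phi> rule: track.induct)
  case (2 p net h)
  then have "net_ok k w [(True, p)]" by (intro net_ok_mono[of h0 w _ k w]) auto
  then show ?case using 2 by simp
next
  case (3 p net h)
  then have "net_ok k w [(True, p)]" by (intro net_ok_mono[of h0 w _ k w]) auto
  then show ?case using 3 by simp
qed simp

definition update :: "nat set \<Rightarrow> nat \<Rightarrow> bool \<Rightarrow> nat set" where
  "update A k q = (if q then insert k A else A - {k})"

lemma in_update [simp]: "l \<in> update A k q \<longleftrightarrow> (if l = k then q else l \<in> A)"
  by (auto simp: update_def)

text \<open>Exchanges data qubit \<open>j\<close> with rail 0; applied before and after a
  gadget.\<close>

definition swap_wire :: "nat \<Rightarrow> state \<Rightarrow> state" where
  "swap_wire j \<psi> = (\<lambda>T S. \<psi> (update T j (0 \<in> S)) (update S 0 (j \<in> T)))"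

definition tphase :: complex where
  "tphase = cis (pi / 4)"

lemma tphase_square: "tphase * tphase = \<i>"
proof -
  have "tphase * tphase = cis (pi / 4 + pi / 4)" by (simp add: tphase_def cis_mult)
  also have "pi / 4 + pi / 4 = pi / 2" by simp
  finally show ?thesis by simp
qed

lemma tphase_norm: "cnj tphase * tphase = 1"
  by (simp add: tphase_def cis_cnj cis_mult)

definition tgates :: "nat set \<Rightarrow> (nat set \<Rightarrow> complex) \<Rightarrow> nat set \<Rightarrow> complex" where
  "tgates J \<phi> = (\<lambda>T. tphase ^ card (J \<inter> T) * \<phi> T)"

lemma tgates_insert:
  assumes "finite J" "j \<notin> J"
  shows "tgates (insert j J) \<phi> = tgates {j} (tgates J \<phi>)"
proof
  fix T
  have "card (insert j J \<inter> T) = card ({j} \<inter> T) + card (J \<inter> T)"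
    using assms by (cases "j \<in> T") (auto simp: Int_insert_left)
  then show "tgates (insert j J) \<phi> T = tgates {j} (tgates J \<phi>) T"
    by (simp add: tgates_def power_add)
qed

text \<open>S^-1 T X equals X T up to a phase, whereas Z commutes with T. Hence the need for a
  correction depends on the X-key bit of the wire alone.\<close>

lemma tgates_pauli:
  "j \<notin> x \<Longrightarrow> tgates {j} (pauli x z \<phi>) = pauli x z (tgates {j} \<phi>)"
  "j \<in> x \<Longrightarrow> sphase j (tgates {j} (pauli x z \<phi>)) = (\<lambda>T. cnj tphase * pauli x z (tgates {j} \<phi>) T)"
proof -
  have *: "tgates {j} \<phi> = (\<lambda>T. (if j \<in> T then tphase else 1) * \<phi> T)" for \<phi>
    by (auto simp: tgates_def)
  show "tgates {j} (pauli x z \<phi>) = pauli x z (tgates {j} \<phi>)" if "j \<notin> x"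
    using that by (auto simp: * pauli_def)
  have "- \<i> * tphase = cnj tphase"
  proof -
    have "- \<i> * tphase = (cnj tphase * tphase) * (- \<i> * tphase)" by (simp only: tphase_norm mult_1)
    also have "\<dots> = cnj tphase * (- \<i> * (tphase * tphase))" by (simp only: mult_ac)
    finally show ?thesis by (simp add: tphase_square)
  qed
  then have e1: "- \<i> * (tphase * c) = cnj tphase * c" for c by (simp only: flip: mult.assoc)
  have e2: "cnj tphase * (tphase * c) = c" for c by (simp only: tphase_norm mult_1 flip: mult.assoc)
  show "sphase j (tgates {j} (pauli x z \<phi>)) = (\<lambda>T. cnj tphase * pauli x z (tgates {j} \<phi>) T)" if "j \<in> x"
  proof
    fix T
    show "sphase j (tgates {j} (pauli x z \<phi>)) T = cnj tphase * pauli x z (tgates {j} \<phi>) T"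
      unfolding * pauli_def sphase_def mult.left_commute[of _ "sg (z \<inter> T)"]
      using that by (cases "j \<in> T") (simp_all only: in_sd simp_thms if_True if_False mult_1 e1 e2)
  qed
qed

text \<open>The part of the error at rail 0 becomes an error on wire \<open>j\<close>, and
  everything else stays on the rails. Their new state \<open>J'\<close> does not depend on the data,
  so the product form persists.\<close>

lemma swap_wire_gadget:
  assumes g: "\<And>\<phi>. g \<phi> = (\<lambda>S. c * pauli x z (sphase t \<phi>) S)" and fin: "finite z"
  obtains J' where "\<And>\<phi> T S. swap_wire j (\<lambda>T. g (swap_wire j (\<lambda>T S. \<phi> T * J S) T)) T S
    = c * pauli (if 0 \<in> x then {j} else {}) (if 0 \<in> z then {j} else {}) (if t = 0 then sphase j \<phi> else \<phi>) T * J' S"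
proof
  define J' where "J' = pauli (x - {0}) (z - {0}) (if t = 0 then J else sphase t J)"
  fix \<phi> T S
  let ?X = "if 0 \<in> x then {j} else {}" and ?Z = "if 0 \<in> z then {j} else {}"
  let ?T = "update T j (0 \<in> S)" and ?S = "update S 0 (j \<in> T)"
  have 1: "update ?T j (0 \<in> sd ?S x) = sd T ?X" by (auto split: if_splits)
  have 2: "update (sd ?S x) 0 (j \<in> ?T) = sd S (x - {0})" by (auto split: if_splits)
  have "z \<inter> ?S = (if 0 \<in> z \<and> j \<in> T then insert 0 ((z - {0}) \<inter> S) else (z - {0}) \<inter> S)"
    by (auto split: if_splits)
  then have 3: "sg (z \<inter> ?S) = sg (?Z \<inter> T) * sg ((z - {0}) \<inter> S)"
    using fin by (auto simp: sg_def)
  have 4: "t \<in> sd ?S x \<longleftrightarrow> (if t = 0 then j \<in> sd T ?X else t \<in> sd S (x - {0}))" by auto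
  have "swap_wire j (\<lambda>T. g (swap_wire j (\<lambda>T S. \<phi> T * J S) T)) T S
      = c * (sg (z \<inter> ?S) * ((if t \<in> sd ?S x then - \<i> else 1) *
         (\<phi> (update ?T j (0 \<in> sd ?S x)) * J (update (sd ?S x) 0 (j \<in> ?T)))))"
    unfolding g by (simp only: swap_wire_def pauli_def sphase_def)
  also have "\<dots> = c * pauli ?X ?Z (if t = 0 then sphase j \<phi> else \<phi>) T * J' S"
    unfolding 1 2 3 4 J'_def pauli_def sphase_def by (cases "t = 0") (simp_all only: if_True if_False simp_thms mult_ac)
  finally show "swap_wire j (\<lambda>T. g (swap_wire j (\<lambda>T S. \<phi> T * J S) T)) T S
    = c * pauli ?X ?Z (if t = 0 then sphase j \<phi> else \<phi>) T * J' S" .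
qed

text \<open>A linear functional of the key: the inner product of \<open>(u, v)\<close> with
  \<open>(x, z)\<close> over the two-element field.\<close>

definition keybit :: "nat set \<Rightarrow> nat set \<Rightarrow> nat set \<Rightarrow> nat set \<Rightarrow> bool" where
  "keybit u v x z \<longleftrightarrow> odd (card (u \<inter> x)) \<noteq> odd (card (v \<inter> z))"

lemma keybit_sd:
  assumes "finite u" "finite v"
  shows "keybit u v (sd x x') (sd z z') \<longleftrightarrow> keybit u v x z \<noteq> keybit u v x' z'"
  using assms by (auto simp: keybit_def Int_sd odd_card_sd)

lemma keybit_single: "keybit u v (if p then {j} else {}) (if q then {j} else {}) \<longleftrightarrow> (j \<in> u \<and> p) \<noteq> (j \<in> v \<and> q)"
  by (cases "j \<in> u"; cases "j \<in> v"; simp add: keybit_def)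

lemma keybit_simps:
  "keybit {j} {} x z \<longleftrightarrow> j \<in> x" "keybit u v {j} {} \<longleftrightarrow> j \<in> u" "keybit u v {} {j} \<longleftrightarrow> j \<in> v"
proof -
  show "keybit {j} {} x z \<longleftrightarrow> j \<in> x" by (cases "j \<in> x") (simp_all add: keybit_def)
  show "keybit u v {j} {} \<longleftrightarrow> j \<in> u" by (cases "j \<in> u") (simp_all add: keybit_def)
  show "keybit u v {} {j} \<longleftrightarrow> j \<in> v" by (cases "j \<in> v") (simp_all add: keybit_def)
qed

context protocol
begin

section \<open>The cost of gadgets in EPR pairs\<close>

lemma funpow_ext:
  assumes "\<And>\<gamma>. \<gamma> \<in> H \<Longrightarrow> length \<gamma> = h" "\<gamma> \<in> (ext ^^ n) H"
  shows "length \<gamma> = h + n \<and> take h \<gamma> \<in> H \<and>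
    (\<forall>k. h \<le> k \<longrightarrow> k < h + n \<longrightarrow> fst (\<gamma> ! k) \<subseteq> R \<and> snd (\<gamma> ! k) \<subseteq> R)"
  using assms(2)
proof (induction n arbitrary: \<gamma>)
  case 0
  then show ?case using assms(1) by auto
next
  case (Suc n)
  then obtain \<gamma>' x z where \<gamma>: "\<gamma> = \<gamma>' @ [(x, z)]" "\<gamma>' \<in> (ext ^^ n) H" "x \<subseteq> R" "z \<subseteq> R"
    by (auto simp: in_ext_iff)
  then show ?case using Suc.IH[OF \<gamma>(2)] by (auto simp: nth_append less_Suc_eq)
qed

lemma lin_iso_pm:
  assumes "p permutes R"
  shows "lin_iso (\<lambda>\<psi> T. pm p (\<psi> T))"
proof -
  have b: "bij p" using assms by (rule permutes_bij)
  have 1: "p -` S \<subseteq> R" "p ` S \<subseteq> R" if "S \<subseteq> R" for S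
    using that permutes_in_image[OF assms] by auto
  have 2: "p ` (p -` S) = S" "p -` (p ` S) = S" for S
    using b by (simp_all add: bij_is_surj surj_image_vimage_eq bij_is_inj inj_vimage_image_eq)
  have "bij_betw (\<lambda>(T, S). (T, p -` S)) (Pow D \<times> Pow R) (Pow D \<times> Pow R)"
    by (rule bij_betw_byWitness[where f' = "\<lambda>(T, S). (T, p ` S)"]) (use 1 2 in \<open>auto simp del: vimage_image_eq\<close>)
  from lin_iso_monomial[OF this, of "\<lambda>T S. 1"] show ?thesis by (simp add: pm_def)
qed

lemma lin_iso_sphase: "lin_iso (\<lambda>\<psi> T. sphase k (\<psi> T))"
  using lin_iso_monomial[of id "\<lambda>T S. if k \<in> S then - \<i> else 1"] by (simp add: sphase_def)

lemma lin_iso_tgates: "lin_iso (\<lambda>\<psi> T S. tgates J (\<lambda>T. \<psi> T S) T)"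
proof -
  have "cnj (tphase ^ k) * tphase ^ k = 1" for k
    by (metis complex_cnj_power power_mult_distrib power_one tphase_norm)
  then show ?thesis
    using lin_iso_monomial[of id "\<lambda>T S. tphase ^ card (J \<inter> T)"] by (simp add: tgates_def)
qed

lemma lin_iso_swap_wire:
  assumes "j < a + b" "0 < W"
  shows "lin_iso (swap_wire j)"
proof -
  have 1: "update (update T j (0 \<in> S)) j (0 \<in> update S 0 (j \<in> T)) = T"
    "update (update S 0 (j \<in> T)) 0 (j \<in> update T j (0 \<in> S)) = S" for T S
    by (auto split: if_splits)
  have 2: "x < a + b" if "x \<in> update T j q" "T \<subseteq> D" for x T q using that assms by (auto split: if_splits)
  have 3: "x < W" if "x \<in> update S 0 q" "S \<subseteq> R" for x S q using that assms by (auto split: if_splits)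
  have "bij_betw (\<lambda>(T, S). (update T j (0 \<in> S), update S 0 (j \<in> T))) (Pow D \<times> Pow R) (Pow D \<times> Pow R)"
    by (rule bij_betw_byWitness[where f' = "\<lambda>(T, S). (update T j (0 \<in> S), update S 0 (j \<in> T))"])
       (use 1 in \<open>auto simp del: in_update dest: 2 3\<close>)
  moreover have "swap_wire j = (\<lambda>\<psi> T S. \<psi> (update T j (0 \<in> S)) (update S 0 (j \<in> T)))"
    by (simp add: swap_wire_def fun_eq_iff)
  ultimately show ?thesis using lin_iso_monomial[of _ "\<lambda>T S. 1"] by fastforce
qed

text \<open>Alice's steps are local isometries and cost nothing; each of Bob's steps is an instance
  of \<open>reach_round_trip\<close>.\<close>

lemma reach_exec:
  assumes "reach HA HB m G" "\<And>\<alpha>. \<alpha> \<in> HA \<Longrightarrow> length \<alpha> = h" "\<And>\<beta>. \<beta> \<in> HB \<Longrightarrow> length \<beta> = h"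
    and "net_ok h0 W net" "h0 \<le> h"
  shows "reach ((ext ^^ rounds net) HA) ((ext ^^ rounds net) HB) (m + 2 * W * rounds net)
     (\<lambda>\<alpha> \<beta> i j T. exec net h \<alpha> \<beta> (G (take h \<alpha>) (take h \<beta>) i j T))"
  using assms
proof (induction net h arbitrary: HA HB m G rule: track.induct)
  case (1 h)
  \<comment> \<open>Truncation to \<open>h\<close> is the identity on the histories at hand, so the
    scalar is 1.\<close>
  have "reach HA HB m (\<lambda>\<alpha> \<beta> i j T. G (take h \<alpha>) (take h \<beta>) i j T)"
    by (rule reach_scale[OF "1.prems"(1)]) (auto simp: "1.prems" intro!: exI[of _ 1])
  then show ?case by simp
next
  case (2 p net h)
  have p: "\<And>\<gamma>. p \<gamma> permutes R" "\<And>\<gamma>. p (take h \<gamma>) = p \<gamma>"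
  proof -
    have "net_ok h W [(True, p)]" using 2 by (intro net_ok_mono[of h0 W _ h W]) auto
    then show "\<And>\<gamma>. p \<gamma> permutes R" "\<And>\<gamma>. p (take h \<gamma>) = p \<gamma>" by auto
  qed
  have "reach HA HB m (\<lambda>\<alpha> \<beta> i j T. pm (p \<alpha>) (G \<alpha> \<beta> i j T))"
    by (rule reach_local[OF "2.prems"(1), of "\<lambda>\<alpha> \<psi> T. pm (p \<alpha>) (\<psi> T)"]) (rule lin_iso_pm[OF p(1)])
  from "2.IH"[OF this "2.prems"(2,3) _ "2.prems"(5)] show ?case using "2.prems"(4) by (simp add: p(2))
next
  case (3 p net h)
  have p: "\<And>\<gamma>. p \<gamma> permutes R" "\<And>\<gamma>. p (take h \<gamma>) = p \<gamma>" and ok: "net_ok h0 W net"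
  proof -
    have "net_ok h W [(True, p)]" using 3 by (intro net_ok_mono[of h0 W _ h W]) auto
    then show "\<And>\<gamma>. p \<gamma> permutes R" "\<And>\<gamma>. p (take h \<gamma>) = p \<gamma>" by auto
    show "net_ok h0 W net" using 3 by simp
  qed
  have len: "length \<gamma> = Suc h" if "\<gamma> \<in> ext HA \<or> \<gamma> \<in> ext HB" for \<gamma>
    using that "3.prems"(2,3) by (auto simp: in_ext_iff)
  have "reach ((ext ^^ rounds net) (ext HA)) ((ext ^^ rounds net) (ext HB)) (m + 2 * W + 2 * W * rounds net)
     (\<lambda>\<alpha> \<beta> i j T. exec net (Suc h) \<alpha> \<beta> (pauli (fst (last (take (Suc h) \<beta>))) (snd (last (take (Suc h) \<beta>)))
       (pm (p (butlast (take (Suc h) \<beta>))) (pauli (fst (last (take (Suc h) \<alpha>))) (snd (last (take (Suc h) \<alpha>)))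
         (G (butlast (take (Suc h) \<alpha>)) (butlast (take (Suc h) \<beta>)) i j T)))))"
    using "3.prems"(5)
    by (intro "3.IH"[OF reach_round_trip[OF "3.prems"(1), of p]] p(1) ok len) auto
  then have *: "reach ((ext ^^ Suc (rounds net)) HA) ((ext ^^ Suc (rounds net)) HB) (m + 2 * W * Suc (rounds net))
     (\<lambda>\<alpha> \<beta> i j T. exec net (Suc h) \<alpha> \<beta> (pauli (fst (last (take (Suc h) \<beta>))) (snd (last (take (Suc h) \<beta>)))
       (pm (p (butlast (take (Suc h) \<beta>))) (pauli (fst (last (take (Suc h) \<alpha>))) (snd (last (take (Suc h) \<alpha>)))
         (G (butlast (take (Suc h) \<alpha>)) (butlast (take (Suc h) \<beta>)) i j T)))))"
    by (simp only: funpow_Suc_right comp_def mult_Suc_right add.assoc)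
  \<comment> \<open>Separates the outcome of this round, so that \<open>last\<close> and
    \<open>butlast\<close> turn into entry \<open>h\<close> and the earlier history.\<close>
  have take: "take (Suc h) \<gamma> = take h \<gamma> @ [\<gamma> ! h]"
    if "\<gamma> \<in> (ext ^^ Suc (rounds net)) HA \<or> \<gamma> \<in> (ext ^^ Suc (rounds net)) HB" for \<gamma>
  proof -
    have "length \<gamma> = h + Suc (rounds net)"
      using that funpow_ext[of HA h \<gamma> "Suc (rounds net)"] funpow_ext[of HB h \<gamma> "Suc (rounds net)"] "3.prems"(2,3)
      by blast
    then show ?thesis by (simp add: take_Suc_conv_app_nth)
  qed
  show ?case unfolding rounds_simps
    by (rule reach_scale[OF *]) (rule exI[of _ 1], simp add: take p(2) del: funpow.simps)
qed

text \<open>The forward and the inverse network together make \<open>2 * rounds net\<close> round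
  trips of \<open>2 * W\<close> pairs each.\<close>

lemma reach_gadget:
  assumes "reach HA HB m G" "\<And>\<alpha>. \<alpha> \<in> HA \<Longrightarrow> length \<alpha> = h" "\<And>\<beta>. \<beta> \<in> HB \<Longrightarrow> length \<beta> = h"
    and ok: "net_ok h W net" and "j < a + b" "0 < W"
  shows "reach ((ext ^^ (2 * rounds net)) HA) ((ext ^^ (2 * rounds net)) HB) (m + 4 * W * rounds net)
     (\<lambda>\<alpha> \<beta> i k. swap_wire j (\<lambda>T. gadget net h \<alpha> \<beta> (swap_wire j (G (take h \<alpha>) (take h \<beta>) i k) T)))"
proof -
  let ?r = "rounds net"
  have sw: "lin_iso (swap_wire j)" using assms by (intro lin_iso_swap_wire)
  have 1: "reach HA HB m (\<lambda>\<alpha> \<beta> i k. swap_wire j (G \<alpha> \<beta> i k))"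
    by (rule reach_local[OF assms(1), of "\<lambda>\<alpha>. swap_wire j", OF sw])
  have 2: "reach ((ext ^^ ?r) HA) ((ext ^^ ?r) HB) (m + 2 * W * ?r)
     (\<lambda>\<alpha> \<beta> i k T. exec net h \<alpha> \<beta> (swap_wire j (G (take h \<alpha>) (take h \<beta>) i k) T))"
    by (rule reach_exec[OF 1 _ _ ok order_refl]) (use assms in auto)
  have 3: "reach ((ext ^^ ?r) HA) ((ext ^^ ?r) HB) (m + 2 * W * ?r)
     (\<lambda>\<alpha> \<beta> i k T. sphase 1 (exec net h \<alpha> \<beta> (swap_wire j (G (take h \<alpha>) (take h \<beta>) i k) T)))"
    using reach_local[OF 2, of "\<lambda>\<alpha> \<psi> T. sphase 1 (\<psi> T)"] lin_iso_sphase by blast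
  have "reach ((ext ^^ rounds (inv_net net)) ((ext ^^ ?r) HA)) ((ext ^^ rounds (inv_net net)) ((ext ^^ ?r) HB)) (m + 2 * W * ?r + 2 * W * rounds (inv_net net))
     (\<lambda>\<alpha> \<beta> i k T. exec (inv_net net) (h + ?r) \<alpha> \<beta> (sphase 1 (exec net h (take (h + ?r) \<alpha>) (take (h + ?r) \<beta>)
        (swap_wire j (G (take h (take (h + ?r) \<alpha>)) (take h (take (h + ?r) \<beta>)) i k) T))))"
  proof (rule reach_exec[OF 3 _ _ net_ok_inv[OF ok] le_add1])
    show "length \<alpha> = h + ?r" if "\<alpha> \<in> (ext ^^ ?r) HA" for \<alpha> using funpow_ext[OF assms(2) that] by simp
    show "length \<beta> = h + ?r" if "\<beta> \<in> (ext ^^ ?r) HB" for \<beta> using funpow_ext[OF assms(3) that] by simp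
  qed
  note * = this
  have "reach ((ext ^^ (2 * ?r)) HA) ((ext ^^ (2 * ?r)) HB) (m + 4 * W * ?r)
     (\<lambda>\<alpha> \<beta> i k T. gadget net h \<alpha> \<beta> (swap_wire j (G (take h \<alpha>) (take h \<beta>) i k) T))"
  proof -
    have "(ext ^^ (2 * ?r)) H = (ext ^^ ?r) ((ext ^^ ?r) H)" for H by (simp add: mult_2 funpow_add)
    moreover have "m + 2 * W * ?r + 2 * W * ?r = m + 4 * W * ?r" by simp
    moreover have "take h (take (h + ?r) \<gamma>) = take h \<gamma>" for \<gamma> :: history by simp
    ultimately show ?thesis
      using * unfolding exec_take[OF ok le_add1 order_refl] gadget_def by (simp only: rounds_inv_net)
  qed
  then show ?thesis
    using reach_local[of _ _ _ _ "\<lambda>\<alpha>. swap_wire j"] sw by blast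
qed

text \<open>Alice holds the data \<open>\<Phi> s\<close>, where \<open>s\<close> labels the input, up to the Pauli key \<open>(Kx, Kz)\<close>;
  the rails are in an irrelevant product state.\<close>
definition stage ::
  "history set \<Rightarrow> history set \<Rightarrow> nat \<Rightarrow> nat \<Rightarrow> (nat set \<Rightarrow> nat set \<Rightarrow> complex) \<Rightarrow>
   (history \<Rightarrow> history \<Rightarrow> nat set) \<Rightarrow> (history \<Rightarrow> history \<Rightarrow> nat set) \<Rightarrow> bool" where
  "stage HA HB h m \<Phi> Kx Kz \<longleftrightarrow> (\<forall>\<alpha>\<in>HA. length \<alpha> = h) \<and> (\<forall>\<beta>\<in>HB. length \<beta> = h) \<and>
     (\<forall>\<alpha>\<in>HA. \<forall>\<beta>\<in>HB. Kx \<alpha> \<beta> \<subseteq> D \<and> Kz \<alpha> \<beta> \<subseteq> D) \<and>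
     (\<exists>J. reach HA HB m (\<lambda>\<alpha> \<beta> i j T S. pauli (Kx \<alpha> \<beta>) (Kz \<alpha> \<beta>) (\<Phi> (i \<union> j)) T * J \<alpha> \<beta> S))"

text \<open>Networks for single key bits would not do: a Clifford gate turns a bit into a sum of
  bits, and joining one network per summand would cost a further factor of order n in every
  layer.\<close>

definition keynets ::
  "history set \<Rightarrow> history set \<Rightarrow> nat \<Rightarrow> nat \<Rightarrow> nat \<Rightarrow>
   (history \<Rightarrow> history \<Rightarrow> nat set) \<Rightarrow> (history \<Rightarrow> history \<Rightarrow> nat set) \<Rightarrow> bool" where
  "keynets HA HB h w L Kx Kz \<longleftrightarrow> (\<forall>u\<in>Pow D. \<forall>v\<in>Pow D. \<exists>net. net_ok h w net \<and> length net \<le> L \<and>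
     (\<forall>\<alpha>\<in>HA. \<forall>\<beta>\<in>HB. computes net \<alpha> \<beta> (keybit u v (Kx \<alpha> \<beta>) (Kz \<alpha> \<beta>))))"

text \<open>Alice applies T to the encrypted wire whatever the key is, and then runs the gadget,
  whose phase gate acts on the wire exactly when its X-key bit is set. New errors on the data are
  confined to wire \<open>j\<close>, and \<open>error_net\<close> makes their functionals
  computable.\<close>

lemma stage_tgate:
  assumes st: "stage HA HB h m \<Phi> Kx Kz" and j: "j < a + b" and ok: "net_ok h w net" and w: "0 < w" "w \<le> W"
    and comp: "\<And>\<alpha> \<beta>. \<alpha> \<in> HA \<Longrightarrow> \<beta> \<in> HB \<Longrightarrow> computes net \<alpha> \<beta> (j \<in> Kx \<alpha> \<beta>)"
  obtains HA' HB' ex ez where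
    "stage HA' HB' (h + 2 * rounds net) (m + 4 * W * rounds net) (\<lambda>s. tgates {j} (\<Phi> s))
       (\<lambda>\<alpha> \<beta>. sd (if ex \<alpha> \<beta> then {j} else {}) (Kx (take h \<alpha>) (take h \<beta>)))
       (\<lambda>\<alpha> \<beta>. sd (if ez \<alpha> \<beta> then {j} else {}) (Kz (take h \<alpha>) (take h \<beta>)))"
    "\<And>\<alpha> \<beta> u v. \<alpha> \<in> HA' \<Longrightarrow> \<beta> \<in> HB' \<Longrightarrow>
       computes (error_net w net h u v) \<alpha> \<beta> ((u \<and> ex \<alpha> \<beta>) \<noteq> (v \<and> ez \<alpha> \<beta>))"
    "\<And>\<alpha>. \<alpha> \<in> HA' \<Longrightarrow> take h \<alpha> \<in> HA" "\<And>\<beta>. \<beta> \<in> HB' \<Longrightarrow> take h \<beta> \<in> HB"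
proof -
  let ?r = "rounds net"
  obtain J where len: "\<And>\<alpha>. \<alpha> \<in> HA \<Longrightarrow> length \<alpha> = h" "\<And>\<beta>. \<beta> \<in> HB \<Longrightarrow> length \<beta> = h"
    and K: "\<And>\<alpha> \<beta>. \<alpha> \<in> HA \<Longrightarrow> \<beta> \<in> HB \<Longrightarrow> Kx \<alpha> \<beta> \<subseteq> D \<and> Kz \<alpha> \<beta> \<subseteq> D"
    and re: "reach HA HB m (\<lambda>\<alpha> \<beta> i j T S. pauli (Kx \<alpha> \<beta>) (Kz \<alpha> \<beta>) (\<Phi> (i \<union> j)) T * J \<alpha> \<beta> S)"
    using st unfolding stage_def by auto
  have okW: "net_ok h W net" using net_ok_mono[OF ok order_refl w(2)] .
  define HA' where "HA' = (ext ^^ (2 * ?r)) HA"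
  define HB' where "HB' = (ext ^^ (2 * ?r)) HB"
  have A': "length \<alpha> = h + 2 * ?r" "take h \<alpha> \<in> HA"
      "\<And>k. h \<le> k \<Longrightarrow> k < h + 2 * ?r \<Longrightarrow> fst (\<alpha> ! k) \<subseteq> R \<and> snd (\<alpha> ! k) \<subseteq> R" if "\<alpha> \<in> HA'" for \<alpha>
    using funpow_ext[OF len(1) that[unfolded HA'_def]] by auto
  have B': "length \<beta> = h + 2 * ?r" "take h \<beta> \<in> HB"
      "\<And>k. h \<le> k \<Longrightarrow> k < h + 2 * ?r \<Longrightarrow> fst (\<beta> ! k) \<subseteq> R \<and> snd (\<beta> ! k) \<subseteq> R" if "\<beta> \<in> HB'" for \<beta>
    using funpow_ext[OF len(2) that[unfolded HB'_def]] by auto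
  define G where "G = (\<lambda>\<alpha> \<beta> i k T S. tgates {j} (pauli (Kx \<alpha> \<beta>) (Kz \<alpha> \<beta>) (\<Phi> (i \<union> k))) T * J \<alpha> \<beta> S)"
  have "reach HA HB m G"
    using reach_local[OF re, of "\<lambda>\<alpha> \<psi> T S. tgates {j} (\<lambda>T. \<psi> T S) T", OF lin_iso_tgates]
    by (simp add: G_def tgates_def mult.assoc)
  from reach_gadget[OF this len okW j] w
  have re': "reach HA' HB' (m + 4 * W * ?r)
     (\<lambda>\<alpha> \<beta> i k. swap_wire j (\<lambda>T. gadget net h \<alpha> \<beta> (swap_wire j (G (take h \<alpha>) (take h \<beta>) i k) T)))"
    by (simp add: HA'_def HB'_def)
  let ?sets = "\<lambda>e. if e then {j} else {}"
  \<comment> \<open>Gathers what has to be chosen together for one pair of outcomes: the error bits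
    on the wire, the residual rail state, and agreement with the tracking network.\<close>
  define P where "P \<alpha> \<beta> ex ez J' \<longleftrightarrow> (\<exists>c. \<forall>i k T S.
      swap_wire j (\<lambda>T. gadget net h \<alpha> \<beta> (swap_wire j (G (take h \<alpha>) (take h \<beta>) i k) T)) T S
       = c * (pauli (sd (?sets ex) (Kx (take h \<alpha>) (take h \<beta>))) (sd (?sets ez) (Kz (take h \<alpha>) (take h \<beta>)))
           (tgates {j} (\<Phi> (i \<union> k))) T * J' S)) \<and>
      (\<forall>s. run (track_gadget net h) \<alpha> \<beta> (0, False, False, s) = (0, ex, ez, s))" for \<alpha> \<beta> ex ez and J' :: "nat set \<Rightarrow> complex"
  have "\<exists>ex ez J'. P \<alpha> \<beta> ex ez J'" if ab: "\<alpha> \<in> HA'" "\<beta> \<in> HB'" for \<alpha> \<beta>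
  proof -
    obtain c x z t where g: "x \<subseteq> {..<W}" "z \<subseteq> {..<W}" "run net \<alpha> \<beta> t = 1"
      "\<And>\<phi>. gadget net h \<alpha> \<beta> \<phi> = (\<lambda>S. c * pauli x z (sphase t \<phi>) S)"
      "\<And>s. run (track_gadget net h) \<alpha> \<beta> (0, False, False, s) = (0, 0 \<in> x, 0 \<in> z, s)"
      by (rule gadget_pauli[OF okW, of h \<alpha> \<beta>]) (use A'(3)[OF ab(1)] B'(3)[OF ab(2)] in auto)
    let ?Kx = "Kx (take h \<alpha>) (take h \<beta>)" and ?Kz = "Kz (take h \<alpha>) (take h \<beta>)"
    have K': "?Kx \<subseteq> D" "?Kz \<subseteq> D" using K[OF A'(2)[OF ab(1)] B'(2)[OF ab(2)]] by auto
    have fin: "finite A" if "A \<subseteq> D" for A using that finite_subset by blast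
    have "computes net \<alpha> \<beta> (j \<in> ?Kx)" using comp[OF A'(2)[OF ab(1)] B'(2)[OF ab(2)]] by (rule computes_take[OF ok])
    then have "run net \<alpha> \<beta> (of_bool False) = of_bool (False \<noteq> (j \<in> ?Kx))" unfolding computes_def ..
    \<comment> \<open>The datum enters on rail 0 and meets the correction iff \<open>net\<close>
      takes rail 0 to rail 1, that is, iff the computed bit is set.\<close>
    moreover have "t = 0 \<longleftrightarrow> run net \<alpha> \<beta> 0 = 1"
      using g(3) injD[OF bij_is_inj[OF run_bij[OF ok, of \<alpha> \<beta>]]] by metis
    ultimately have t: "t = 0 \<longleftrightarrow> j \<in> ?Kx" by simp
    have finz: "finite z" using g(2) finite_subset by blast
    obtain J' where J': "\<And>\<phi> T S. swap_wire j (\<lambda>T. gadget net h \<alpha> \<beta> (swap_wire j (\<lambda>T S. \<phi> T * J (take h \<alpha>) (take h \<beta>) S) T)) T S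
      = c * pauli (?sets (0 \<in> x)) (?sets (0 \<in> z)) (if t = 0 then sphase j \<phi> else \<phi>) T * J' S"
      using swap_wire_gadget[OF g(4) finz, of j "J (take h \<alpha>) (take h \<beta>)"] by blast
    have corr: "(if t = 0 then sphase j (tgates {j} (pauli ?Kx ?Kz \<phi>)) else tgates {j} (pauli ?Kx ?Kz \<phi>))
        = (\<lambda>T. (if t = 0 then cnj tphase else 1) * pauli ?Kx ?Kz (tgates {j} \<phi>) T)" for \<phi>
      using t by (auto simp: tgates_pauli)
    have pp: "pauli (?sets (0 \<in> x)) (?sets (0 \<in> z)) (pauli ?Kx ?Kz \<phi>)
        = (\<lambda>T. sg (?Kz \<inter> ?sets (0 \<in> x)) * pauli (sd (?sets (0 \<in> x)) ?Kx) (sd (?sets (0 \<in> z)) ?Kz) \<phi> T)" for \<phi>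
      using K' fin by (intro pauli_pauli) auto
    have "swap_wire j (\<lambda>T. gadget net h \<alpha> \<beta> (swap_wire j (G (take h \<alpha>) (take h \<beta>) i k) T)) T S
       = c * (if t = 0 then cnj tphase else 1) * sg (?Kz \<inter> ?sets (0 \<in> x)) * (pauli (sd (?sets (0 \<in> x)) ?Kx) (sd (?sets (0 \<in> z)) ?Kz)
           (tgates {j} (\<Phi> (i \<union> k))) T * J' S)" for i k T S
      unfolding G_def J' corr pauli_scale pp by (simp only: mult_ac)
    then have "P \<alpha> \<beta> (0 \<in> x) (0 \<in> z) J'"
      unfolding P_def by (intro conjI exI allI g(5))
    then show ?thesis by blast
  qed
  then obtain ex ez J' where P: "\<forall>\<alpha>\<in>HA'. \<forall>\<beta>\<in>HB'. P \<alpha> \<beta> (ex \<alpha> \<beta>) (ez \<alpha> \<beta>) (J' \<alpha> \<beta>)"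
    using choice2[of HA' HB' P] by blast
  show ?thesis
  proof (rule that)
    have "reach HA' HB' (m + 4 * W * ?r) (\<lambda>\<alpha> \<beta> i k T S. pauli (sd (?sets (ex \<alpha> \<beta>)) (Kx (take h \<alpha>) (take h \<beta>)))
        (sd (?sets (ez \<alpha> \<beta>)) (Kz (take h \<alpha>) (take h \<beta>))) (tgates {j} (\<Phi> (i \<union> k))) T * J' \<alpha> \<beta> S)"
    proof (rule reach_scale[OF re'])
      fix \<alpha> \<beta> assume "\<alpha> \<in> HA'" "\<beta> \<in> HB'"
      then have "P \<alpha> \<beta> (ex \<alpha> \<beta>) (ez \<alpha> \<beta>) (J' \<alpha> \<beta>)" using P by blast
      then obtain c where c: "\<forall>i k T S. swap_wire j (\<lambda>T. gadget net h \<alpha> \<beta> (swap_wire j (G (take h \<alpha>) (take h \<beta>) i k) T)) T S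
         = c * (pauli (sd (?sets (ex \<alpha> \<beta>)) (Kx (take h \<alpha>) (take h \<beta>))) (sd (?sets (ez \<alpha> \<beta>)) (Kz (take h \<alpha>) (take h \<beta>)))
           (tgates {j} (\<Phi> (i \<union> k))) T * J' \<alpha> \<beta> S)"
        unfolding P_def by (elim conjE exE)
      show "\<exists>c. \<forall>i\<in>Pow DA. \<forall>k\<in>Pow DB. \<forall>T\<in>Pow D. \<forall>S\<in>Pow R.
          swap_wire j (\<lambda>T. gadget net h \<alpha> \<beta> (swap_wire j (G (take h \<alpha>) (take h \<beta>) i k) T)) T S
         = c * (pauli (sd (?sets (ex \<alpha> \<beta>)) (Kx (take h \<alpha>) (take h \<beta>))) (sd (?sets (ez \<alpha> \<beta>)) (Kz (take h \<alpha>) (take h \<beta>)))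
           (tgates {j} (\<Phi> (i \<union> k))) T * J' \<alpha> \<beta> S)"
        by (intro exI[of _ c] ballI c[rule_format])
    qed
    moreover have "sd (?sets e) (Kx (take h \<alpha>) (take h \<beta>)) \<subseteq> D" "sd (?sets e) (Kz (take h \<alpha>) (take h \<beta>)) \<subseteq> D"
      if "\<alpha> \<in> HA'" "\<beta> \<in> HB'" for \<alpha> \<beta> e
      using K[OF A'(2)[OF that(1)] B'(2)[OF that(2)]] j by (intro sd_subset; auto)+
    ultimately show "stage HA' HB' (h + 2 * rounds net) (m + 4 * W * rounds net) (\<lambda>s. tgates {j} (\<Phi> s))
       (\<lambda>\<alpha> \<beta>. sd (?sets (ex \<alpha> \<beta>)) (Kx (take h \<alpha>) (take h \<beta>)))
       (\<lambda>\<alpha> \<beta>. sd (?sets (ez \<alpha> \<beta>)) (Kz (take h \<alpha>) (take h \<beta>)))"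
      unfolding stage_def using A'(1) B'(1) by blast
    show "computes (error_net w net h u v) \<alpha> \<beta> ((u \<and> ex \<alpha> \<beta>) \<noteq> (v \<and> ez \<alpha> \<beta>))"
      if "\<alpha> \<in> HA'" "\<beta> \<in> HB'" for \<alpha> \<beta> u v
      using P that by (intro error_net_computes[OF ok order_refl w(1)]) (auto simp: P_def)
  qed (use A'(2) B'(2) in auto)
qed

text \<open>Gates of one layer do not nest: a gate alters the key on its own wire only, so each
  gadget may use a network of length at most \<open>L\<close> on \<open>w\<close> rails for the key
  at the start of the layer. Only the networks for the resulting key become longer and need
  \<open>8 * w\<close> rails.\<close>

lemma stage_tlayer:
  assumes st: "stage HA HB h m \<Phi> Kx Kz" and kn: "keynets HA HB h w L Kx Kz"
    and w: "0 < w" "8 * w \<le> W" and "Q \<subseteq> D"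
  obtains HA' HB' h' m' Kx' Kz' where "stage HA' HB' h' m' (\<lambda>s. tgates Q (\<Phi> s)) Kx' Kz'"
    "keynets HA' HB' h' (8 * w) (L + card Q * (8 * L + 3)) Kx' Kz'" "m' \<le> m + card Q * (4 * W * L)"
proof -
  have "finite Q" using \<open>Q \<subseteq> D\<close> finite_subset by blast
  \<comment> \<open>The last conjunct drives the induction: X-key bits of wires not yet treated are
    still those from the start of the layer, evaluated at the truncated histories.\<close>
  then have "\<exists>HA' HB' h' m' Kx' Kz'. stage HA' HB' h' m' (\<lambda>s. tgates Q (\<Phi> s)) Kx' Kz' \<and>
    keynets HA' HB' h' (8 * w) (L + card Q * (8 * L + 3)) Kx' Kz' \<and> m' \<le> m + card Q * (4 * W * L) \<and> h \<le> h' \<and>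
    (\<forall>\<alpha>\<in>HA'. take h \<alpha> \<in> HA) \<and> (\<forall>\<beta>\<in>HB'. take h \<beta> \<in> HB) \<and>
    (\<forall>\<alpha>\<in>HA'. \<forall>\<beta>\<in>HB'. \<forall>j\<in>-Q. j \<in> Kx' \<alpha> \<beta> \<longleftrightarrow> j \<in> Kx (take h \<alpha>) (take h \<beta>))"
    using \<open>Q \<subseteq> D\<close>
  proof (induction Q rule: finite_induct)
    case empty
    have "keynets HA HB h (8 * w) L Kx Kz"
      unfolding keynets_def
    proof (intro ballI)
      fix u v assume "u \<in> Pow D" "v \<in> Pow D"
      then obtain net where "net_ok h w net" "length net \<le> L"
        "\<forall>\<alpha>\<in>HA. \<forall>\<beta>\<in>HB. computes net \<alpha> \<beta> (keybit u v (Kx \<alpha> \<beta>) (Kz \<alpha> \<beta>))"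
        using kn unfolding keynets_def by blast
      moreover from this(1) have "net_ok h (8 * w) net" by (rule net_ok_mono) simp_all
      ultimately show "\<exists>net. net_ok h (8 * w) net \<and> length net \<le> L \<and>
        (\<forall>\<alpha>\<in>HA. \<forall>\<beta>\<in>HB. computes net \<alpha> \<beta> (keybit u v (Kx \<alpha> \<beta>) (Kz \<alpha> \<beta>)))" by blast
    qed
    moreover have "(\<lambda>s. tgates {} (\<Phi> s)) = \<Phi>" by (simp add: tgates_def)
    moreover have "\<forall>\<alpha>\<in>HA. take h \<alpha> = \<alpha>" "\<forall>\<beta>\<in>HB. take h \<beta> = \<beta>"
      using st by (auto simp: stage_def)
    ultimately show ?case using st
      by (intro exI[of _ HA] exI[of _ HB] exI[of _ h] exI[of _ m] exI[of _ Kx] exI[of _ Kz]) simp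
  next
    case (insert j Q)
    then have "Q \<subseteq> D" by simp
    from insert.IH[OF this] obtain HA1 HB1 h1 m1 Kx1 Kz1 where IH: "stage HA1 HB1 h1 m1 (\<lambda>s. tgates Q (\<Phi> s)) Kx1 Kz1"
      "keynets HA1 HB1 h1 (8 * w) (L + card Q * (8 * L + 3)) Kx1 Kz1" "m1 \<le> m + card Q * (4 * W * L)" "h \<le> h1"
      "\<forall>\<alpha>\<in>HA1. take h \<alpha> \<in> HA" "\<forall>\<beta>\<in>HB1. take h \<beta> \<in> HB"
      "\<forall>\<alpha>\<in>HA1. \<forall>\<beta>\<in>HB1. \<forall>j\<in>-Q. j \<in> Kx1 \<alpha> \<beta> \<longleftrightarrow> j \<in> Kx (take h \<alpha>) (take h \<beta>)"
      by (elim exE conjE)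
    note IH = IH[rule_format]
    have j: "j < a + b" using insert.prems by auto
    \<comment> \<open>The functional reading the X-key bit of wire \<open>j\<close> is taken from
      the initial \<open>kn\<close>, not from the longer networks of the induction
      hypothesis.\<close>
    have "{j} \<in> Pow D" "{} \<in> Pow D" using j by auto
    from bspec[OF bspec[OF kn[unfolded keynets_def] this(1)] this(2)]
    obtain net where net: "net_ok h w net" "length net \<le> L"
      and comp: "\<forall>\<alpha>\<in>HA. \<forall>\<beta>\<in>HB. computes net \<alpha> \<beta> (keybit {j} {} (Kx \<alpha> \<beta>) (Kz \<alpha> \<beta>))"
      by (elim exE conjE)
    note comp = comp[rule_format]
    have ok1: "net_ok h1 w net" using net_ok_mono[OF net(1) IH(4) order_refl] .
    have comp1: "computes net \<alpha> \<beta> (j \<in> Kx1 \<alpha> \<beta>)" if "\<alpha> \<in> HA1" "\<beta> \<in> HB1" for \<alpha> \<beta>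
    proof -
      have "computes net (take h \<alpha>) (take h \<beta>) (j \<in> Kx (take h \<alpha>) (take h \<beta>))"
        using comp[OF IH(5)[OF that(1)] IH(6)[OF that(2)]] by (simp add: keybit_simps)
      then show ?thesis using computes_take[OF net(1)] IH(7)[OF that, of j] insert.hyps(2) by simp
    qed
    have wW: "w \<le> W" using w by simp
    let ?h = "h1 + 2 * rounds net" and ?s = "\<lambda>e. if e then {j} else {}"
    obtain HA' HB' ex ez where new: "stage HA' HB' ?h (m1 + 4 * W * rounds net) (\<lambda>s. tgates {j} (tgates Q (\<Phi> s)))
       (\<lambda>\<alpha> \<beta>. sd (?s (ex \<alpha> \<beta>)) (Kx1 (take h1 \<alpha>) (take h1 \<beta>)))
       (\<lambda>\<alpha> \<beta>. sd (?s (ez \<alpha> \<beta>)) (Kz1 (take h1 \<alpha>) (take h1 \<beta>)))"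
      and err: "\<And>\<alpha> \<beta> u v. \<alpha> \<in> HA' \<Longrightarrow> \<beta> \<in> HB' \<Longrightarrow>
         computes (error_net w net h1 u v) \<alpha> \<beta> ((u \<and> ex \<alpha> \<beta>) \<noteq> (v \<and> ez \<alpha> \<beta>))"
      and tk: "\<And>\<alpha>. \<alpha> \<in> HA' \<Longrightarrow> take h1 \<alpha> \<in> HA1" "\<And>\<beta>. \<beta> \<in> HB' \<Longrightarrow> take h1 \<beta> \<in> HB1"
      using stage_tgate[OF IH(1) j ok1 w(1) wW comp1] by blast
    have tkk: "take h (take h1 \<gamma>) = take h \<gamma>" for \<gamma> :: history using IH(4) by (simp add: min_absorb1)
    have "keynets HA' HB' ?h (8 * w) (L + card (insert j Q) * (8 * L + 3))
       (\<lambda>\<alpha> \<beta>. sd (?s (ex \<alpha> \<beta>)) (Kx1 (take h1 \<alpha>) (take h1 \<beta>)))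
       (\<lambda>\<alpha> \<beta>. sd (?s (ez \<alpha> \<beta>)) (Kz1 (take h1 \<alpha>) (take h1 \<beta>)))"
      unfolding keynets_def
    proof (intro ballI)
      fix u v assume uv: "u \<in> Pow D" "v \<in> Pow D"
      then have fin: "finite u" "finite v" using finite_subset by auto
      obtain old where old: "net_ok h1 (8 * w) old" "length old \<le> L + card Q * (8 * L + 3)"
        "\<And>\<alpha> \<beta>. \<alpha> \<in> HA1 \<Longrightarrow> \<beta> \<in> HB1 \<Longrightarrow> computes old \<alpha> \<beta> (keybit u v (Kx1 \<alpha> \<beta>) (Kz1 \<alpha> \<beta>))"
        using IH(2) uv unfolding keynets_def by blast
      \<comment> \<open>The new key is the old one plus an error on wire \<open>j\<close>, so one
        error network is added, with the coefficients of the functional at \<open>j\<close>.\<close>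
      let ?net = "error_net w net h1 (j \<in> u) (j \<in> v) @ old"
      have "net_ok ?h (8 * w) ?net"
        using error_net_ok[OF ok1 order_refl] net_ok_mono[OF old(1) _ order_refl, of ?h] by simp
      moreover have "length ?net \<le> L + card (insert j Q) * (8 * L + 3)"
        using length_error_net[of w net h1 "j \<in> u" "j \<in> v"] old(2) net(2) insert.hyps by simp
      moreover have "computes ?net \<alpha> \<beta> (keybit u v (sd (?s (ex \<alpha> \<beta>)) (Kx1 (take h1 \<alpha>) (take h1 \<beta>)))
           (sd (?s (ez \<alpha> \<beta>)) (Kz1 (take h1 \<alpha>) (take h1 \<beta>))))" if "\<alpha> \<in> HA'" "\<beta> \<in> HB'" for \<alpha> \<beta>
        unfolding keybit_sd[OF fin] keybit_single
        using err[OF that] computes_take[OF old(1) old(3)[OF tk(1)[OF that(1)] tk(2)[OF that(2)]]]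
        by (rule computes_append)
      ultimately show "\<exists>net. net_ok ?h (8 * w) net \<and> length net \<le> L + card (insert j Q) * (8 * L + 3) \<and>
        (\<forall>\<alpha>\<in>HA'. \<forall>\<beta>\<in>HB'. computes net \<alpha> \<beta> (keybit u v (sd (?s (ex \<alpha> \<beta>)) (Kx1 (take h1 \<alpha>) (take h1 \<beta>)))
           (sd (?s (ez \<alpha> \<beta>)) (Kz1 (take h1 \<alpha>) (take h1 \<beta>)))))" by blast
    qed
    moreover have "m1 + 4 * W * rounds net \<le> m + card (insert j Q) * (4 * W * L)"
    proof -
      have "4 * W * rounds net \<le> 4 * W * L" using rounds_le_length[of net] net(2) by (intro mult_le_mono2) simp
      moreover have "card (insert j Q) = Suc (card Q)" using insert.hyps by simp
      ultimately show ?thesis using IH(3) by (simp only: mult_Suc)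
    qed
    moreover have "h \<le> ?h" using IH(4) by simp
    moreover have "take h \<alpha> \<in> HA" if "\<alpha> \<in> HA'" for \<alpha> using IH(5)[OF tk(1)[OF that]] by (simp only: tkk)
    moreover have "take h \<beta> \<in> HB" if "\<beta> \<in> HB'" for \<beta> using IH(6)[OF tk(2)[OF that]] by (simp only: tkk)
    moreover have "k \<in> sd (?s (ex \<alpha> \<beta>)) (Kx1 (take h1 \<alpha>) (take h1 \<beta>)) \<longleftrightarrow> k \<in> Kx (take h \<alpha>) (take h \<beta>)"
      if "\<alpha> \<in> HA'" "\<beta> \<in> HB'" "k \<in> - insert j Q" for \<alpha> \<beta> k
      using IH(7)[OF tk(1)[OF that(1)] tk(2)[OF that(2)], of k, unfolded tkk] that(3) by auto
    moreover note new[folded tgates_insert[OF insert.hyps]]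
    ultimately show ?case by blast
  qed
  then show ?thesis using that by blast
qed

section \<open>Linear maps on the data and Clifford layers\<close>

definition kapply :: "(nat set \<Rightarrow> nat set \<Rightarrow> complex) \<Rightarrow> (nat set \<Rightarrow> complex) \<Rightarrow> nat set \<Rightarrow> complex" where
  "kapply C \<phi> = (\<lambda>T. \<Sum>s\<in>Pow D. C T s * \<phi> s)"

lemma lin_iso_kapply:
  assumes "\<And>s s'. s \<in> Pow D \<Longrightarrow> s' \<in> Pow D \<Longrightarrow> (\<Sum>T\<in>Pow D. cnj (C T s) * C T s') = (if s = s' then 1 else 0)"
  shows "lin_iso (\<lambda>\<psi> T S. kapply C (\<lambda>T. \<psi> T S) T)"
  unfolding lin_iso_def
proof (intro conjI allI impI ballI)
  fix L :: "history set" and c f assume "finite L"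
  show "(\<lambda>T S. kapply C (\<lambda>T. \<Sum>l\<in>L. c l * f l T S) T) = (\<lambda>T S. \<Sum>l\<in>L. c l * kapply C (\<lambda>T. f l T S) T)"
    unfolding kapply_def
    by (intro ext) (simp add: sum_distrib_left mult.left_commute sum.swap[of _ L])
next
  fix \<psi> \<phi> :: state
  have "(\<Sum>T\<in>Pow D. cnj (kapply C (\<lambda>T. \<psi> T S) T) * kapply C (\<lambda>T. \<phi> T S) T) = (\<Sum>s\<in>Pow D. cnj (\<psi> s S) * \<phi> s S)" for S
  proof -
    have "(\<Sum>T\<in>Pow D. cnj (kapply C (\<lambda>T. \<psi> T S) T) * kapply C (\<lambda>T. \<phi> T S) T)
        = (\<Sum>T\<in>Pow D. \<Sum>s\<in>Pow D. \<Sum>s'\<in>Pow D. (cnj (\<psi> s S) * \<phi> s' S) * (cnj (C T s) * C T s'))"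
      unfolding kapply_def cnj_sum sum_product by (intro sum.cong refl) simp
    also have "\<dots> = (\<Sum>s\<in>Pow D. \<Sum>T\<in>Pow D. \<Sum>s'\<in>Pow D. (cnj (\<psi> s S) * \<phi> s' S) * (cnj (C T s) * C T s'))"
      by (rule sum.swap)
    also have "\<dots> = (\<Sum>s\<in>Pow D. \<Sum>s'\<in>Pow D. \<Sum>T\<in>Pow D. (cnj (\<psi> s S) * \<phi> s' S) * (cnj (C T s) * C T s'))"
      by (rule sum.cong[OF refl], rule sum.swap)
    also have "\<dots> = (\<Sum>s\<in>Pow D. \<Sum>s'\<in>Pow D. if s = s' then cnj (\<psi> s S) * \<phi> s' S else 0)"
      by (intro sum.cong refl, subst sum_distrib_left[symmetric]) (simp add: assms)
    also have "\<dots> = (\<Sum>s\<in>Pow D. cnj (\<psi> s S) * \<phi> s S)"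
      by (intro sum.cong refl) (simp add: sum.delta')
    finally show ?thesis .
  qed
  then show "ip (\<lambda>T S. kapply C (\<lambda>T. \<psi> T S) T) (\<lambda>T S. kapply C (\<lambda>T. \<phi> T S) T) = ip \<psi> \<phi>"
    unfolding ip_def by (subst (1 2) sum.swap) simp
qed (simp add: kapply_def)

text \<open>Conjugation by \<open>C\<close> acts on Pauli keys, up to phases, by an additive map; the dual action on
  linear functionals of keys is what the networks need.\<close>
definition key_map :: "(nat set \<Rightarrow> nat set \<Rightarrow> complex) \<Rightarrow> bool" where
  "key_map C \<longleftrightarrow> (\<exists>X Z. (\<forall>x\<in>Pow D. \<forall>z\<in>Pow D. X x z \<in> Pow D \<and> Z x z \<in> Pow D \<and>
       (\<exists>c. \<forall>\<phi>. \<forall>T\<in>Pow D. kapply C (pauli x z \<phi>) T = c * pauli (X x z) (Z x z) (kapply C \<phi>) T)) \<and>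
     (\<forall>u\<in>Pow D. \<forall>v\<in>Pow D. \<exists>u'\<in>Pow D. \<exists>v'\<in>Pow D. \<forall>x\<in>Pow D. \<forall>z\<in>Pow D.
       keybit u v (X x z) (Z x z) \<longleftrightarrow> keybit u' v' x z))"

text \<open>A functional of the new key pulls back to a functional of the old key, whose network is
  reused unchanged. Hence neither pairs nor network length are spent.\<close>

lemma stage_clifford:
  assumes st: "stage HA HB h m \<Phi> Kx Kz" and kn: "keynets HA HB h w L Kx Kz"
    and iso: "\<And>s s'. s \<in> Pow D \<Longrightarrow> s' \<in> Pow D \<Longrightarrow> (\<Sum>T\<in>Pow D. cnj (C T s) * C T s') = (if s = s' then 1 else 0)"
    and km: "key_map C"
  obtains Kx' Kz' where "stage HA HB h m (\<lambda>s. kapply C (\<Phi> s)) Kx' Kz'" "keynets HA HB h w L Kx' Kz'"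
proof -
  obtain X Z where XZ: "\<forall>x\<in>Pow D. \<forall>z\<in>Pow D. X x z \<in> Pow D \<and> Z x z \<in> Pow D \<and>
       (\<exists>c. \<forall>\<phi>. \<forall>T\<in>Pow D. kapply C (pauli x z \<phi>) T = c * pauli (X x z) (Z x z) (kapply C \<phi>) T)"
    and key: "\<forall>u\<in>Pow D. \<forall>v\<in>Pow D. \<exists>u'\<in>Pow D. \<exists>v'\<in>Pow D. \<forall>x\<in>Pow D. \<forall>z\<in>Pow D.
       keybit u v (X x z) (Z x z) \<longleftrightarrow> keybit u' v' x z"
    using km unfolding key_map_def by (elim exE conjE)
  obtain J where len: "\<forall>\<alpha>\<in>HA. length \<alpha> = h" "\<forall>\<beta>\<in>HB. length \<beta> = h"
    and K: "\<And>\<alpha> \<beta>. \<alpha> \<in> HA \<Longrightarrow> \<beta> \<in> HB \<Longrightarrow> Kx \<alpha> \<beta> \<in> Pow D \<and> Kz \<alpha> \<beta> \<in> Pow D"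
    and re: "reach HA HB m (\<lambda>\<alpha> \<beta> i j T S. pauli (Kx \<alpha> \<beta>) (Kz \<alpha> \<beta>) (\<Phi> (i \<union> j)) T * J \<alpha> \<beta> S)"
    using st unfolding stage_def by auto
  let ?X = "\<lambda>\<alpha> \<beta>. X (Kx \<alpha> \<beta>) (Kz \<alpha> \<beta>)" and ?Z = "\<lambda>\<alpha> \<beta>. Z (Kx \<alpha> \<beta>) (Kz \<alpha> \<beta>)"
  have "reach HA HB m (\<lambda>\<alpha> \<beta> i j T S. kapply C (pauli (Kx \<alpha> \<beta>) (Kz \<alpha> \<beta>) (\<Phi> (i \<union> j))) T * J \<alpha> \<beta> S)"
    using reach_local[OF re, of "\<lambda>\<alpha> \<psi> T S. kapply C (\<lambda>T. \<psi> T S) T", OF lin_iso_kapply[OF iso]]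
    by (simp add: kapply_def sum_distrib_right mult.assoc)
  then have "reach HA HB m (\<lambda>\<alpha> \<beta> i j T S. pauli (?X \<alpha> \<beta>) (?Z \<alpha> \<beta>) (kapply C (\<Phi> (i \<union> j))) T * J \<alpha> \<beta> S)"
  proof (rule reach_scale)
    fix \<alpha> \<beta> assume "\<alpha> \<in> HA" "\<beta> \<in> HB"
    then obtain c where c: "\<forall>\<phi>. \<forall>T\<in>Pow D. kapply C (pauli (Kx \<alpha> \<beta>) (Kz \<alpha> \<beta>) \<phi>) T
        = c * pauli (?X \<alpha> \<beta>) (?Z \<alpha> \<beta>) (kapply C \<phi>) T"
      using XZ K by blast
    show "\<exists>c. \<forall>i\<in>Pow DA. \<forall>j\<in>Pow DB. \<forall>T\<in>Pow D. \<forall>S\<in>Pow R.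
        kapply C (pauli (Kx \<alpha> \<beta>) (Kz \<alpha> \<beta>) (\<Phi> (i \<union> j))) T * J \<alpha> \<beta> S
        = c * (pauli (?X \<alpha> \<beta>) (?Z \<alpha> \<beta>) (kapply C (\<Phi> (i \<union> j))) T * J \<alpha> \<beta> S)"
      by (rule exI[of _ c], intro ballI, simp only: c[rule_format] mult.assoc)
  qed
  then have "stage HA HB h m (\<lambda>s. kapply C (\<Phi> s)) ?X ?Z"
    unfolding stage_def using len XZ K by blast
  moreover have "keynets HA HB h w L ?X ?Z"
    unfolding keynets_def
  proof (intro ballI)
    fix u v assume "u \<in> Pow D" "v \<in> Pow D"
    from bspec[OF bspec[OF key this(1)] this(2)] obtain u' v' where uv: "u' \<in> Pow D" "v' \<in> Pow D"
      "\<forall>x\<in>Pow D. \<forall>z\<in>Pow D. keybit u v (X x z) (Z x z) \<longleftrightarrow> keybit u' v' x z"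
      by (elim bexE)
    note uv = uv[rule_format]
    obtain net where net: "net_ok h w net" "length net \<le> L"
      "\<And>\<alpha> \<beta>. \<alpha> \<in> HA \<Longrightarrow> \<beta> \<in> HB \<Longrightarrow> computes net \<alpha> \<beta> (keybit u' v' (Kx \<alpha> \<beta>) (Kz \<alpha> \<beta>))"
      using kn uv(1,2) unfolding keynets_def by blast
    have "computes net \<alpha> \<beta> (keybit u v (?X \<alpha> \<beta>) (?Z \<alpha> \<beta>))" if "\<alpha> \<in> HA" "\<beta> \<in> HB" for \<alpha> \<beta>
      using net(3)[OF that] K[OF that] uv(3) by simp
    then show "\<exists>net. net_ok h w net \<and> length net \<le> L \<and>
      (\<forall>\<alpha>\<in>HA. \<forall>\<beta>\<in>HB. computes net \<alpha> \<beta> (keybit u v (?X \<alpha> \<beta>) (?Z \<alpha> \<beta>)))"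
      using net(1,2) by blast
  qed
  ultimately show ?thesis by (rule that)
qed

text \<open>The initial key consists of Bob's teleportation outcomes, so he alone knows every
  functional of it: one step that exchanges rails 0 and 1 or does nothing computes it.\<close>

lemma stage_init:
  obtains HA HB Kx Kz where "stage HA HB 1 b (\<lambda>s T. if T = s then 1 else 0) Kx Kz" "keynets HA HB 1 2 1 Kx Kz"
proof
  let ?HA = "{[({}, {})]} :: history set" and ?HB = "(\<lambda>e. [e]) ` (Pow DB \<times> Pow DB) :: history set"
  let ?X = "\<lambda>\<alpha> \<beta> :: history. fst (hd \<beta>)" and ?Z = "\<lambda>\<alpha> \<beta> :: history. snd (hd \<beta>)"
  show "stage ?HA ?HB 1 b (\<lambda>s T. if T = s then 1 else 0) ?X ?Z"
    unfolding stage_def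
    by (intro conjI exI[of _ "\<lambda>\<alpha> \<beta> S. if S = {} then 1 else 0"] reach_teleport) auto
  show "keynets ?HA ?HB 1 2 1 ?X ?Z"
    unfolding keynets_def
  proof (intro ballI)
    fix u v
    define p where "p \<gamma> = (if keybit u v (fst (hd \<gamma>)) (snd (hd \<gamma>)) then transpose 0 (1::nat) else id)" for \<gamma> :: history
    have "hd (take 1 \<gamma>) = hd \<gamma>" for \<gamma> :: history by (cases \<gamma>) auto
    then have "p (take 1 \<gamma>) = p \<gamma>" for \<gamma> by (simp add: p_def)
    moreover have "p \<gamma> permutes {..<2}" for \<gamma>
      by (auto simp: p_def permutes_id intro: permutes_swap_id)
    ultimately have "net_ok 1 2 [(False, p)]" by simp
    moreover have "computes [(False, p)] \<alpha> \<beta> (keybit u v (?X \<alpha> \<beta>) (?Z \<alpha> \<beta>))" for \<alpha> \<beta>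
      by (auto simp: computes_def p_def)
    ultimately show "\<exists>net. net_ok 1 2 net \<and> length net \<le> 1 \<and>
      (\<forall>\<alpha>\<in>?HA. \<forall>\<beta>\<in>?HB. computes net \<alpha> \<beta> (keybit u v (?X \<alpha> \<beta>) (?Z \<alpha> \<beta>)))"
      by (intro exI[of _ "[(False, p)]"]) simp
  qed
qed

end

section \<open>Matrices as kernels on qubit labels\<close>

text \<open>The label of basis state \<open>r\<close> of \<open>n\<close> qubits; qubit 0 is the most significant bit.\<close>
definition bset :: "nat \<Rightarrow> nat \<Rightarrow> nat set" where
  "bset n r = {j. j < n \<and> odd (r div 2 ^ (n - 1 - j))}"

lemma bset_subset: "bset n r \<subseteq> {..<n}"
  by (auto simp: bset_def)

text \<open>Matches the register order A (x) B: Alice's qubits are the high bits, and Bob's labels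
  are shifted by \<open>a\<close>.\<close>

lemma bset_pair:
  assumes "k < 2 ^ b"
  shows "bset (a + b) (i * 2 ^ b + k) = bset a i \<union> (+) a ` bset b k"
proof (intro Set.set_eqI)
  fix j
  consider "j < a" | j' where "j = a + j'" "j' < b" | "a + b \<le> j"
    by (metis add_diff_inverse_nat leI nat_add_left_cancel_less)
  then show "j \<in> bset (a + b) (i * 2 ^ b + k) \<longleftrightarrow> j \<in> bset a i \<union> (+) a ` bset b k"
  proof cases
    case 1
    have "a + b - 1 - j = b + (a - 1 - j)" using 1 by simp
    then have "(i * 2 ^ b + k) div 2 ^ (a + b - 1 - j) = (i * 2 ^ b + k) div 2 ^ b div 2 ^ (a - 1 - j)"
      by (simp only: power_add div_mult2_eq)
    also have "(i * 2 ^ b + k) div 2 ^ b = i" using assms by simp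
    finally show ?thesis using 1 by (auto simp: bset_def)
  next
    case 2
    define q where "q = (2::nat) ^ (b - 1 - j')"
    have "(2::nat) ^ b = 2 ^ (Suc j') * q"
      unfolding q_def using 2 by (simp flip: power_add power_Suc)
    then have "(i * 2 ^ b + k) div q = ((i * 2 ^ Suc j') * q + k) div q" by (simp only: mult.assoc)
    also have "\<dots> = i * 2 ^ Suc j' + k div q" by (simp add: q_def)
    finally have "odd ((i * 2 ^ b + k) div q) \<longleftrightarrow> odd (k div q)" by simp
    moreover have "a + b - 1 - j = b - 1 - j'" using 2 by simp
    ultimately show ?thesis using 2 by (auto simp: bset_def q_def)
  next
    case 3
    then show ?thesis by (auto simp: bset_def)
  qed
qed

lemma bset_Suc:
  assumes "i < 2" "r < 2 ^ n"
  shows "bset (Suc n) (i * 2 ^ n + r) = (if i = 1 then {0} else {}) \<union> Suc ` bset n r"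
proof -
  have "bset 1 i = (if i = 1 then {0} else {})"
  proof -
    have "i = 0 \<or> i = 1" using assms(1) by auto
    then show ?thesis by (auto simp: bset_def)
  qed
  moreover have "(+) 1 ` bset n r = Suc ` bset n r" by simp
  ultimately show ?thesis using bset_pair[OF assms(2), of 1 i] by (simp only: plus_1_eq_Suc)
qed

lemma bij_betw_bset: "bij_betw (bset n) {..<2 ^ n} (Pow {..<n})"
proof -
  have "inj_on (bset n) {..<2 ^ n}"
  proof (induction n)
    case (Suc n)
    show ?case
    proof (rule inj_onI)
      fix r c assume rc: "r \<in> {..<2 ^ Suc n}" "c \<in> {..<2 ^ Suc n}" "bset (Suc n) r = bset (Suc n) c"
      have "r < 2 * 2 ^ n" "c < 2 * 2 ^ n" using rc by auto
      then obtain i r' j c' where i: "i < 2" "r' < 2 ^ n" "r = i * 2 ^ n + r'"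
        and j: "j < 2" "c' < 2 ^ n" "c = j * 2 ^ n + c'"
        by (metis pair_index_cases)
      have eq: "(if i = 1 then {0} else {}) \<union> Suc ` bset n r' = (if j = 1 then {0} else {}) \<union> Suc ` bset n c'"
        using rc(3) unfolding i(3) j(3) bset_Suc[OF i(1,2)] bset_Suc[OF j(1,2)] .
      then have "0 \<in> (if i = 1 then {0} else {}) \<union> Suc ` bset n r' \<longleftrightarrow> 0 \<in> (if j = 1 then {0} else {}) \<union> Suc ` bset n c'"
        by (simp only:)
      then have "i = j" using i(1) j(1) by (auto split: if_splits)
      moreover have "bset n r' = bset n c'"
      proof (intro Set.set_eqI)
        fix k
        have "Suc k \<in> (if i = 1 then {0} else {}) \<union> Suc ` bset n r' \<longleftrightarrow> Suc k \<in> (if j = 1 then {0} else {}) \<union> Suc ` bset n c'"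
          by (simp only: eq)
        then show "k \<in> bset n r' \<longleftrightarrow> k \<in> bset n c'" by (auto split: if_splits)
      qed
      ultimately show "r = c" using Suc.IH i j by (auto dest: inj_onD)
    qed
  qed (auto simp: inj_on_def)
  moreover have "bset n ` {..<2 ^ n} \<subseteq> Pow {..<n}" using bset_subset by blast
  ultimately have "bset n ` {..<2 ^ n} = Pow {..<n}"
    by (intro card_subset_eq) (simp_all add: card_image card_Pow)
  then show ?thesis using \<open>inj_on (bset n) {..<2 ^ n}\<close> by (simp add: bij_betw_def)
qed

lemma sum_bset: "(\<Sum>T\<in>Pow {..<n}. f T) = (\<Sum>r<2 ^ n. f (bset n r))"
  by (rule sum.reindex_bij_betw[OF bij_betw_bset, symmetric])

definition bindex :: "nat \<Rightarrow> nat set \<Rightarrow> nat" where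
  "bindex n = the_inv_into {..<2 ^ n} (bset n)"

lemma bindex_bset [simp]: "r < 2 ^ n \<Longrightarrow> bindex n (bset n r) = r"
  unfolding bindex_def using bij_betw_bset[of n] by (simp add: bij_betw_def the_inv_into_f_f)

lemma bset_bindex [simp]: "T \<subseteq> {..<n} \<Longrightarrow> bset n (bindex n T) = T"
  unfolding bindex_def using bij_betw_bset[of n] by (simp add: bij_betw_def f_the_inv_into_f)

lemma bindex_less: "T \<subseteq> {..<n} \<Longrightarrow> bindex n T < 2 ^ n"
  using bij_betw_bset[of n] the_inv_into_into[of "bset n" "{..<2 ^ n}" T "{..<2 ^ n}"]
  by (auto simp: bij_betw_def bindex_def)

section \<open>Entries of tensor products of qubit gates\<close>

lemma kron_list_carrier:
  assumes "\<And>M. M \<in> set Ms \<Longrightarrow> M \<in> carrier_mat 2 2"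
  shows "kron_list Ms \<in> carrier_mat (2 ^ length Ms) (2 ^ length Ms)"
  using assms
proof (induction Ms)
  case (Cons M Ms)
  then show ?case using kron_carrier[of M 2 2 "kron_list Ms"] by simp
qed simp

lemma kron_list_index:
  assumes "\<And>M. M \<in> set Ms \<Longrightarrow> M \<in> carrier_mat 2 2" "length Ms = n" "r < 2 ^ n" "c < 2 ^ n"
  shows "kron_list Ms $$ (r, c) = (\<Prod>j<n. (Ms ! j) $$ (of_bool (j \<in> bset n r), of_bool (j \<in> bset n c)))"
  using assms
proof (induction Ms arbitrary: n r c)
  case Nil
  then show ?case by simp
next
  case (Cons M Ms)
  define k where "k = length Ms"
  have n: "n = Suc k" using Cons.prems(2) by (simp add: k_def)
  have "r < 2 * 2 ^ k" "c < 2 * 2 ^ k" using Cons.prems(3,4) n by auto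
  then obtain i r' j c' where i: "i < 2" "r' < 2 ^ k" "r = i * 2 ^ k + r'"
    and j: "j < 2" "c' < 2 ^ k" "c = j * 2 ^ k + c'"
    by (metis pair_index_cases)
  have c: "M \<in> carrier_mat 2 2" "kron_list Ms \<in> carrier_mat (2 ^ k) (2 ^ k)"
    using Cons.prems kron_list_carrier[of Ms] by (auto simp: k_def)
  have IH: "kron_list Ms $$ (r', c') = (\<Prod>l<k. (Ms ! l) $$ (of_bool (l \<in> bset k r'), of_bool (l \<in> bset k c')))"
    using Cons.prems i j by (intro Cons.IH) (auto simp: k_def)
  have 0: "of_bool (0 \<in> bset n r) = i" "of_bool (0 \<in> bset n c) = j"
    using i(1) j(1) unfolding n i(3) j(3) bset_Suc[OF i(1,2)] bset_Suc[OF j(1,2)] by auto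
  have S: "Suc l \<in> bset n r \<longleftrightarrow> l \<in> bset k r'" "Suc l \<in> bset n c \<longleftrightarrow> l \<in> bset k c'" for l
    unfolding n i(3) j(3) bset_Suc[OF i(1,2)] bset_Suc[OF j(1,2)] by auto
  have "kron_list (M # Ms) $$ (r, c) = M $$ (i, j) * kron_list Ms $$ (r', c')"
    unfolding i(3) j(3) kron_list.simps by (rule kron_index[OF c i(1,2) j(1,2)])
  also have "\<dots> = (\<Prod>l<Suc k. ((M # Ms) ! l) $$ (of_bool (l \<in> bset n r), of_bool (l \<in> bset n c)))"
    unfolding IH prod.lessThan_Suc_shift by (simp add: 0 S)
  finally show ?case by (simp add: n)
qed

lemma prod_if_zero:
  fixes f :: "'a \<Rightarrow> 'b :: comm_semiring_1"
  assumes "finite A"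
  shows "(\<Prod>j\<in>A. if P j then f j else 0) = (if \<forall>j\<in>A. P j then \<Prod>j\<in>A. f j else 0)"
proof (cases "\<forall>j\<in>A. P j")
  case False
  then have "(\<Prod>j\<in>A. if P j then f j else 0) = 0" by (intro prod_zero assms) auto
  then show ?thesis by (simp only: False if_False)
next
  case True
  then have "(\<Prod>j\<in>A. if P j then f j else 0) = (\<Prod>j\<in>A. f j)" by (intro prod.cong) auto
  then show ?thesis using True by simp
qed

lemma prod_phase:
  fixes p :: "'a :: comm_monoid_mult"
  assumes "finite A"
  shows "(\<Prod>j\<in>A. if j \<in> B then p else 1) = p ^ card (B \<inter> A)"
  using assms by (simp add: prod.If_cases Int_commute)

lemma subset_eq_bounded_iff:
  "A \<subseteq> {..<n} \<Longrightarrow> B \<subseteq> {..<n} \<Longrightarrow> (\<forall>j<n. (j \<in> A) = (j \<in> B)) \<longleftrightarrow> A = B" for n :: nat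
  by blast

lemma T_layer_carrier: "T_layer n S \<in> carrier_mat (2 ^ n) (2 ^ n)"
proof -
  have "kron_list (map (\<lambda>j. if j \<in> S then T_gate else pauli_I) [0..<n]) \<in> carrier_mat (2 ^ length (map (\<lambda>j. if j \<in> S then T_gate else pauli_I) [0..<n]))
      (2 ^ length (map (\<lambda>j. if j \<in> S then T_gate else pauli_I) [0..<n]))"
    by (rule kron_list_carrier) (auto simp: T_gate_def pauli_I_def mat_of_rows_list_def split: if_splits)
  then show ?thesis by (simp add: T_layer_def)
qed

lemma T_layer_index:
  assumes "r < 2 ^ n" "c < 2 ^ n"
  shows "T_layer n S $$ (r, c) = (if r = c then tphase ^ card (S \<inter> bset n r) else 0)"
proof -
  let ?Ms = "map (\<lambda>j. if j \<in> S then T_gate else pauli_I) [0..<n]"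
  have e: "(if j \<in> S then T_gate else pauli_I) $$ (of_bool x, of_bool y)
      = (if x = y then (if j \<in> S \<and> x then tphase else 1) else 0)" for j x y
    by (auto simp: T_gate_def pauli_I_def mat_of_rows_list_def tphase_def)
  have "T_layer n S $$ (r, c) = (\<Prod>j<n. (?Ms ! j) $$ (of_bool (j \<in> bset n r), of_bool (j \<in> bset n c)))"
    unfolding T_layer_def using assms
    by (intro kron_list_index) (auto simp: T_gate_def pauli_I_def mat_of_rows_list_def split: if_splits)
  also have "\<dots> = (\<Prod>j<n. if (j \<in> bset n r) = (j \<in> bset n c) then (if j \<in> S \<inter> bset n r then tphase else 1) else 0)"
    by (intro prod.cong refl) (simp add: e)
  also have "\<dots> = (if \<forall>j<n. (j \<in> bset n r) = (j \<in> bset n c) then tphase ^ card (S \<inter> bset n r \<inter> {..<n}) else 0)"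
    by (simp only: prod_if_zero[OF finite_lessThan] prod_phase[OF finite_lessThan] Ball_def lessThan_iff)
  also have "S \<inter> bset n r \<inter> {..<n} = S \<inter> bset n r" using bset_subset[of n r] by auto
  also have "(\<forall>j<n. (j \<in> bset n r) = (j \<in> bset n c)) \<longleftrightarrow> r = c"
  proof
    assume "\<forall>j<n. (j \<in> bset n r) = (j \<in> bset n c)"
    then have "bset n r = bset n c" by (auto simp: bset_def)
    then show "r = c" using assms by (metis bindex_bset)
  qed simp
  finally show ?thesis .
qed

section \<open>Paulis and Cliffords as operators on label vectors\<close>

context protocol
begin

definition kernel :: "complex mat \<Rightarrow> nat set \<Rightarrow> nat set \<Rightarrow> complex" where
  "kernel U T s = U $$ (bindex (a + b) T, bindex (a + b) s)"

lemma kapply_kernel: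
  assumes "T \<in> Pow D"
  shows "kapply (kernel U) \<phi> T = (\<Sum>c<2 ^ (a + b). U $$ (bindex (a + b) T, c) * \<phi> (bset (a + b) c))"
  unfolding kapply_def sum_bset by (intro sum.cong refl) (simp add: kernel_def)

lemma kapply_cong: "(\<And>s. s \<in> Pow D \<Longrightarrow> \<phi> s = \<psi> s) \<Longrightarrow> kapply C \<phi> = kapply C \<psi>"
  unfolding kapply_def by (intro ext sum.cong refl) simp

lemma kapply_scale: "kapply C (\<lambda>s. c * \<phi> s) = (\<lambda>T. c * kapply C \<phi> T)"
  by (simp add: kapply_def sum_distrib_left mult.left_commute)

lemma kapply_mult:
  assumes A: "A \<in> carrier_mat (2 ^ (a + b)) (2 ^ (a + b))" and B: "B \<in> carrier_mat (2 ^ (a + b)) (2 ^ (a + b))"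
    and T: "T \<in> Pow D"
  shows "kapply (kernel (A * B)) \<phi> T = kapply (kernel A) (kapply (kernel B) \<phi>) T"
proof -
  have lt: "bindex (a + b) T < 2 ^ (a + b)" using T by (simp add: bindex_less)
  have "kapply (kernel (A * B)) \<phi> T
      = (\<Sum>c<2 ^ (a + b). \<Sum>l<2 ^ (a + b). A $$ (bindex (a + b) T, l) * (B $$ (l, c) * \<phi> (bset (a + b) c)))"
    unfolding kapply_kernel[OF T]
    by (intro sum.cong refl) (simp add: mult_mat_index[OF A B lt] sum_distrib_right mult.assoc)
  also have "\<dots> = (\<Sum>l<2 ^ (a + b). \<Sum>c<2 ^ (a + b). A $$ (bindex (a + b) T, l) * (B $$ (l, c) * \<phi> (bset (a + b) c)))"
    by (rule sum.swap)
  also have "\<dots> = kapply (kernel A) (kapply (kernel B) \<phi>) T"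
    unfolding kapply_kernel[OF T]
  proof (intro sum.cong refl)
    fix l :: nat assume "l \<in> {..<2 ^ (a + b)}"
    then show "(\<Sum>c<2 ^ (a + b). A $$ (bindex (a + b) T, l) * (B $$ (l, c) * \<phi> (bset (a + b) c)))
        = A $$ (bindex (a + b) T, l) * kapply (kernel B) \<phi> (bset (a + b) l)"
      using bset_subset[of "a + b" l] by (simp add: kapply_kernel sum_distrib_left)
  qed
  finally show ?thesis .
qed

lemma kernel_mult:
  assumes A: "A \<in> carrier_mat (2 ^ (a + b)) (2 ^ (a + b))" and B: "B \<in> carrier_mat (2 ^ (a + b)) (2 ^ (a + b))"
    and "T \<in> Pow D" "s \<in> Pow D"
  shows "kernel (A * B) T s = kapply (kernel A) (\<lambda>T. kernel B T s) T"
proof -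
  have lt: "bindex (a + b) T < 2 ^ (a + b)" "bindex (a + b) s < 2 ^ (a + b)" using assms by (auto intro: bindex_less)
  show ?thesis
    unfolding kapply_kernel[OF assms(3)] unfolding kernel_def mult_mat_index[OF A B lt] by (intro sum.cong refl) simp
qed

lemma kernel_isometry:
  assumes U: "is_unitary (2 ^ (a + b)) U" and "s \<in> Pow D" "s' \<in> Pow D"
  shows "(\<Sum>T\<in>Pow D. cnj (kernel U T s) * kernel U T s') = (if s = s' then 1 else 0)"
proof -
  have Uc: "U \<in> carrier_mat (2 ^ (a + b)) (2 ^ (a + b))" "adj U * U = 1\<^sub>m (2 ^ (a + b))"
    using U by (auto simp: is_unitary_def)
  have lt: "bindex (a + b) s < 2 ^ (a + b)" "bindex (a + b) s' < 2 ^ (a + b)" using assms by (auto intro: bindex_less)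
  have "(\<Sum>T\<in>Pow D. cnj (kernel U T s) * kernel U T s') = (adj U * U) $$ (bindex (a + b) s, bindex (a + b) s')"
    unfolding sum_bset gram_index[OF Uc(1) lt] by (intro sum.cong refl) (simp add: kernel_def)
  also have "\<dots> = (if bindex (a + b) s = bindex (a + b) s' then 1 else 0)" unfolding Uc(2) using lt by simp
  also have "bindex (a + b) s = bindex (a + b) s' \<longleftrightarrow> s = s'" using assms by (metis PowD bset_bindex)
  finally show ?thesis .
qed

lemma kapply_T_layer:
  assumes "T \<in> Pow D"
  shows "kapply (kernel (T_layer (a + b) S)) \<phi> T = tgates S \<phi> T"
proof -
  have lt: "bindex (a + b) T < 2 ^ (a + b)" using assms by (simp add: bindex_less)
  have "kapply (kernel (T_layer (a + b) S)) \<phi> T = (\<Sum>c<2 ^ (a + b). if c = bindex (a + b) T then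
     tphase ^ card (S \<inter> T) * \<phi> (bset (a + b) c) else 0)"
    unfolding kapply_kernel[OF assms] using lt assms
    by (intro sum.cong refl) (simp add: T_layer_index)
  then show ?thesis using lt assms by (simp add: tgates_def)
qed

text \<open>The factor \<open>c\<close> is left open apart from being nonzero;
  \<open>clifford_intertwines\<close> divides by it.\<close>

definition acts_as_pauli :: "complex mat \<Rightarrow> complex \<Rightarrow> nat set \<Rightarrow> nat set \<Rightarrow> bool" where
  "acts_as_pauli P c x z \<longleftrightarrow> P \<in> carrier_mat (2 ^ (a + b)) (2 ^ (a + b)) \<and> c \<noteq> 0 \<and> x \<in> Pow D \<and> z \<in> Pow D \<and>
     (\<forall>\<phi>. \<forall>T\<in>Pow D. kapply (kernel P) \<phi> T = c * pauli x z \<phi> T)"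

text \<open>Both bits are read off the 2 x 2 entries: X and Y are the Paulis with zero diagonal, and
  Y and Z are those whose two row sums differ, by a sign.\<close>

lemma acts_as_pauli_kron_list:
  assumes len: "length ps = a + b" and ps: "set ps \<subseteq> {pauli_I, pauli_X, pauli_Y, pauli_Z}"
  shows "\<exists>c. acts_as_pauli (kron_list ps) c {j. j < a + b \<and> ps ! j $$ (0, 0) = 0}
     {j. j < a + b \<and> ps ! j $$ (0, 0) + ps ! j $$ (0, 1) \<noteq> ps ! j $$ (1, 0) + ps ! j $$ (1, 1)}"
proof -
  define x where "x = {j. j < a + b \<and> ps ! j $$ (0, 0) = 0}"
  define z where "z = {j. j < a + b \<and> ps ! j $$ (0, 0) + ps ! j $$ (0, 1) \<noteq> ps ! j $$ (1, 0) + ps ! j $$ (1, 1)}"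
  define c where "c = (\<Prod>j<a + b. ps ! j $$ (0, 0) + ps ! j $$ (0, 1))"
  have pj: "ps ! j \<in> {pauli_I, pauli_X, pauli_Y, pauli_Z}" if "j < a + b" for j
    using subsetD[OF ps nth_mem[of j ps]] len that by simp
  have carrier2: "p \<in> carrier_mat 2 2" if "p \<in> {pauli_I, pauli_X, pauli_Y, pauli_Z}" for p
    using that by (auto simp: pauli_I_def pauli_X_def pauli_Y_def pauli_Z_def mat_of_rows_list_def)
  have carrier: "kron_list ps \<in> carrier_mat (2 ^ (a + b)) (2 ^ (a + b))"
    using kron_list_carrier[of ps] ps carrier2 len by (metis subsetD)
  \<comment> \<open>Each row of a Pauli has one nonzero entry, so its row sum is that entry; the
    column is given by the X bit, the relative sign of row 1 by the Z bit.\<close>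
  have entry: "p $$ (of_bool q, of_bool q') = (if q' = (q \<noteq> (p $$ (0, 0) = 0)) then
      (p $$ (0, 0) + p $$ (0, 1)) * (if p $$ (0, 0) + p $$ (0, 1) \<noteq> p $$ (1, 0) + p $$ (1, 1) \<and> q then - 1 else 1) else 0)"
    "p $$ (0, 0) + p $$ (0, 1) \<noteq> 0"
    if "p \<in> {pauli_I, pauli_X, pauli_Y, pauli_Z}" for p q q'
    using that by (auto simp: pauli_I_def pauli_X_def pauli_Y_def pauli_Z_def mat_of_rows_list_def)
  have c0: "c \<noteq> 0" unfolding c_def using entry(2)[OF pj] by simp
  have idx: "kron_list ps $$ (r, s) = (if bset (a + b) s = sd (bset (a + b) r) x then c * sg (z \<inter> bset (a + b) r) else 0)"
    if rs: "r < 2 ^ (a + b)" "s < 2 ^ (a + b)" for r s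
  proof -
    let ?r = "bset (a + b) r" and ?s = "bset (a + b) s"
    have "kron_list ps $$ (r, s) = (\<Prod>j<a + b. ps ! j $$ (of_bool (j \<in> ?r), of_bool (j \<in> ?s)))"
      using ps carrier2 by (intro kron_list_index len rs) blast
    also have "\<dots> = (\<Prod>j<a + b. if (j \<in> ?s) = (j \<in> sd ?r x) then
        (ps ! j $$ (0, 0) + ps ! j $$ (0, 1)) * (if j \<in> z \<inter> ?r then - 1 else 1) else 0)"
    proof (rule prod.cong[OF refl])
      fix j assume "j \<in> {..<a + b}"
      then have j: "j < a + b" by simp
      show "ps ! j $$ (of_bool (j \<in> ?r), of_bool (j \<in> ?s)) = (if (j \<in> ?s) = (j \<in> sd ?r x) then
        (ps ! j $$ (0, 0) + ps ! j $$ (0, 1)) * (if j \<in> z \<inter> ?r then - 1 else 1) else 0)"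
        unfolding entry(1)[OF pj[OF j], of "j \<in> ?r" "j \<in> ?s"] using j
        by (cases "j \<in> ?r"; cases "j \<in> ?s"; simp add: x_def z_def)
    qed
    also have "\<dots> = (if \<forall>j<a + b. (j \<in> ?s) = (j \<in> sd ?r x) then c * (-1) ^ card (z \<inter> ?r \<inter> {..<a + b}) else 0)"
      by (simp only: prod_if_zero[OF finite_lessThan] prod.distrib prod_phase[OF finite_lessThan] c_def
        Ball_def lessThan_iff if_True)
    also have "z \<inter> ?r \<inter> {..<a + b} = z \<inter> ?r" by (auto simp: z_def)
    also have "(\<forall>j<a + b. (j \<in> ?s) = (j \<in> sd ?r x)) \<longleftrightarrow> ?s = sd ?r x"
      using bset_subset[of "a + b"] by (intro subset_eq_bounded_iff sd_subset) (auto simp: x_def)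
    finally show ?thesis by (simp add: sg_def)
  qed
  have "kapply (kernel (kron_list ps)) \<phi> T = c * pauli x z \<phi> T" if T: "T \<in> Pow D" for \<phi> T
  proof -
    have lt: "bindex (a + b) T < 2 ^ (a + b)" using T by (simp add: bindex_less)
    have x: "sd T x \<subseteq> D" using T by (intro sd_subset) (auto simp: x_def)
    have "kapply (kernel (kron_list ps)) \<phi> T = (\<Sum>s\<in>Pow D. if s = sd T x then c * sg (z \<inter> T) * \<phi> s else 0)"
      unfolding kapply_def
    proof (intro sum.cong refl)
      fix s assume "s \<in> Pow D"
      then show "kernel (kron_list ps) T s * \<phi> s = (if s = sd T x then c * sg (z \<inter> T) * \<phi> s else 0)"
        using T idx[OF lt bindex_less[of s "a + b"]] by (simp add: kernel_def)
    qed
    also have "\<dots> = c * pauli x z \<phi> T" using x by (simp add: pauli_def)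
    finally show ?thesis .
  qed
  then have "acts_as_pauli (kron_list ps) c x z"
    unfolding acts_as_pauli_def using carrier c0 by (auto simp: x_def z_def)
  then show ?thesis unfolding x_def z_def by (intro exI)
qed

lemma pauli_string_acts:
  assumes "pauli_string (a + b) P"
  obtains c x z where "acts_as_pauli P c x z"
  using assms acts_as_pauli_kron_list unfolding pauli_string_def by blast

lemma pauli_string_exists:
  assumes "x \<in> Pow D" "z \<in> Pow D"
  obtains P c where "pauli_string (a + b) P" "acts_as_pauli P c x z"
proof -
  define ps where "ps = map (\<lambda>j. if j \<in> x then if j \<in> z then pauli_Y else pauli_X
     else if j \<in> z then pauli_Z else pauli_I) [0..<a + b]"
  have len: "length ps = a + b" and ps: "set ps \<subseteq> {pauli_I, pauli_X, pauli_Y, pauli_Z}"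
    by (auto simp: ps_def)
  note defs = pauli_I_def pauli_X_def pauli_Y_def pauli_Z_def mat_of_rows_list_def
  have "{j. j < a + b \<and> ps ! j $$ (0, 0) = 0} = x"
    using assms by (auto simp: ps_def defs split: if_splits)
  moreover have "{j. j < a + b \<and> ps ! j $$ (0, 0) + ps ! j $$ (0, 1) \<noteq> ps ! j $$ (1, 0) + ps ! j $$ (1, 1)} = z"
    using assms by (auto simp: ps_def defs split: if_splits)
  ultimately obtain c where "acts_as_pauli (kron_list ps) c x z"
    using acts_as_pauli_kron_list[OF len ps] by auto
  moreover have "pauli_string (a + b) (kron_list ps)"
    unfolding pauli_string_def using len ps by blast
  ultimately show ?thesis using that by blast
qed

definition intertwines :: "(nat set \<Rightarrow> nat set \<Rightarrow> complex) \<Rightarrow> nat set \<Rightarrow> nat set \<Rightarrow> nat set \<Rightarrow> nat set \<Rightarrow> bool" where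
  "intertwines C x z x' z' \<longleftrightarrow> x' \<in> Pow D \<and> z' \<in> Pow D \<and>
     (\<exists>c. \<forall>\<phi>. \<forall>T\<in>Pow D. kapply C (pauli x z \<phi>) T = c * pauli x' z' (kapply C \<phi>) T)"

lemma clifford_intertwines:
  assumes C: "clifford (a + b) C" and xz: "x \<in> Pow D" "z \<in> Pow D"
  shows "\<exists>x' z'. intertwines (kernel C) x z x' z'"
proof -
  have Cc: "C \<in> carrier_mat (2 ^ (a + b)) (2 ^ (a + b))" "adj C * C = 1\<^sub>m (2 ^ (a + b))"
    using C by (auto simp: clifford_def is_unitary_def)
  obtain P p where P: "pauli_string (a + b) P" "acts_as_pauli P p x z" using pauli_string_exists[OF xz] .
  then obtain Q k where Q: "pauli_string (a + b) Q" "C * P * adj C = k \<cdot>\<^sub>m Q"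
    using C unfolding clifford_def by blast
  obtain q x' z' where q: "acts_as_pauli Q q x' z'" using pauli_string_acts[OF Q(1)] .
  have Pc: "P \<in> carrier_mat (2 ^ (a + b)) (2 ^ (a + b))" "p \<noteq> 0" and Qc: "Q \<in> carrier_mat (2 ^ (a + b)) (2 ^ (a + b))"
    using P(2) q by (auto simp: acts_as_pauli_def)
  have CP: "C * P \<in> carrier_mat (2 ^ (a + b)) (2 ^ (a + b))" using Cc(1) Pc(1) by (rule mult_carrier_mat)
  \<comment> \<open>Inserting the identity \<open>adj C * C\<close> turns the conjugation rule into
    a commutation rule.\<close>
  have "C * P = C * P * (adj C * C)" using right_mult_one_mat[OF CP] by (simp only: Cc(2))
  also have "\<dots> = C * P * adj C * C"
    using assoc_mult_mat[OF CP adj_carrier[OF Cc(1)] Cc(1)] by simp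
  also have "\<dots> = k \<cdot>\<^sub>m (Q * C)" using Q(2) Qc Cc(1) by (simp add: mult_smult_assoc_mat)
  finally have eq: "C * P = k \<cdot>\<^sub>m (Q * C)" .
  have QC: "Q * C \<in> carrier_mat (2 ^ (a + b)) (2 ^ (a + b))" using Qc Cc(1) by (rule mult_carrier_mat)
  have "kapply (kernel C) (pauli x z \<phi>) T = k * q / p * pauli x' z' (kapply (kernel C) \<phi>) T" if T: "T \<in> Pow D" for \<phi> T
  proof -
    have "p * kapply (kernel C) (pauli x z \<phi>) T = kapply (kernel C) (\<lambda>T. p * pauli x z \<phi> T) T"
      by (simp add: kapply_scale)
    also have "(kapply (kernel C) (\<lambda>T. p * pauli x z \<phi> T)) = kapply (kernel C) (kapply (kernel P) \<phi>)"
      using P(2) by (intro kapply_cong) (simp add: acts_as_pauli_def)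
    also have "kapply (kernel C) (kapply (kernel P) \<phi>) T = kapply (kernel (C * P)) \<phi> T"
      using kapply_mult[OF Cc(1) Pc(1) T] by simp
    also have "\<dots> = k * kapply (kernel (Q * C)) \<phi> T"
    proof -
      have "(k \<cdot>\<^sub>m (Q * C)) $$ (bindex (a + b) T, c) = k * (Q * C) $$ (bindex (a + b) T, c)" if "c < 2 ^ (a + b)" for c
        using QC T that bindex_less[of T "a + b"] by (intro index_smult_mat(1)) auto
      then show ?thesis
        unfolding eq kapply_kernel[OF T] sum_distrib_left by (intro sum.cong refl) (simp only: lessThan_iff mult.assoc)
    qed
    also have "\<dots> = k * (q * pauli x' z' (kapply (kernel C) \<phi>) T)"
      using kapply_mult[OF Qc Cc(1) T] q T by (simp add: acts_as_pauli_def)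
    finally show ?thesis using Pc(2) by (simp add: field_simps)
  qed
  then have "intertwines (kernel C) x z x' z'"
    unfolding intertwines_def using q unfolding acts_as_pauli_def by blast
  then show ?thesis by blast
qed

text \<open>A product of Paulis is sent to the product of their images, and the signs disappear in
  the constant. So images may be assembled from those of generators.\<close>

lemma intertwines_sd:
  assumes "intertwines C x z X Z" "intertwines C x' z' X' Z'"
    and xz: "x \<in> Pow D" "z \<in> Pow D" "x' \<in> Pow D" "z' \<in> Pow D"
  shows "intertwines C (sd x x') (sd z z') (sd X X') (sd Z Z')"
proof -
  have XZ: "X \<in> Pow D" "Z \<in> Pow D" "X' \<in> Pow D" "Z' \<in> Pow D" using assms by (auto simp: intertwines_def)
  obtain c where c: "\<And>\<phi> T. T \<in> Pow D \<Longrightarrow> kapply C (pauli x z \<phi>) T = c * pauli X Z (kapply C \<phi>) T"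
    using assms(1) unfolding intertwines_def by blast
  obtain c' where c': "\<And>\<phi> T. T \<in> Pow D \<Longrightarrow> kapply C (pauli x' z' \<phi>) T = c' * pauli X' Z' (kapply C \<phi>) T"
    using assms(2) unfolding intertwines_def by blast
  have fin: "finite A" if "A \<in> Pow D" for A using that finite_subset by blast
  have "kapply C (pauli (sd x x') (sd z z') \<phi>) T
      = sg (z' \<inter> x) * c * c' * sg (Z' \<inter> X) * pauli (sd X X') (sd Z Z') (kapply C \<phi>) T" if T: "T \<in> Pow D" for \<phi> T
  proof -
    have "pauli (sd x x') (sd z z') \<phi> = (\<lambda>T. sg (z' \<inter> x) * pauli x z (pauli x' z' \<phi>) T)"
      using xz fin by (simp add: pauli_pauli)
    then have "kapply C (pauli (sd x x') (sd z z') \<phi>) T = sg (z' \<inter> x) * (c * pauli X Z (kapply C (pauli x' z' \<phi>)) T)"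
      by (simp add: kapply_scale c[OF T])
    also have "pauli X Z (kapply C (pauli x' z' \<phi>)) T = pauli X Z (\<lambda>T. c' * pauli X' Z' (kapply C \<phi>) T) T"
    proof -
      have "sd T X \<in> Pow D" using T XZ sd_subset[of T D X] by simp
      then show ?thesis by (simp add: pauli_def[of X Z] c')
    qed
    also have "\<dots> = c' * (sg (Z' \<inter> X) * pauli (sd X X') (sd Z Z') (kapply C \<phi>) T)"
      using XZ fin by (simp add: pauli_scale pauli_pauli)
    finally show ?thesis by (simp only: mult.assoc)
  qed
  moreover have "sd X X' \<in> Pow D" "sd Z Z' \<in> Pow D"
    using XZ sd_subset[of X D X'] sd_subset[of Z D Z'] by auto
  ultimately show ?thesis unfolding intertwines_def by blast
qed

text \<open>Images supplied separately for every Pauli by \<open>clifford_intertwines\<close> would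
  not be known to depend additively on the key. Therefore they are chosen for the generators X_j and
  Z_j only and summed, which makes the pullback of a functional again a functional.\<close>

lemma clifford_key_map:
  assumes C: "clifford (a + b) C"
  shows "key_map (kernel C)"
proof -
  have "\<forall>j\<in>D. \<exists>x' z'. intertwines (kernel C) {j} {} x' z'" "\<forall>j\<in>D. \<exists>x' z'. intertwines (kernel C) {} {j} x' z'"
    using clifford_intertwines[OF C] by auto
  then obtain Xx Zx Xz Zz where gen: "\<And>j. j \<in> D \<Longrightarrow> intertwines (kernel C) {j} {} (Xx j) (Zx j)"
    "\<And>j. j \<in> D \<Longrightarrow> intertwines (kernel C) {} {j} (Xz j) (Zz j)"
    by metis
  \<comment> \<open>The coefficients of the pulled-back functional are its values on the images of
    the generators; \<open>du\<close> belongs to the X_j and \<open>dv\<close> to the Z_j.\<close>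
  define du where "du u v = {j\<in>D. keybit u v (Xx j) (Zx j)}" for u v
  define dv where "dv u v = {j\<in>D. keybit u v (Xz j) (Zz j)}" for u v
  \<comment> \<open>Couples the image of a key with the pullback identity, so that both pass through
    the same induction over generators.\<close>
  define rel where "rel x z X Z \<longleftrightarrow> intertwines (kernel C) x z X Z \<and>
     (\<forall>u\<in>Pow D. \<forall>v\<in>Pow D. keybit u v X Z \<longleftrightarrow> keybit (du u v) (dv u v) x z)" for x z X Z
  have fin: "finite u" if "u \<in> Pow D" for u using that finite_subset by blast
  have dfin: "finite (du u v)" "finite (dv u v)" for u v by (simp_all add: du_def dv_def)
  have rel_sd: "rel (sd x x') (sd z z') (sd X X') (sd Z Z')"
    if "rel x z X Z" "rel x' z' X' Z'" "x \<in> Pow D" "z \<in> Pow D" "x' \<in> Pow D" "z' \<in> Pow D" for x z X Z x' z' X' Z'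
    using that intertwines_sd unfolding rel_def by (simp add: keybit_sd fin dfin)
  have rel_gen: "rel {j} {} (Xx j) (Zx j)" "rel {} {j} (Xz j) (Zz j)" if "j \<in> D" for j
    using gen[OF that] that by (auto simp: rel_def keybit_simps du_def dv_def)
  have rel_empty: "rel {} {} {} {}"
    unfolding rel_def intertwines_def
    by (intro conjI exI[of _ 1]) (auto simp: keybit_def pauli_def)
  have insert_sd: "insert j A = sd {j} A" if "j \<notin> A" for j and A :: "nat set" using that by auto
  have relx: "\<exists>X Z. rel x {} X Z" if "x \<in> Pow D" for x
  proof -
    have "finite x" using fin that by blast
    then show ?thesis using that
    proof (induction x rule: finite_induct)
      case (insert j x)
      then obtain X Z where "rel x {} X Z" by auto
      then have "rel (sd {j} x) (sd {} {}) (sd (Xx j) X) (sd (Zx j) Z)"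
        using insert.prems by (intro rel_sd rel_gen) auto
      then show ?case using insert_sd[OF insert.hyps(2)] by auto
    qed (use rel_empty in blast)
  qed
  have relxz: "\<exists>X Z. rel x z X Z" if x: "x \<in> Pow D" and "z \<in> Pow D" for x z
  proof -
    have "finite z" using fin that by blast
    then show ?thesis using that(2)
    proof (induction z rule: finite_induct)
      case (insert j z)
      then obtain X Z where "rel x z X Z" by auto
      then have "rel (sd {} x) (sd {j} z) (sd (Xz j) X) (sd (Zz j) Z)"
        using insert.prems x by (intro rel_sd rel_gen) auto
      then show ?case using insert_sd[OF insert.hyps(2)] by auto
    qed (use relx[OF x] in blast)
  qed
  then obtain X Z where XZ: "\<And>x z. x \<in> Pow D \<Longrightarrow> z \<in> Pow D \<Longrightarrow> rel x z (X x z) (Z x z)" by metis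
  have duv: "du u v \<in> Pow D" "dv u v \<in> Pow D" for u v by (auto simp: du_def dv_def)
  show ?thesis
    unfolding key_map_def
  proof (rule exI[of _ X], rule exI[of _ Z], intro conjI ballI)
    fix u v assume "u \<in> Pow D" "v \<in> Pow D"
    then have "\<forall>x\<in>Pow D. \<forall>z\<in>Pow D. keybit u v (X x z) (Z x z) \<longleftrightarrow> keybit (du u v) (dv u v) x z"
      using XZ unfolding rel_def by blast
    then show "\<exists>u'\<in>Pow D. \<exists>v'\<in>Pow D. \<forall>x\<in>Pow D. \<forall>z\<in>Pow D. keybit u v (X x z) (Z x z) \<longleftrightarrow> keybit u' v' x z"
      by (intro bexI[OF _ duv(1)[of u v]] bexI[OF _ duv(2)[of u v]])
  next
    fix x z assume "x \<in> Pow D" "z \<in> Pow D"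
    then have i: "intertwines (kernel C) x z (X x z) (Z x z)" using XZ unfolding rel_def by blast
    show "X x z \<in> Pow D" "Z x z \<in> Pow D" using i unfolding intertwines_def by blast+
    show "\<exists>c. \<forall>\<phi>. \<forall>T\<in>Pow D. kapply (kernel C) (pauli x z \<phi>) T = c * pauli (X x z) (Z x z) (kapply (kernel C) \<phi>) T"
      using i unfolding intertwines_def by (elim conjE)
  qed
qed

end

section \<open>The protocol for a circuit\<close>

lemma sd_Un_Int: "X \<subseteq> A \<Longrightarrow> Y \<inter> A = {} \<Longrightarrow> sd (X \<union> Y) x \<inter> A = sd X (x \<inter> A)"
  by auto

context protocol
begin

lemma sum_Pow_D: "(\<Sum>T\<in>Pow D. f T) = (\<Sum>j<2 ^ a. \<Sum>k<2 ^ b. f (bset a j \<union> (+) a ` bset b k))"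
  unfolding sum_bset power_add sum_lessThan_mult by (intro sum.cong refl) (simp add: bset_pair)

lemma shift_bset: "(+) a ` bset b k \<in> Pow DB"
  using bset_subset[of b k] by auto

lemma shift_bset_eq_iff:
  assumes "k < 2 ^ b" "k' < 2 ^ b"
  shows "(+) a ` bset b k = (+) a ` bset b k' \<longleftrightarrow> k = k'"
proof -
  have "(+) a ` bset b k = (+) a ` bset b k' \<longleftrightarrow> bset b k = bset b k'"
    by (rule inj_image_eq_iff) simp
  then show ?thesis using assms by (metis bindex_bset)
qed

lemma bset_eq_iff: "i < 2 ^ n \<Longrightarrow> i' < 2 ^ n \<Longrightarrow> bset n i = bset n i' \<longleftrightarrow> i = i'"
  by (metis bindex_bset)

text \<open>Columns of a Pauli operator are orthonormal. This is the completeness of the final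
  correction on either side, with \<open>B\<close> enumerating the labels of that side.\<close>

lemma sum_pauli_local:
  fixes B :: "nat \<Rightarrow> nat set"
  assumes B: "bij_betw B {..<N} (Pow E)" and x: "x \<subseteq> E" and i: "i < N" "i' < N"
  shows "(\<Sum>j<N. cnj (if B i = sd (B j) x then sg (z \<inter> B j) else 0) * (if B i' = sd (B j) x then sg (z \<inter> B j) else 0))
     = (if i = i' then 1 else 0)"
proof -
  have Bi: "B i \<subseteq> E" "B i' \<subseteq> E" using B i by (auto simp: bij_betw_def)
  have "(\<Sum>j<N. cnj (if B i = sd (B j) x then sg (z \<inter> B j) else 0) * (if B i' = sd (B j) x then sg (z \<inter> B j) else 0))
     = (\<Sum>j<N. (\<lambda>T. if B i = sd x T then (if B i = B i' then 1 else 0) else 0) (B j))"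
    by (intro sum.cong refl) (auto simp: sd_commute)
  also have "\<dots> = (\<Sum>T\<in>Pow E. if B i = sd x T then (if B i = B i' then 1 else 0) else 0)"
    by (rule sum.reindex_bij_betw[OF B])
  also have "\<dots> = (\<Sum>T\<in>Pow E. if B i = T then (if B i = B i' then 1 else 0) else 0)"
    by (rule sum_sd_reindex[OF x, of "\<lambda>T. if B i = T then (if B i = B i' then 1 else 0) else 0"])
  also have "\<dots> = (if B i = B i' then 1 else 0)"
  proof (cases "finite E")
    case True
    then show ?thesis using Bi by simp
  next
    \<comment> \<open>Excluded, since \<open>Pow E\<close> is in bijection with a finite
      set.\<close>
    case False
    have "finite (Pow E)" using bij_betw_finite[OF B] by simp
    then show ?thesis using False by simp
  qed
  also have "B i = B i' \<longleftrightarrow> i = i'" using B i by (auto simp: bij_betw_def inj_on_def)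
  finally show ?thesis .
qed

text \<open>The key is a tensor product of Paulis on the two sides, so once both outcomes are known
  each party removes its own half. The data on \<open>DB\<close> travels to Bob in the
  exchange.\<close>

lemma reach_implements:
  assumes U: "is_unitary (2 ^ (a + b)) U"
    and re: "reach HA HB m (\<lambda>\<alpha> \<beta> i j T S. pauli (Kx \<alpha> \<beta>) (Kz \<alpha> \<beta>) (\<Phi> (i \<union> j)) T * J \<alpha> \<beta> S)"
    and K: "\<And>\<alpha> \<beta>. \<alpha> \<in> HA \<Longrightarrow> \<beta> \<in> HB \<Longrightarrow> Kx \<alpha> \<beta> \<subseteq> D \<and> Kz \<alpha> \<beta> \<subseteq> D"
    and \<Phi>: "\<And>s T. s \<in> Pow D \<Longrightarrow> T \<in> Pow D \<Longrightarrow> \<Phi> s T = kernel U T s"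
  shows "nlqc_implements a b m U"
proof -
  obtain LL v \<tau> where fin: "finite HA" "finite HB" "finite LL" and card: "card LL = 2 ^ m"
    and v: "alice_complete HA LL v" and \<tau>: "bob_complete HB LL \<tau>"
    and G: "contracts HA HB LL v \<tau> (\<lambda>\<alpha> \<beta> i j T S. pauli (Kx \<alpha> \<beta>) (Kz \<alpha> \<beta>) (\<Phi> (i \<union> j)) T * J \<alpha> \<beta> S)"
    using re unfolding reach_def by (elim conjE exE)
  note v = v[unfolded alice_complete_def, rule_format] and \<tau> = \<tau>[unfolded bob_complete_def, rule_format]
  \<comment> \<open>Alice also measures the rails in the basis of labels, and the result is part of
    her outcome; the rail amplitude then becomes a scalar of the branch.\<close>
  obtain f where f: "bij_betw f {..<card (HA \<times> Pow R)} (HA \<times> Pow R)"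
    using ex_bij_betw_nat_finite[of "HA \<times> Pow R"] fin by (auto simp: atLeast0LessThan)
  obtain e where e: "bij_betw e {..<card HB} HB"
    using ex_bij_betw_nat_finite[OF fin(2)] by (auto simp: atLeast0LessThan)
  obtain g where g: "bij_betw g {..<2 ^ m :: nat} LL"
    using ex_bij_betw_nat_finite[OF fin(3)] card by (auto simp: atLeast0LessThan)
  have fI: "fst (f q) \<in> HA" "snd (f q) \<in> Pow R" if "q < card (HA \<times> Pow R)" for q
    using bij_betwE[OF f] that by (auto simp: mem_Times_iff)
  have eI: "e q \<in> HB" if "q < card HB" for q using bij_betwE[OF e] that by auto
  have gI: "g l \<in> LL" if "l < 2 ^ m" for l using bij_betwE[OF g] that by auto
  have geq: "g l = g l' \<longleftrightarrow> l = l'" if "l < 2 ^ m" "l' < 2 ^ m" for l l'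
    using g that by (auto simp: bij_betw_def inj_on_def)
  let ?A = "bset a" and ?B = "\<lambda>k. (+) a ` bset b k"
  have A: "?A i \<in> Pow DA" for i using bset_subset by blast
  note B = shift_bset
  have bijB: "bij_betw ?B {..<2 ^ b} (Pow DB)"
  proof -
    have "bij_betw ((`) ((+) a)) (Pow {..<b}) (Pow ((+) a ` {..<b}))" by (intro bij_betw_Pow) (simp add: bij_betw_def)
    moreover have "(+) a ` {..<b} = DB" using image_add_atLeastLessThan[of a 0 b] by (simp add: atLeast0LessThan add.commute)
    ultimately show ?thesis using bij_betw_trans[OF bij_betw_bset[of b]] by (simp add: comp_def)
  qed
  have D: "DA \<union> DB = D" "DA \<inter> DB = {}" by auto
  define kx where "kx q \<beta> = Kx (fst (f q)) (e \<beta>)" for q \<beta>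
  define kz where "kz q \<beta> = Kz (fst (f q)) (e \<beta>)" for q \<beta>
  have k: "kx q \<beta> \<subseteq> D" "kz q \<beta> \<subseteq> D" if "q < card (HA \<times> Pow R)" "\<beta> < card HB" for q \<beta>
    using K[OF fI(1)[OF that(1)] eI[OF that(2)]] by (auto simp: kx_def kz_def)
  show ?thesis
  proof (rule nlqc_from_kraus[where nQ = "card (HA \<times> Pow R)" and nB = "card HB"
      and v = "\<lambda>q j k i l. v (fst (f q)) (?A i) (g l) (?A j \<union> ?B k) (snd (f q))"
      and t = "\<lambda>\<beta> l h. \<tau> (e \<beta>) (g l) (?B h)"
      and wA = "\<lambda>q \<beta> j i. if ?A i = sd (?A j) (kx q \<beta> \<inter> DA) then sg (kz q \<beta> \<inter> DA \<inter> ?A j) else 0"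
      and wB = "\<lambda>q \<beta> j i. if ?B i = sd (?B j) (kx q \<beta> \<inter> DB) then sg (kz q \<beta> \<inter> DB \<inter> ?B j) else 0"])
    show "is_unitary (2 ^ a * 2 ^ b) U" using U by (simp add: power_add)
  next
    fix i l i' l' :: nat assume *: "i < 2 ^ a" "l < 2 ^ m" "i' < 2 ^ a" "l' < 2 ^ m"
    have "(\<Sum>q<card (HA \<times> Pow R). \<Sum>j<2 ^ a. \<Sum>k<2 ^ b.
        cnj (v (fst (f q)) (?A i) (g l) (?A j \<union> ?B k) (snd (f q))) * v (fst (f q)) (?A i') (g l') (?A j \<union> ?B k) (snd (f q)))
      = (\<Sum>q<card (HA \<times> Pow R). (\<lambda>p. \<Sum>T\<in>Pow D. cnj (v (fst p) (?A i) (g l) T (snd p)) * v (fst p) (?A i') (g l') T (snd p)) (f q))"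
      by (simp only: sum_Pow_D)
    also have "\<dots> = (\<Sum>p\<in>HA \<times> Pow R. \<Sum>T\<in>Pow D. cnj (v (fst p) (?A i) (g l) T (snd p)) * v (fst p) (?A i') (g l') T (snd p))"
      by (rule sum.reindex_bij_betw[OF f])
    also have "\<dots> = (\<Sum>\<alpha>\<in>HA. \<Sum>S\<in>Pow R. \<Sum>T\<in>Pow D. cnj (v \<alpha> (?A i) (g l) T S) * v \<alpha> (?A i') (g l') T S)"
      by (simp only: sum.cartesian_product[of "\<lambda>\<alpha> S. \<Sum>T\<in>Pow D. cnj (v \<alpha> (?A i) (g l) T S) * v \<alpha> (?A i') (g l') T S"]
          split_def)
    also have "\<dots> = (\<Sum>\<alpha>\<in>HA. ip (v \<alpha> (?A i) (g l)) (v \<alpha> (?A i') (g l')))"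
      unfolding ip_def by (rule sum.cong[OF refl], rule sum.swap)
    also have "\<dots> = (if i = i' then if l = l' then 1 else 0 else 0)"
      using v[OF A gI[OF *(2)] A gI[OF *(4)], of i i'] * by (simp add: bset_eq_iff geq)
    finally show "(\<Sum>q<card (HA \<times> Pow R). \<Sum>j<2 ^ a. \<Sum>k<2 ^ b.
        cnj (v (fst (f q)) (?A i) (g l) (?A j \<union> ?B k) (snd (f q))) * v (fst (f q)) (?A i') (g l') (?A j \<union> ?B k) (snd (f q)))
      = (if i = i' then if l = l' then 1 else 0 else 0)" .
  next
    fix l h l' h' :: nat assume *: "l < 2 ^ m" "h < 2 ^ b" "l' < 2 ^ m" "h' < 2 ^ b"
    have "(\<Sum>\<beta><card HB. cnj (\<tau> (e \<beta>) (g l) (?B h)) * \<tau> (e \<beta>) (g l') (?B h'))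
      = (\<Sum>\<beta>\<in>HB. cnj (\<tau> \<beta> (g l) (?B h)) * \<tau> \<beta> (g l') (?B h'))"
      by (rule sum.reindex_bij_betw[OF e])
    then show "(\<Sum>\<beta><card HB. cnj (\<tau> (e \<beta>) (g l) (?B h)) * \<tau> (e \<beta>) (g l') (?B h'))
        = (if l = l' then if h = h' then 1 else 0 else 0)"
      using \<tau>[OF gI[OF *(1)] B[of h] gI[OF *(3)] B[of h']] * by (simp add: shift_bset_eq_iff geq)
  next
    fix q \<beta> i i' assume "i < (2::nat) ^ a" "i' < (2::nat) ^ a"
    then show "(\<Sum>j<2 ^ a. cnj (if ?A i = sd (?A j) (kx q \<beta> \<inter> DA) then sg (kz q \<beta> \<inter> DA \<inter> ?A j) else 0) *
        (if ?A i' = sd (?A j) (kx q \<beta> \<inter> DA) then sg (kz q \<beta> \<inter> DA \<inter> ?A j) else 0)) = (if i = i' then 1 else 0)"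
      by (intro sum_pauli_local[OF bij_betw_bset]) auto
  next
    fix q \<beta> i i' assume "i < (2::nat) ^ b" "i' < (2::nat) ^ b"
    then show "(\<Sum>j<2 ^ b. cnj (if ?B i = sd (?B j) (kx q \<beta> \<inter> DB) then sg (kz q \<beta> \<inter> DB \<inter> ?B j) else 0) *
        (if ?B i' = sd (?B j) (kx q \<beta> \<inter> DB) then sg (kz q \<beta> \<inter> DB \<inter> ?B j) else 0)) = (if i = i' then 1 else 0)"
      by (intro sum_pauli_local[OF bijB]) auto
  next
    fix q \<beta> assume q: "q < card (HA \<times> Pow R)" and \<beta>: "\<beta> < card HB"
    let ?\<alpha> = "fst (f q)" and ?S = "snd (f q)" and ?x = "kx q \<beta>" and ?z = "kz q \<beta>"
    from bspec[OF bspec[OF G[unfolded contracts_def] fI(1)[OF q]] eI[OF \<beta>]]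
    obtain c where "\<forall>i\<in>Pow DA. \<forall>j\<in>Pow DB. \<forall>T\<in>Pow D. \<forall>S\<in>Pow R.
          (\<Sum>l\<in>LL. \<tau> (e \<beta>) l j * v ?\<alpha> i l T S) = c * (pauli ?x ?z (\<Phi> (i \<union> j)) T * J ?\<alpha> (e \<beta>) S)"
      unfolding kx_def kz_def by (elim exE)
    note c = this[rule_format]
    note kk = k[OF q \<beta>]
    have finx: "finite ?x" "finite ?z" using kk finite_subset by blast+
    \<comment> \<open>The sign arises because Z^z X^x squares to the identity only up to
      sign.\<close>
    define c' where "c' = c * J ?\<alpha> (e \<beta>) ?S * sg (?z \<inter> ?x)"
    have "(\<Sum>j'<2 ^ a. \<Sum>k'<2 ^ b. (if ?A j' = sd (?A j) (?x \<inter> DA) then sg (?z \<inter> DA \<inter> ?A j) else 0) *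
        (if ?B k' = sd (?B k) (?x \<inter> DB) then sg (?z \<inter> DB \<inter> ?B k) else 0) *
        (\<Sum>l<2 ^ m. v ?\<alpha> (?A i) (g l) (?A j' \<union> ?B k') ?S * \<tau> (e \<beta>) (g l) (?B h)))
      = c' * U $$ (j * 2 ^ b + k, i * 2 ^ b + h)"
      if *: "j < 2 ^ a" "k < 2 ^ b" "i < 2 ^ a" "h < 2 ^ b" for j k i h
    proof -
      let ?T = "?A j \<union> ?B k" and ?s = "?A i \<union> ?B h"
      have T: "?T \<in> Pow D" "?s \<in> Pow D" using A[of j] B[of k] A[of i] B[of h] by fastforce+
      have sdT: "sd ?T ?x \<in> Pow D" using T kk sd_subset[of ?T D ?x] by simp
      have sums: "(\<Sum>l<2 ^ m. v ?\<alpha> (?A i) (g l) T ?S * \<tau> (e \<beta>) (g l) (?B h))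
          = c * (pauli ?x ?z (\<Phi> ?s) T * J ?\<alpha> (e \<beta>) ?S)" if "T \<in> Pow D" for T
      proof -
        have "(\<Sum>l<2 ^ m. v ?\<alpha> (?A i) (g l) T ?S * \<tau> (e \<beta>) (g l) (?B h))
            = (\<Sum>l\<in>LL. \<tau> (e \<beta>) l (?B h) * v ?\<alpha> (?A i) l T ?S)"
          using sum.reindex_bij_betw[OF g, of "\<lambda>l. \<tau> (e \<beta>) l (?B h) * v ?\<alpha> (?A i) l T ?S"]
          by (simp add: mult.commute)
        then show ?thesis using c[OF A B that fI(2)[OF q]] by simp
      qed
      have disj: "T = sd ?T ?x \<longleftrightarrow> T \<inter> DA = sd (?A j) (?x \<inter> DA) \<and> T \<inter> DB = sd (?B k) (?x \<inter> DB)" if "T \<in> Pow D" for T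
      proof -
        have 1: "sd ?T ?x \<inter> DA = sd (?A j) (?x \<inter> DA)" "sd ?T ?x \<inter> DB = sd (?B k) (?x \<inter> DB)"
        proof -
          have "?B k \<inter> DA = {}" "?A j \<inter> DB = {}" using A[of j] B[of k] by fastforce+
          then show "sd ?T ?x \<inter> DA = sd (?A j) (?x \<inter> DA)" "sd ?T ?x \<inter> DB = sd (?B k) (?x \<inter> DB)"
            using A[of j] B[of k] sd_Un_Int[of "?A j" DA "?B k" ?x] sd_Un_Int[of "?B k" DB "?A j" ?x]
            by (simp_all add: Un_commute)
        qed
        have "Y = (Y \<inter> DA) \<union> (Y \<inter> DB)" if "Y \<in> Pow D" for Y using that by auto
        then have "T = sd ?T ?x \<longleftrightarrow> T \<inter> DA = sd ?T ?x \<inter> DA \<and> T \<inter> DB = sd ?T ?x \<inter> DB"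
          using that sdT by metis
        then show ?thesis by (simp only: 1)
      qed
      have sgT: "sg (?z \<inter> DA \<inter> ?A j) * sg (?z \<inter> DB \<inter> ?B k) = sg (?z \<inter> ?T)"
      proof -
        have "?z \<inter> ?T = sd (?z \<inter> DA \<inter> ?A j) (?z \<inter> DB \<inter> ?B k)" using A[of j] B[of k] by fastforce
        then show ?thesis using finx by (simp add: sg_sd)
      qed
      have "(\<Sum>j'<2 ^ a. \<Sum>k'<2 ^ b. (if ?A j' = sd (?A j) (?x \<inter> DA) then sg (?z \<inter> DA \<inter> ?A j) else 0) *
        (if ?B k' = sd (?B k) (?x \<inter> DB) then sg (?z \<inter> DB \<inter> ?B k) else 0) *
        (\<Sum>l<2 ^ m. v ?\<alpha> (?A i) (g l) (?A j' \<union> ?B k') ?S * \<tau> (e \<beta>) (g l) (?B h)))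
        = (\<Sum>j'<2 ^ a. \<Sum>k'<2 ^ b. if ?A j' \<union> ?B k' = sd ?T ?x then
            sg (?z \<inter> ?T) * (c * (pauli ?x ?z (\<Phi> ?s) (?A j' \<union> ?B k') * J ?\<alpha> (e \<beta>) ?S)) else 0)"
      proof (intro sum.cong refl)
        fix j' k'
        have "?A j' \<union> ?B k' \<in> Pow D" using A[of j'] B[of k'] by fastforce
        moreover have "(?A j' \<union> ?B k') \<inter> DA = ?A j'" "(?A j' \<union> ?B k') \<inter> DB = ?B k'" using A[of j'] B[of k'] by fastforce+
        ultimately show "(if ?A j' = sd (?A j) (?x \<inter> DA) then sg (?z \<inter> DA \<inter> ?A j) else 0) *
          (if ?B k' = sd (?B k) (?x \<inter> DB) then sg (?z \<inter> DB \<inter> ?B k) else 0) *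
          (\<Sum>l<2 ^ m. v ?\<alpha> (?A i) (g l) (?A j' \<union> ?B k') ?S * \<tau> (e \<beta>) (g l) (?B h))
          = (if ?A j' \<union> ?B k' = sd ?T ?x then
            sg (?z \<inter> ?T) * (c * (pauli ?x ?z (\<Phi> ?s) (?A j' \<union> ?B k') * J ?\<alpha> (e \<beta>) ?S)) else 0)"
          using disj[of "?A j' \<union> ?B k'"] by (simp add: sums flip: sgT)
      qed
      also have "\<dots> = (\<Sum>T\<in>Pow D. if T = sd ?T ?x then
            sg (?z \<inter> ?T) * (c * (pauli ?x ?z (\<Phi> ?s) T * J ?\<alpha> (e \<beta>) ?S)) else 0)"
        by (simp only: sum_Pow_D)
      also have "\<dots> = sg (?z \<inter> ?T) * (c * (pauli ?x ?z (\<Phi> ?s) (sd ?T ?x) * J ?\<alpha> (e \<beta>) ?S))"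
        by (subst sum.delta) (use sdT in auto)
      also have "\<dots> = c * J ?\<alpha> (e \<beta>) ?S * pauli ?x ?z (pauli ?x ?z (\<Phi> ?s)) ?T"
        by (simp add: pauli_def)
      also have "\<dots> = c' * \<Phi> ?s ?T"
        using finx by (simp add: pauli_pauli c'_def) (simp add: pauli_def)
      also have "\<Phi> ?s ?T = U $$ (j * 2 ^ b + k, i * 2 ^ b + h)"
      proof -
        have "j * 2 ^ b + k < 2 ^ (a + b)" "i * 2 ^ b + h < 2 ^ (a + b)"
          using * by (simp_all add: power_add pair_index_less)
        then show ?thesis using \<Phi>[OF T(2,1)] *
          by (simp add: kernel_def flip: bset_pair)
      qed
      finally show ?thesis .
    qed
    then show "\<exists>c. \<forall>j<2 ^ a. \<forall>k<2 ^ b. \<forall>i<2 ^ a. \<forall>h<2 ^ b.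
      (\<Sum>j'<2 ^ a. \<Sum>k'<2 ^ b. (if ?A j' = sd (?A j) (?x \<inter> DA) then sg (?z \<inter> DA \<inter> ?A j) else 0) *
        (if ?B k' = sd (?B k) (?x \<inter> DB) then sg (?z \<inter> DB \<inter> ?B k) else 0) *
        (\<Sum>l<2 ^ m. v ?\<alpha> (?A i) (g l) (?A j' \<union> ?B k') ?S * \<tau> (e \<beta>) (g l) (?B h)))
      = c * U $$ (j * 2 ^ b + k, i * 2 ^ b + h)" by blast
  qed
qed

lemma keynets_mono:
  assumes "keynets HA HB h w L Kx Kz" "L \<le> L'"
  shows "keynets HA HB h w L' Kx Kz"
  unfolding keynets_def
proof (intro ballI)
  fix u v assume "u \<in> Pow D" "v \<in> Pow D"
  from bspec[OF bspec[OF assms(1)[unfolded keynets_def] this(1)] this(2)]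
  obtain net where "net_ok h w net" "length net \<le> L"
    "\<forall>\<alpha>\<in>HA. \<forall>\<beta>\<in>HB. computes net \<alpha> \<beta> (keybit u v (Kx \<alpha> \<beta>) (Kz \<alpha> \<beta>))"
    by (elim exE conjE)
  then show "\<exists>net. net_ok h w net \<and> length net \<le> L' \<and>
     (\<forall>\<alpha>\<in>HA. \<forall>\<beta>\<in>HB. computes net \<alpha> \<beta> (keybit u v (Kx \<alpha> \<beta>) (Kz \<alpha> \<beta>)))"
    using assms(2) by (intro exI[of _ net]) simp
qed

lemma ct_circuit_carrier:
  assumes "\<And>i. i \<le> k \<Longrightarrow> clifford n (Cs i)"
  shows "ct_circuit n Cs Ss k \<in> carrier_mat (2 ^ n) (2 ^ n)"
  using assms
proof (induction k)
  case 0
  then show ?case by (simp add: clifford_def is_unitary_def)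
next
  case (Suc k)
  have "Cs (Suc k) \<in> carrier_mat (2 ^ n) (2 ^ n)" using Suc.prems by (simp add: clifford_def is_unitary_def)
  moreover have "ct_circuit n Cs Ss k \<in> carrier_mat (2 ^ n) (2 ^ n)" using Suc by simp
  ultimately show ?case unfolding ct_circuit.simps by (intro mult_carrier_mat[of _ "2 ^ n" "2 ^ n"] T_layer_carrier)
qed

text \<open>\<open>W\<close> is chosen once to hold the networks after all \<open>d\<close> layers;
  after \<open>k\<close> layers they occupy only the first \<open>2 * 8 ^ k\<close> rails. Every
  layer costs at most \<open>(a + b) * (4 * W)\<close> times the current network length, hence the
  geometric sum.\<close>

lemma circuit_stage:
  assumes cl: "\<And>i. i \<le> d \<Longrightarrow> clifford (a + b) (Cs i)" and Ss: "\<And>i. i < d \<Longrightarrow> Ss i \<subseteq> D"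
    and W: "W = 2 * 8 ^ d"
  shows "k \<le> d \<Longrightarrow> \<exists>HA HB h m \<Phi> Kx Kz. stage HA HB h m \<Phi> Kx Kz \<and>
    keynets HA HB h (2 * 8 ^ k) ((11 * (a + b) + 1) ^ k) Kx Kz \<and>
    (\<forall>s\<in>Pow D. \<forall>T\<in>Pow D. \<Phi> s T = kernel (ct_circuit (a + b) Cs Ss k) T s) \<and>
    m \<le> b + (a + b) * (4 * W) * (\<Sum>i<k. (11 * (a + b) + 1) ^ i)"
proof (induction k)
  case 0
  obtain HA HB Kx Kz where st: "stage HA HB 1 b (\<lambda>s T. if T = s then 1 else 0) Kx Kz" "keynets HA HB 1 2 1 Kx Kz"
    by (rule stage_init)
  have cl0: "clifford (a + b) (Cs 0)" using cl by simp
  then have "is_unitary (2 ^ (a + b)) (Cs 0)" by (simp add: clifford_def)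
  from stage_clifford[OF st kernel_isometry[OF this] clifford_key_map[OF cl0]]
  obtain Kx' Kz' where st': "stage HA HB 1 b (\<lambda>s. kapply (kernel (Cs 0)) (\<lambda>T. if T = s then 1 else 0)) Kx' Kz'"
    "keynets HA HB 1 2 1 Kx' Kz'" by blast
  have "kapply (kernel (Cs 0)) (\<lambda>T. if T = s then 1 else 0) T = kernel (Cs 0) T s" if "s \<in> Pow D" for s T
    unfolding kapply_def using that by (simp add: if_distrib cong: if_cong)
  then show ?case using st'
    by (intro exI[of _ HA] exI[of _ HB] exI[of _ 1] exI[of _ b] exI[of _ "\<lambda>s. kapply (kernel (Cs 0)) (\<lambda>T. if T = s then 1 else 0)"])
       auto
next
  case (Suc k)
  let ?n = "a + b" and ?L = "(11 * (a + b) + 1) ^ k"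
  obtain HA HB h m \<Phi> Kx Kz where IH: "stage HA HB h m \<Phi> Kx Kz" "keynets HA HB h (2 * 8 ^ k) ?L Kx Kz"
    "\<forall>s\<in>Pow D. \<forall>T\<in>Pow D. \<Phi> s T = kernel (ct_circuit (a + b) Cs Ss k) T s"
    "m \<le> b + ?n * (4 * W) * (\<Sum>i<k. (11 * ?n + 1) ^ i)"
    using Suc by auto
  have Q: "Ss k \<subseteq> D" using Ss Suc.prems by simp
  have cardQ: "card (Ss k) \<le> ?n" using card_mono[OF _ Q] by simp
  have "(8::nat) ^ Suc k \<le> 8 ^ d" using Suc.prems by (intro power_increasing) auto
  then have w: "8 * (2 * 8 ^ k) \<le> W" by (simp add: W)
  obtain HA' HB' h' m' Kx' Kz' where st: "stage HA' HB' h' m' (\<lambda>s. tgates (Ss k) (\<Phi> s)) Kx' Kz'"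
    "keynets HA' HB' h' (8 * (2 * 8 ^ k)) (?L + card (Ss k) * (8 * ?L + 3)) Kx' Kz'" "m' \<le> m + card (Ss k) * (4 * W * ?L)"
    by (rule stage_tlayer[OF IH(1,2) _ w Q]) auto
  have clk: "clifford (a + b) (Cs (Suc k))" using cl Suc.prems by simp
  then have un: "is_unitary (2 ^ (a + b)) (Cs (Suc k))" by (simp add: clifford_def)
  from stage_clifford[OF st(1,2) kernel_isometry[OF this] clifford_key_map[OF clk]]
  obtain Kx'' Kz'' where st': "stage HA' HB' h' m' (\<lambda>s. kapply (kernel (Cs (Suc k))) (tgates (Ss k) (\<Phi> s))) Kx'' Kz''"
    "keynets HA' HB' h' (8 * (2 * 8 ^ k)) (?L + card (Ss k) * (8 * ?L + 3)) Kx'' Kz''" by blast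
  \<comment> \<open>As L is at least 1, the 3 is absorbed and 8 L + 3 is at most 11 L; this is the
    origin of 11 n + 1.\<close>
  have "1 \<le> ?L" by simp
  then have "8 * ?L + 3 \<le> 11 * ?L" by linarith
  then have "card (Ss k) * (8 * ?L + 3) \<le> ?n * (11 * ?L)" using cardQ by (rule mult_le_mono[rotated])
  moreover have "(11 * n + 1) * l = l + n * (11 * l)" for n l :: nat by (simp add: algebra_simps)
  ultimately have "?L + card (Ss k) * (8 * ?L + 3) \<le> (11 * ?n + 1) ^ Suc k"
    unfolding power_Suc by (simp only: add_le_cancel_left)
  from keynets_mono[OF st'(2) this]
  have kn: "keynets HA' HB' h' (2 * 8 ^ Suc k) ((11 * ?n + 1) ^ Suc k) Kx'' Kz''" by (simp add: mult_ac)
  have cW: "card (Ss k) * (4 * W * ?L) \<le> ?n * (4 * W * ?L)" using cardQ by (rule mult_le_mono1)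
  have m': "m' \<le> b + ?n * (4 * W) * (\<Sum>i<Suc k. (11 * ?n + 1) ^ i)"
  proof -
    have "m' \<le> m + ?n * (4 * W * ?L)" using st(3) cW by (meson add_left_mono order_trans)
    also have "\<dots> \<le> b + ?n * (4 * W) * (\<Sum>i<k. (11 * ?n + 1) ^ i) + ?n * (4 * W * ?L)"
      using IH(4) by (rule add_right_mono)
    also have "\<dots> = b + ?n * (4 * W) * (\<Sum>i<Suc k. (11 * ?n + 1) ^ i)"
      by (simp only: sum.lessThan_Suc distrib_left mult.assoc add.assoc)
    finally show ?thesis .
  qed
  have ker: "kapply (kernel (Cs (Suc k))) (tgates (Ss k) (\<Phi> s)) T = kernel (ct_circuit (a + b) Cs Ss (Suc k)) T s"
    if s: "s \<in> Pow D" and T: "T \<in> Pow D" for s T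
  proof -
    let ?C = "Cs (Suc k)" and ?T = "T_layer (a + b) (Ss k)" and ?U = "ct_circuit (a + b) Cs Ss k"
    have C: "?C \<in> carrier_mat (2 ^ (a + b)) (2 ^ (a + b))" using un by (simp add: is_unitary_def)
    note TL = T_layer_carrier[of "a + b" "Ss k"]
    have Uc: "?U \<in> carrier_mat (2 ^ (a + b)) (2 ^ (a + b))" using cl Suc.prems by (intro ct_circuit_carrier) auto
    have "kapply (kernel ?C) (tgates (Ss k) (\<Phi> s)) T = kapply (kernel ?C) (kapply (kernel ?T) (\<Phi> s)) T"
      by (rule fun_cong[OF kapply_cong]) (simp add: kapply_T_layer)
    also have "\<dots> = kapply (kernel (?C * ?T)) (\<Phi> s) T" by (rule kapply_mult[OF C TL T, symmetric])
    also have "kapply (kernel (?C * ?T)) (\<Phi> s) = kapply (kernel (?C * ?T)) (\<lambda>T. kernel ?U T s)"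
      using IH(3) s by (intro kapply_cong) auto
    also have "\<dots> T = kernel (?C * ?T * ?U) T s"
      by (rule kernel_mult[OF mult_carrier_mat[OF C TL] Uc T s, symmetric])
    finally show ?thesis by simp
  qed
  show ?case
    by (rule exI[of _ HA'], rule exI[of _ HB'], rule exI[of _ h'], rule exI[of _ m'],
        rule exI[of _ "\<lambda>s. kapply (kernel (Cs (Suc k))) (tgates (Ss k) (\<Phi> s))"], rule exI[of _ Kx''], rule exI[of _ Kz''])
       (intro conjI st'(1) kn m' ballI ker)
qed

end

text \<open>For positive \<open>n\<close>, 12 n dominates both the ratio 11 n + 1 and the factor n +
  1 that the induction step produces.\<close>

lemma geometric_bound:
  fixes n k :: nat
  assumes "1 \<le> n"
  shows "n * (\<Sum>i<k. (11 * n + 1) ^ i) \<le> (12 * n) ^ k"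
proof (induction k)
  case (Suc k)
  have "n * (\<Sum>i<Suc k. (11 * n + 1) ^ i) = n * (\<Sum>i<k. (11 * n + 1) ^ i) + n * (11 * n + 1) ^ k"
    by (simp add: distrib_left)
  also have "\<dots> \<le> (12 * n) ^ k + n * (12 * n) ^ k"
    using Suc assms by (intro add_mono mult_le_mono2 power_mono) auto
  also have "\<dots> = (1 + n) * (12 * n) ^ k" by (simp add: distrib_right)
  also have "\<dots> \<le> (12 * n) * (12 * n) ^ k" using assms by (intro mult_le_mono1) simp
  finally show ?case by simp
qed simp

theorem mainTheorem1:
  shows "\<exists>K>0. \<exists>C>0. \<forall>a b d (U :: complex mat).
            is_unitary (2^(a+b)) U \<longrightarrow> 1 \<le> d \<longrightarrow> has_CT_decomposition (a+b) d U \<longrightarrow>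
              (\<exists>m. nlqc_implements a b m U) \<and>
              real (E_nlqc a b U) \<le> C * (K * real (a+b)) ^ d"
proof -
  \<comment> \<open>96 is 8 from the growth of the rails per layer times 12 from
    \<open>geometric_bound\<close>. Of the 9, 8 comes from 4 W = 8 * 8^d, and 1 pays for the initial
    teleportation.\<close>
  have "(\<exists>m. nlqc_implements a b m U) \<and> real (E_nlqc a b U) \<le> 9 * (96 * real (a + b)) ^ d"
    if U: "is_unitary (2 ^ (a + b)) U" and d: "1 \<le> d" and ct: "has_CT_decomposition (a + b) d U" for a b d U
  proof -
    let ?n = "a + b"
    obtain Cs Ss where cl: "\<And>i. i \<le> d \<Longrightarrow> clifford ?n (Cs i)" and Ss: "\<And>i. i < d \<Longrightarrow> Ss i \<subseteq> {..<?n}"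
      and UC: "U = ct_circuit ?n Cs Ss d"
      using ct unfolding has_CT_decomposition_def by blast
    define W :: nat where "W = 2 * 8 ^ d"
    interpret protocol a b W .
    obtain HA HB h m \<Phi> Kx Kz where st: "stage HA HB h m \<Phi> Kx Kz"
      and \<Phi>: "\<forall>s\<in>Pow D. \<forall>T\<in>Pow D. \<Phi> s T = kernel (ct_circuit (a + b) Cs Ss d) T s"
      and m: "m \<le> b + ?n * (4 * W) * (\<Sum>i<d. (11 * ?n + 1) ^ i)"
    proof -
      have "\<exists>HA HB h m \<Phi> Kx Kz. stage HA HB h m \<Phi> Kx Kz \<and>
        keynets HA HB h (2 * 8 ^ d) ((11 * ?n + 1) ^ d) Kx Kz \<and>
        (\<forall>s\<in>Pow D. \<forall>T\<in>Pow D. \<Phi> s T = kernel (ct_circuit ?n Cs Ss d) T s) \<and>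
        m \<le> b + ?n * (4 * W) * (\<Sum>i<d. (11 * ?n + 1) ^ i)"
        by (rule circuit_stage[OF _ _ W_def order_refl]) (use cl Ss in auto)
      then show thesis using that by (elim exE conjE)
    qed
    from st obtain J where re: "reach HA HB m (\<lambda>\<alpha> \<beta> i j T S. pauli (Kx \<alpha> \<beta>) (Kz \<alpha> \<beta>) (\<Phi> (i \<union> j)) T * J \<alpha> \<beta> S)"
      and K: "\<forall>\<alpha>\<in>HA. \<forall>\<beta>\<in>HB. Kx \<alpha> \<beta> \<subseteq> D \<and> Kz \<alpha> \<beta> \<subseteq> D"
      unfolding stage_def by (elim exE conjE)
    have impl: "nlqc_implements a b m U"
      by (rule reach_implements[OF U re]) (use K \<Phi> UC in auto)
    then have "E_nlqc a b U \<le> m" unfolding E_nlqc_def by (rule Least_le)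
    also have "m \<le> 9 * (96 * ?n) ^ d"
    proof (cases "?n = 0")
      \<comment> \<open>Without qubits the bound on \<open>m\<close> is 0.\<close>
      case True
      then show ?thesis using m by simp
    next
      case False
      have "?n * (4 * W) * (\<Sum>i<d. (11 * ?n + 1) ^ i) = 8 * 8 ^ d * (?n * (\<Sum>i<d. (11 * ?n + 1) ^ i))"
        by (simp add: W_def)
      also have "\<dots> \<le> 8 * 8 ^ d * (12 * ?n) ^ d"
        using False by (intro mult_le_mono2 geometric_bound) linarith
      also have "\<dots> = 8 * (96 * ?n) ^ d" by (simp flip: power_mult_distrib)
      finally have "m \<le> b + 8 * (96 * ?n) ^ d" using m by (meson add_left_mono order_trans)
      \<comment> \<open>Here \<open>d\<close> must be at least 1: for \<open>d\<close> = 0 the right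
        side would be 1, while the initial teleportation still takes \<open>b\<close> pairs.\<close>
      moreover have "b \<le> (96 * ?n) ^ d"
      proof -
        have "b \<le> 96 * ?n" by simp
        also have "\<dots> \<le> (96 * ?n) ^ d" using d False by (intro self_le_power) auto
        finally show ?thesis .
      qed
      ultimately show ?thesis by simp
    qed
    finally have "real (E_nlqc a b U) \<le> real (9 * (96 * ?n) ^ d)" by (rule of_nat_mono)
    then show ?thesis using impl by auto
  qed
  then show ?thesis by (intro exI[of _ "96 :: real"] exI[of _ "9 :: real"] conjI allI impI) auto
qed

end
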